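(* Let solutions $\psi_n$ of the KG equation concentrate at the trajectory $\hat{\mathbf r}$, let $\mathbf r_n(t)$ be their adjacent ergocenters, and let $\bar\rho_\infty$ be a constant such that the restricted charges satisfy $\bar\rho_n(t)\to\bar\rho_\infty$ uniformly on $[T_-,T_+]$ (along the sequence considered). Then for any $t_0,t\in[T_-,T_+]$ $$\frac1{c^2}\bar{\mathcal E}_n(t)\partial_t\mathbf r_n(t)-\frac1{c^2}\bar{\mathcal E}_n(t_0)\partial_t\mathbf r_n(t_0)=-\int_{t_0}^t\bar\rho_\infty\nabla\varphi_\infty(t')\,dt'+\boldsymbol\delta_f,$$ where $\boldsymbol\delta_f=\boldsymbol\delta_{f,n}(t_0,t)\to0$ uniformly on $[T_-,T_+]$.
   Context: Fix constants $c>0$, $m>0$ and a real charge $q$. For parameters $\chi>0$, $a>0$ and a real electric potential $\varphi(t,\mathbf x)$, the KG equation is $-c^{-2}\tilde\partial_t^2\psi+\Delta\psi-G_a'(|\psi|^2)\psi-\kappa_0^2\psi=0$, $\tilde\partial_t=\partial_t+\mathrm i q\varphi/\chi$, $\kappa_0=mc/\chi$, with $G_a(s)=a^{-5}G_1(a^3s)$, where $G_1(0)=0$, $G_1'\in C^1((0,\infty))$, $\psi\mapsto G_1'(|\psi|^2)\psi$ extends to a $C^\alpha(\mathbb C)$ function and $\psi\mapsto G_1(|\psi|^2)$ is $C^{1+\alpha}(\mathbb C)$ for every $\alpha\in(0,1)$, and for every $C_1$ there is $C$ with $|G_1(|\psi|^2)|\le C|\psi|^{1+\alpha}$, $|G_1'(|\psi|^2)||\psi|\le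 C|\psi|^\alpha$ for $|\psi|\le C_1$. $a_C=\chi/(mc)$. Charge density $\rho=-\frac{\chi q}{mc^2}\operatorname{Im}(\psi^*\tilde\partial_t\psi)$; energy density $\mathcal E=\frac{\chi^2}{2m}[c^{-2}|\tilde\partial_t\psi|^2+|\nabla\psi|^2+G_a(|\psi|^2)+\kappa_0^2|\psi|^2]$. $\nabla_{0,\mathbf x}=(c^{-1}\partial_t,\partial_1,\partial_2,\partial_3)$. Trajectory: $\hat{\mathbf r}\in C^2([T_-,T_+];\mathbb R^3)$ with $|\partial_t\hat{\mathbf r}|,|\partial_t^2\hat{\mathbf r}|\le C$; $R_n\to0$; $\Omega_n(t)=\{|\mathbf x-\hat{\mathbf r}(t)|\le R_n\}$, $\hat\Omega_n=\{(t,\mathbf x):t\in[T_-,T_+],\mathbf x\in\Omega_n(t)\}$. Localized KG equations: $a_n\to0$, $\chi_n\to0$, $a_{C,n}/a_n\le C$, $R_n/a_n\to\infty$; $\varphi_n\in C^2(\hat\Omega_n)$ with $\sup_{\hat\Omega_n}(|\varphi_n|+|\nabla_{0,\mathbf x}\varphi_n|)\le C$; a limit $\varphi_\infty(t,\mathbf x)=\varphi_\infty(t,\hat{\mathbf r}(t))+(\mathbf x-\hat{\mathbf r}(t))\cdot\nabla\varphi_\infty(t)$ with $\sup_{\hat\Omega_n}(|\varphi_n-\varphi_\infty|+|\nabla_{0,\mathbf x}(\varphi_n-\varphi_\infty)|)\to0$ and $|\varphi_\infty(t,\hat{\mathbf r}(t))|,|\nabla\varphi_\infty(t)|,|\partial_t\nabla\varphi_\infty(t)|\le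 C$. Concentrating solutions: $\psi_n\in C^2(\hat\Omega_n)$ solving KG with $(\chi_n,a_n,\varphi_n)$ in $\hat\Omega_n$ such that (i) $\max_t\int_{\Omega_n(t)}[a_C^2|\nabla_{0,\mathbf x}\psi_n|^2+a_C^2|G_a(|\psi_n|^2)|+|\psi_n|^2]d^3x\le C$; (ii) $\max_t\int_{\partial\Omega_n(t)}[\text{same integrand}]d^2\sigma\to0$; (iii) $\bar{\mathcal E}_n(t)=\int_{\Omega_n(t)}\mathcal E_nd^3x\ge c_0>0$ for $n\ge n_0$; (iv) $\bar{\mathcal E}_n(t_0)$ converges for some $t_0$. Restricted charge $\bar\rho_n(t)=\int_{\Omega_n(t)}\rho_n d^3x$. Adjacent ergocenter $\mathbf r_n(t)=\bar{\mathcal E}_n(t)^{-1}\int_{\Omega_n(t)}\mathbf x\,\mathcal E_n\,d^3x$. *)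

theory Defs
  imports "HOL-Analysis.Analysis"
begin

text \<open>Space points are vectors in real^3; time is real. Fields are curried functions
  f t x.  Partial derivatives are two-sided derivatives (the functions to which they
  are applied are assumed C^2 on an open neighbourhood of the relevant closed set).\<close>

definition dt :: "(real \<Rightarrow> real^3 \<Rightarrow> 'b::real_normed_vector) \<Rightarrow> real \<Rightarrow> real^3 \<Rightarrow> 'b" where
  "dt f t x = vector_derivative (\<lambda>s. f s x) (at t)"

definition dx :: "3 \<Rightarrow> (real \<Rightarrow> real^3 \<Rightarrow> 'b::real_normed_vector) \<Rightarrow> real \<Rightarrow> real^3 \<Rightarrow> 'b" where
  "dx i f t x = vector_derivative (\<lambda>s. f t (x + s *\<^sub>R axis i 1)) (at 0)"

definition grad_sq :: "(real \<Rightarrow> real^3 \<Rightarrow> 'b::real_normed_vector) \<Rightarrow> real \<Rightarrow> real^3 \<Rightarrow> real" where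
  "grad_sq f t x = (\<Sum>i\<in>UNIV. (norm (dx i f t x))\<^sup>2)"

definition grad0_sq :: "real \<Rightarrow> (real \<Rightarrow> real^3 \<Rightarrow> 'b::real_normed_vector) \<Rightarrow> real \<Rightarrow> real^3 \<Rightarrow> real" where
  "grad0_sq c f t x = (norm (dt f t x))\<^sup>2 / c\<^sup>2 + grad_sq f t x"

definition lap :: "(real \<Rightarrow> real^3 \<Rightarrow> complex) \<Rightarrow> real \<Rightarrow> real^3 \<Rightarrow> complex" where
  "lap f t x = (\<Sum>i\<in>UNIV. dx i (dx i f) t x)"

definition tdt :: "real \<Rightarrow> real \<Rightarrow> (real \<Rightarrow> real^3 \<Rightarrow> real) \<Rightarrow> (real \<Rightarrow> real^3 \<Rightarrow> complex)
    \<Rightarrow> real \<Rightarrow> real^3 \<Rightarrow> complex" where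
  "tdt q chi phi psi t x = dt psi t x + \<i> * complex_of_real (q * phi t x / chi) * psi t x"

definition Ga :: "(real \<Rightarrow> real) \<Rightarrow> real \<Rightarrow> real \<Rightarrow> real" where
  "Ga G1 a s = G1 (a ^ 3 * s) / a ^ 5"

definition dGa :: "(real \<Rightarrow> real) \<Rightarrow> real \<Rightarrow> real \<Rightarrow> real" where
  "dGa dG1 a s = a ^ 3 * dG1 (a ^ 3 * s) / a ^ 5"

definition KG :: "real \<Rightarrow> real \<Rightarrow> real \<Rightarrow> real \<Rightarrow> real \<Rightarrow> (real \<Rightarrow> real)
    \<Rightarrow> (real \<Rightarrow> real^3 \<Rightarrow> real) \<Rightarrow> (real \<Rightarrow> real^3 \<Rightarrow> complex) \<Rightarrow> real \<Rightarrow> real^3 \<Rightarrow> complex" where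
  "KG c m q chi a dG1 phi psi t x =
     - tdt q chi phi (tdt q chi phi psi) t x / complex_of_real (c\<^sup>2)
     + lap psi t x
     - complex_of_real (dGa dG1 a ((cmod (psi t x))\<^sup>2)) * psi t x
     - complex_of_real ((m * c / chi)\<^sup>2) * psi t x"

definition energy_density :: "real \<Rightarrow> real \<Rightarrow> real \<Rightarrow> real \<Rightarrow> real \<Rightarrow> (real \<Rightarrow> real)
    \<Rightarrow> (real \<Rightarrow> real^3 \<Rightarrow> real) \<Rightarrow> (real \<Rightarrow> real^3 \<Rightarrow> complex) \<Rightarrow> real \<Rightarrow> real^3 \<Rightarrow> real" where
  "energy_density c m q chi a G1 phi psi t x =
     chi\<^sup>2 / (2 * m) * ((cmod (tdt q chi phi psi t x))\<^sup>2 / c\<^sup>2 + grad_sq psi t x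
        + Ga G1 a ((cmod (psi t x))\<^sup>2) + (m * c / chi)\<^sup>2 * (cmod (psi t x))\<^sup>2)"

definition charge_density :: "real \<Rightarrow> real \<Rightarrow> real \<Rightarrow> real
    \<Rightarrow> (real \<Rightarrow> real^3 \<Rightarrow> real) \<Rightarrow> (real \<Rightarrow> real^3 \<Rightarrow> complex) \<Rightarrow> real \<Rightarrow> real^3 \<Rightarrow> real" where
  "charge_density c m q chi phi psi t x =
     - (chi * q / (m * c\<^sup>2)) * Im (cnj (psi t x) * tdt q chi phi psi t x)"

definition tube :: "real \<Rightarrow> real \<Rightarrow> (real \<Rightarrow> real^3) \<Rightarrow> real \<Rightarrow> (real \<times> (real^3)) set" where
  "tube Tm Tp rhat R = {(t, x). t \<in> {Tm..Tp} \<and> x \<in> cball (rhat t) R}"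

definition C2_on :: "'a::euclidean_space set \<Rightarrow> ('a \<Rightarrow> 'b::real_normed_vector) \<Rightarrow> bool" where
  "C2_on U F \<longleftrightarrow> (\<exists>D D2. (\<forall>z\<in>U. (F has_derivative blinfun_apply (D z)) (at z))
      \<and> (\<forall>z\<in>U. (D has_derivative blinfun_apply (D2 z)) (at z)) \<and> continuous_on U D2)"

definition C2_closed :: "(real \<times> (real^3)) set \<Rightarrow> (real \<Rightarrow> real^3 \<Rightarrow> 'b::real_normed_vector) \<Rightarrow> bool" where
  "C2_closed S f \<longleftrightarrow> (\<exists>U. open U \<and> S \<subseteq> U \<and> C2_on U (\<lambda>(t, x). f t x))"

definition holder_loc :: "real \<Rightarrow> ('a::real_normed_vector \<Rightarrow> 'b::real_normed_vector) \<Rightarrow> bool" where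
  "holder_loc \<alpha> g \<longleftrightarrow> (\<forall>K. \<exists>L. \<forall>z w. norm z \<le> K \<longrightarrow> norm w \<le> K \<longrightarrow>
      norm (g z - g w) \<le> L * norm (z - w) powr \<alpha>)"

definition sphere_integral :: "real^3 \<Rightarrow> real \<Rightarrow> (real^3 \<Rightarrow> real) \<Rightarrow> real" where
  "sphere_integral x0 R g = integral (cbox (0, 0) (pi, 2 * pi))
     (\<lambda>(\<theta>, \<phi>). g (x0 + R *\<^sub>R vector [sin \<theta> * cos \<phi>, sin \<theta> * sin \<phi>, cos \<theta>]) * R\<^sup>2 * sin \<theta>)"

definition oint :: "real \<Rightarrow> real \<Rightarrow> (real \<Rightarrow> 'b::euclidean_space) \<Rightarrow> 'b" where
  "oint t0 t f = (if t0 \<le> t then integral {t0..t} f else - integral {t..t0} f)"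


definition Ebar :: "real \<Rightarrow> real \<Rightarrow> real \<Rightarrow> real \<Rightarrow> real \<Rightarrow> (real \<Rightarrow> real)
    \<Rightarrow> (real \<Rightarrow> real^3 \<Rightarrow> real) \<Rightarrow> (real \<Rightarrow> real^3 \<Rightarrow> complex) \<Rightarrow> (real \<Rightarrow> real^3) \<Rightarrow> real \<Rightarrow> real \<Rightarrow> real" where
  "Ebar c m q chi a G1 phi psi rhat R t =
     integral (cball (rhat t) R) (energy_density c m q chi a G1 phi psi t)"

definition rhobar :: "real \<Rightarrow> real \<Rightarrow> real \<Rightarrow> real
    \<Rightarrow> (real \<Rightarrow> real^3 \<Rightarrow> real) \<Rightarrow> (real \<Rightarrow> real^3 \<Rightarrow> complex) \<Rightarrow> (real \<Rightarrow> real^3) \<Rightarrow> real \<Rightarrow> real \<Rightarrow> real" where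
  "rhobar c m q chi phi psi rhat R t =
     integral (cball (rhat t) R) (charge_density c m q chi phi psi t)"

definition ergocenter :: "real \<Rightarrow> real \<Rightarrow> real \<Rightarrow> real \<Rightarrow> real \<Rightarrow> (real \<Rightarrow> real)
    \<Rightarrow> (real \<Rightarrow> real^3 \<Rightarrow> real) \<Rightarrow> (real \<Rightarrow> real^3 \<Rightarrow> complex) \<Rightarrow> (real \<Rightarrow> real^3) \<Rightarrow> real \<Rightarrow> real \<Rightarrow> real^3" where
  "ergocenter c m q chi a G1 phi psi rhat R t =
     (1 / Ebar c m q chi a G1 phi psi rhat R t) *\<^sub>R
       integral (cball (rhat t) R) (\<lambda>x. energy_density c m q chi a G1 phi psi t x *\<^sub>R x)"

definition loc_integrand :: "real \<Rightarrow> real \<Rightarrow> real \<Rightarrow> (real \<Rightarrow> real)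
    \<Rightarrow> (real \<Rightarrow> real^3 \<Rightarrow> complex) \<Rightarrow> real \<Rightarrow> real^3 \<Rightarrow> real" where
  "loc_integrand c aC a G1 psi t x =
     aC\<^sup>2 * grad0_sq c psi t x + aC\<^sup>2 * \<bar>Ga G1 a ((cmod (psi t x))\<^sup>2)\<bar> + (cmod (psi t x))\<^sup>2"

end

theory Submission
  imports Defs
begin

text \<open>
  A solution satisfies two local balance laws, one for the energy density \<open>e\<close>, whose flux is
  \<open>c\<^sup>2\<close> times the momentum density \<open>p\<close>, and one for the momentum density:
  \<open>\<partial>\<^sub>t e = - c\<^sup>2 div p - \<nabla>\<phi> \<bullet> J\<close> and \<open>\<partial>\<^sub>t p\<^sub>j = - \<partial>\<^sub>i T\<^sub>i\<^sub>j - \<rho> \<partial>\<^sub>j \<phi>\<close>.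
  All densities are bounded by a constant, independent of \<open>n\<close>, times the integrand of the
  concentration conditions.  Integrate over the moving ball; every divergence becomes an
  integral over the sphere and is therefore small.  The energy law, multiplied by the distance
  to the ergocenter (which is of order \<open>R\<^sub>n\<close>), says that \<open>E \<partial>\<^sub>t r / c\<^sup>2\<close> equals the total momentum up
  to a small error.  The momentum law says that the time derivative of the total momentum is
  \<open>- \<rho>\<^sub>\<infinity> \<nabla>\<phi>\<^sub>\<infinity>\<close> up to a small error.
\<close>

text \<open>The work term of the energy law is bounded but not small. It becomes negligible because
  the law is weighted with the offset from the ergocenter frozen at the time under consideration.
  The boundary condition speaks of an explicit integral in two angles. The divergence theorem is
  therefore proved in exactly these coordinates, and the same coordinates centred at
  \<open>rhat t\<close> turn the moving ball into a fixed domain, so that differentiation in time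
  can be done under the integral sign. Second derivatives are given as derivatives of a derivative.
  Both balance laws exchange a time and a space derivative, which is why symmetry has to be
  established beforehand. For a fixed index every small quantity is bounded by one number
  \<open>d\<close>. The final error is \<open>d\<close> times a constant that depends neither on the
  index nor on the two times; this gives the uniformity.\<close>

section \<open>Symmetry of the second derivative\<close>

text \<open>The mean value theorem is applied twice in one variable: along \<open>u\<close> to the
  difference in direction \<open>v\<close>, then along \<open>v\<close> to the derivative in
  direction \<open>u\<close>. The left side is the mixed second difference over a parallelogram,
  which does not change when \<open>u\<close> and \<open>v\<close> are exchanged.\<close>

lemma second_difference_mvt:
  fixes f :: "'a::real_normed_vector \<Rightarrow> real"
  assumes D: "\<And>w. w \<in> U \<Longrightarrow> (f has_derivative blinfun_apply (D w)) (at w)"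
    and D2: "\<And>w. w \<in> U \<Longrightarrow> (D has_derivative blinfun_apply (D2 w)) (at w)"
    and h: "0 < h"
    and par: "\<And>s t. 0 \<le> s \<Longrightarrow> s \<le> h \<Longrightarrow> 0 \<le> t \<Longrightarrow> t \<le> h \<Longrightarrow> z + s *\<^sub>R u + t *\<^sub>R v \<in> U"
  shows "\<exists>s t. 0 \<le> s \<and> s \<le> h \<and> 0 \<le> t \<and> t \<le> h \<and>
    f (z + h *\<^sub>R u + h *\<^sub>R v) - f (z + h *\<^sub>R u) - f (z + h *\<^sub>R v) + f z
      = h\<^sup>2 * blinfun_apply (D2 (z + s *\<^sub>R u + t *\<^sub>R v) v) u"
proof -
  define F where "F s = f (z + s *\<^sub>R u + h *\<^sub>R v) - f (z + s *\<^sub>R u)" for s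
  have par0: "z + s *\<^sub>R u \<in> U" if "0 \<le> s" "s \<le> h" for s
    using par[of s 0] that h by simp
  have "\<exists>s. 0 < s \<and> s < h \<and> F h - F 0 = (h - 0) * (D (z + s *\<^sub>R u + h *\<^sub>R v) u - D (z + s *\<^sub>R u) u)"
  proof (rule MVT2[OF h])
    fix s assume s: "0 \<le> s" "s \<le> h"
    have 1: "((\<lambda>s. f (z + s *\<^sub>R u + h *\<^sub>R v)) has_derivative (\<lambda>k. D (z + s *\<^sub>R u + h *\<^sub>R v) (k *\<^sub>R u))) (at s)"
      by (rule has_derivative_compose[of "\<lambda>s. z + s *\<^sub>R u + h *\<^sub>R v" "\<lambda>k. k *\<^sub>R u" s UNIV f])
         (use par[of s h] s h in \<open>auto intro!: D derivative_eq_intros\<close>)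
    have 2: "((\<lambda>s. f (z + s *\<^sub>R u)) has_derivative (\<lambda>k. D (z + s *\<^sub>R u) (k *\<^sub>R u))) (at s)"
      by (rule has_derivative_compose[of "\<lambda>s. z + s *\<^sub>R u" "\<lambda>k. k *\<^sub>R u" s UNIV f])
         (use par0[of s] s h in \<open>auto intro!: D derivative_eq_intros\<close>)
    show "(F has_real_derivative D (z + s *\<^sub>R u + h *\<^sub>R v) u - D (z + s *\<^sub>R u) u) (at s)"
      unfolding has_field_derivative_def F_def
      by (rule has_derivative_eq_rhs[OF has_derivative_diff[OF 1 2]])
         (auto simp: blinfun.scaleR_right algebra_simps)
  qed
  then obtain s where s: "0 < s" "s < h" and Fs: "F h - F 0 = h * (D (z + s *\<^sub>R u + h *\<^sub>R v) u - D (z + s *\<^sub>R u) u)"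
    by auto
  have "\<exists>t. 0 < t \<and> t < h \<and> D (z + s *\<^sub>R u + h *\<^sub>R v) u - D (z + s *\<^sub>R u + 0 *\<^sub>R v) u
      = (h - 0) * D2 (z + s *\<^sub>R u + t *\<^sub>R v) v u"
  proof (rule MVT2[OF h])
    fix t assume t: "0 \<le> t" "t \<le> h"
    have "((\<lambda>t. D (z + s *\<^sub>R u + t *\<^sub>R v)) has_derivative (\<lambda>k. D2 (z + s *\<^sub>R u + t *\<^sub>R v) (k *\<^sub>R v))) (at t)"
      by (rule has_derivative_compose[of "\<lambda>t. z + s *\<^sub>R u + t *\<^sub>R v" "\<lambda>k. k *\<^sub>R v" t UNIV D])
         (use par[of s t] s t in \<open>auto intro!: D2 derivative_eq_intros\<close>)
    from bounded_linear.has_derivative[OF blinfun.bounded_linear_left this, of u]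
    show "((\<lambda>t. D (z + s *\<^sub>R u + t *\<^sub>R v) u) has_real_derivative D2 (z + s *\<^sub>R u + t *\<^sub>R v) v u) (at t)"
      unfolding has_field_derivative_def
      by (rule has_derivative_eq_rhs) (auto simp: blinfun.scaleR_right blinfun.scaleR_left)
  qed
  then obtain t where t: "0 < t" "t < h"
    and "D (z + s *\<^sub>R u + h *\<^sub>R v) u - D (z + s *\<^sub>R u) u = h * D2 (z + s *\<^sub>R u + t *\<^sub>R v) v u"
    by auto
  with Fs have "F h - F 0 = h\<^sup>2 * D2 (z + s *\<^sub>R u + t *\<^sub>R v) v u"
    by (simp add: power2_eq_square)
  moreover have "F h - F 0 = f (z + h *\<^sub>R u + h *\<^sub>R v) - f (z + h *\<^sub>R u) - f (z + h *\<^sub>R v) + f z"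
    by (simp add: F_def)
  ultimately show ?thesis using s t by (intro exI[of _ s] exI[of _ t]) auto
qed

text \<open>The mixed second difference equals \<open>h\<^sup>2\<close> times a mixed derivative at
  some point of the parallelogram, in either order of differentiation. Shrinking the parallelogram
  and using continuity of \<open>D2\<close> at \<open>z\<close> brings both values within any
  \<open>e\<close> of each other.\<close>

lemma second_derivative_symmetric_real:
  fixes f :: "'a::real_normed_vector \<Rightarrow> real"
  assumes D: "\<And>w. w \<in> U \<Longrightarrow> (f has_derivative blinfun_apply (D w)) (at w)"
    and D2: "\<And>w. w \<in> U \<Longrightarrow> (D has_derivative blinfun_apply (D2 w)) (at w)"
    and cont: "continuous_on U D2" and U: "open U" and z: "z \<in> U"
  shows "blinfun_apply (D2 z u) v = blinfun_apply (D2 z v) u"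
proof -
  have close: "\<exists>d>0. \<forall>w. norm (w - z) < d \<longrightarrow> w \<in> U \<and> \<bar>D2 w a b - D2 z a b\<bar> < e"
    if "e > 0" for a b e
  proof -
    have "continuous_on U (\<lambda>w. D2 w a b)"
      by (intro continuous_intros cont)
    then have "isCont (\<lambda>w. D2 w a b) z"
      using U z continuous_on_eq_continuous_at by blast
    then have "\<forall>\<^sub>F w in nhds z. dist (D2 w a b) (D2 z a b) < e"
      using that by (auto simp: isCont_def tendsto_iff eventually_at_filter elim!: eventually_mono)
    moreover have "\<forall>\<^sub>F w in nhds z. w \<in> U"
      using U z eventually_nhds by blast
    ultimately have "\<forall>\<^sub>F w in nhds z. w \<in> U \<and> dist (D2 w a b) (D2 z a b) < e"
      by eventually_elim auto
    then show ?thesis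
      unfolding eventually_nhds_metric by (auto simp: dist_norm)
  qed
  have "\<bar>D2 z u v - D2 z v u\<bar> \<le> e" if e: "e > 0" for e
  proof -
    from close[of "e/2"] e obtain d1 where d1: "d1 > 0"
      "\<And>w. norm (w - z) < d1 \<Longrightarrow> w \<in> U \<and> \<bar>D2 w v u - D2 z v u\<bar> < e/2" by (metis half_gt_zero)
    from close[of "e/2"] e obtain d2 where d2: "d2 > 0"
      "\<And>w. norm (w - z) < d2 \<Longrightarrow> w \<in> U \<and> \<bar>D2 w u v - D2 z u v\<bar> < e/2" by (metis half_gt_zero)
    define d where "d = min d1 d2"
    \<comment> \<open>With this size the whole parallelogram stays within distance \<open>d\<close>
      of \<open>z\<close>. The summand 1 keeps the denominator positive when both directions are
      zero.\<close>
    define h where "h = d / (2 * (norm u + norm v + 1))"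
    have dp: "d > 0" using d1 d2 by (simp add: d_def)
    have den: "norm u + norm v + 1 > 0" by (smt (verit) norm_ge_zero)
    have hp: "h > 0" using dp den by (simp add: h_def)
    have hd: "h * (norm u + norm v) < d"
    proof -
      have "h * (norm u + norm v) \<le> h * (norm u + norm v + 1)" using hp by simp
      also have "\<dots> = d / 2" using den by (simp add: h_def field_simps)
      finally show ?thesis using dp by simp
    qed
    have small: "norm (z + s *\<^sub>R a + t *\<^sub>R b - z) < d"
      if "0 \<le> s" "s \<le> h" "0 \<le> t" "t \<le> h" "norm a + norm b = norm u + norm v" for s t a b
    proof -
      have "norm (s *\<^sub>R a + t *\<^sub>R b) \<le> s * norm a + t * norm b"
        using norm_triangle_ineq[of "s *\<^sub>R a" "t *\<^sub>R b"] that by simp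
      also have "\<dots> \<le> h * norm a + h * norm b"
        using that by (intro add_mono mult_right_mono) auto
      also have "\<dots> < d" using hd that by (simp add: distrib_left[symmetric])
      finally show ?thesis by (simp add: add.assoc)
    qed
    have inU: "w \<in> U" if "norm (w - z) < d" for w using d1(2)[of w] that by (simp add: d_def)
    obtain s t where st: "0 \<le> s" "s \<le> h" "0 \<le> t" "t \<le> h"
      and e1: "f (z + h *\<^sub>R u + h *\<^sub>R v) - f (z + h *\<^sub>R u) - f (z + h *\<^sub>R v) + f z
        = h\<^sup>2 * D2 (z + s *\<^sub>R u + t *\<^sub>R v) v u"
      using second_difference_mvt[OF D D2 hp, of U z u v] inU[OF small] by fastforce
    obtain s' t' where st': "0 \<le> s'" "s' \<le> h" "0 \<le> t'" "t' \<le> h"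
      and e2: "f (z + h *\<^sub>R v + h *\<^sub>R u) - f (z + h *\<^sub>R v) - f (z + h *\<^sub>R u) + f z
        = h\<^sup>2 * D2 (z + s' *\<^sub>R v + t' *\<^sub>R u) u v"
      using second_difference_mvt[OF D D2 hp, of U z v u] inU[OF small] by (fastforce simp: add.commute)
    have "h\<^sup>2 * D2 (z + s *\<^sub>R u + t *\<^sub>R v) v u = h\<^sup>2 * D2 (z + s' *\<^sub>R v + t' *\<^sub>R u) u v"
      using e1 e2 by (simp add: algebra_simps)
    then have "D2 (z + s *\<^sub>R u + t *\<^sub>R v) v u = D2 (z + s' *\<^sub>R v + t' *\<^sub>R u) u v"
      using hp by simp
    moreover have "\<bar>D2 (z + s *\<^sub>R u + t *\<^sub>R v) v u - D2 z v u\<bar> < e/2"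
      using d1(2) small[OF st, of u v] by (simp add: d_def)
    moreover have "\<bar>D2 (z + s' *\<^sub>R v + t' *\<^sub>R u) u v - D2 z u v\<bar> < e/2"
      using d2(2) small[OF st', of v u] by (simp add: d_def)
    ultimately show ?thesis by linarith
  qed
  then show ?thesis
    by (metis abs_le_zero_iff eq_iff_diff_eq_0 field_le_epsilon add_0)
qed

text \<open>Reduction to the real case, one coordinate at a time. The second derivative of the
  coordinate \<open>f w \<bullet> b\<close> is \<open>D2\<close> followed by the inner product with
  \<open>b\<close>; it is wrapped as a bounded linear map into bounded linear maps so that it has
  the type required there.\<close>

lemma second_derivative_symmetric:
  fixes f :: "'a::real_normed_vector \<Rightarrow> 'b::euclidean_space"
  assumes D: "\<And>w. w \<in> U \<Longrightarrow> (f has_derivative blinfun_apply (D w)) (at w)"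
    and D2: "\<And>w. w \<in> U \<Longrightarrow> (D has_derivative blinfun_apply (D2 w)) (at w)"
    and cont: "continuous_on U D2" and U: "open U" and z: "z \<in> U"
  shows "blinfun_apply (D2 z u) v = blinfun_apply (D2 z v) u"
proof (rule euclidean_eqI)
  fix b :: 'b assume "b \<in> Basis"
  let ?B = "blinfun_inner_left b"
  let ?DD = "\<lambda>w. ?B o\<^sub>L D w"
  let ?D2 = "\<lambda>w. Blinfun (\<lambda>h. ?B o\<^sub>L D2 w h)"
  have bl: "bounded_linear (\<lambda>h. ?B o\<^sub>L D2 w h)" for w
    by (intro bounded_linear_compose[OF bounded_bilinear.bounded_linear_right[OF bounded_bilinear_blinfun_compose]]
        blinfun.bounded_linear_right)
  have ap: "blinfun_apply (?D2 w) h = ?B o\<^sub>L D2 w h" for w h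
    by (simp add: bounded_linear_Blinfun_apply[OF bl])
  have "blinfun_apply (?D2 z u) v = blinfun_apply (?D2 z v) u"
  proof (rule second_derivative_symmetric_real[OF _ _ _ U z, of "\<lambda>w. f w \<bullet> b" ?DD])
    fix w assume w: "w \<in> U"
    show "((\<lambda>w. f w \<bullet> b) has_derivative blinfun_apply (?DD w)) (at w)"
      by (rule has_derivative_eq_rhs[OF has_derivative_inner_left[OF D[OF w]]]) (auto simp: inner_commute)
    show "(?DD has_derivative blinfun_apply (?D2 w)) (at w)"
      by (rule has_derivative_eq_rhs[OF bounded_linear.has_derivative[OF
           bounded_bilinear.bounded_linear_right[OF bounded_bilinear_blinfun_compose] D2[OF w]]])
         (auto simp: ap)
  next
    have eq: "?D2 w = (Blinfun (\<lambda>C. ?B o\<^sub>L C)) o\<^sub>L D2 w" for w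
      by (rule blinfun_eqI) (simp add: ap bounded_linear_Blinfun_apply
          bounded_bilinear.bounded_linear_right[OF bounded_bilinear_blinfun_compose])
    show "continuous_on U ?D2"
      unfolding eq by (intro continuous_intros cont)
  qed
  then show "D2 z u v \<bullet> b = D2 z v u \<bullet> b" by (simp add: ap inner_commute)
qed

section \<open>Spherical coordinates\<close>

text \<open>The unit vector that \<open>sphere_integral\<close> writes out, with colatitude
  \<open>\<theta>\<close> and azimuth \<open>\<phi>\<close>.\<close>

definition sph_dir :: "real \<Rightarrow> real \<Rightarrow> real^3" where
  "sph_dir \<theta> \<phi> = vector [sin \<theta> * cos \<phi>, sin \<theta> * sin \<phi>, cos \<theta>]"

lemma sph_dir_component [simp]:
  "sph_dir \<theta> \<phi> $ 1 = sin \<theta> * cos \<phi>" "sph_dir \<theta> \<phi> $ 2 = sin \<theta> * sin \<phi>" "sph_dir \<theta> \<phi> $ 3 = cos \<theta>"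
  by (simp_all add: sph_dir_def)

lemma vec3_eqI:
  fixes x y :: "'a^3"
  shows "x $ 1 = y $ 1 \<Longrightarrow> x $ 2 = y $ 2 \<Longrightarrow> x $ 3 = y $ 3 \<Longrightarrow> x = y"
  by (simp add: vec_eq_iff forall_3)

lemma norm_sph_dir [simp]: "norm (sph_dir \<theta> \<phi>) = 1"
proof -
  have "(norm (sph_dir \<theta> \<phi>))\<^sup>2 = (sin \<theta>)\<^sup>2 * ((cos \<phi>)\<^sup>2 + (sin \<phi>)\<^sup>2) + (cos \<theta>)\<^sup>2"
    by (simp only: power2_norm_eq_inner inner_vec_def sum_3)
       (simp add: power2_eq_square algebra_simps del: sin_cos_squared_add sin_cos_squared_add2 sin_cos_squared_add3)
  also have "\<dots> = 1" by (simp only: sin_cos_squared_add sin_cos_squared_add2 mult_1_right)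
  finally show ?thesis using norm_ge_zero[of "sph_dir \<theta> \<phi>"] by (smt (verit) power2_eq_1_iff)
qed

lemma sph_dir_alt:
  "sph_dir \<theta> \<phi> = (sin \<theta> * cos \<phi>) *\<^sub>R axis 1 1 + (sin \<theta> * sin \<phi>) *\<^sub>R axis 2 1 + cos \<theta> *\<^sub>R axis 3 1"
  by (rule vec3_eqI) (simp_all add: axis_def)

lemma continuous_on_sph_dir [continuous_intros]:
  fixes f g :: "'a::t2_space \<Rightarrow> real"
  assumes "continuous_on S f" "continuous_on S g"
  shows "continuous_on S (\<lambda>x. sph_dir (f x) (g x))"
  unfolding sph_dir_alt by (intro continuous_intros assms)

text \<open>The third component determines \<open>\<theta>\<close> because the cosine is injective
  on the interval from 0 to \<open>pi\<close>. Then \<open>sin \<theta>\<close> is positive and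
  cancels, and the remaining freedom of a multiple of \<open>2 * pi\<close> in \<open>\<phi>\<close>
  is excluded by the length of the interval.\<close>

lemma sph_dir_inj:
  assumes "0 < \<theta>" "\<theta> < pi" "0 < \<theta>'" "\<theta>' < pi" "0 < \<phi>" "\<phi> < 2 * pi" "0 < \<phi>'" "\<phi>' < 2 * pi"
    and eq: "sph_dir \<theta> \<phi> = sph_dir \<theta>' \<phi>'"
  shows "\<theta> = \<theta>' \<and> \<phi> = \<phi>'"
proof -
  have ct: "cos \<theta> = cos \<theta>'" using arg_cong[OF eq, of "\<lambda>v. v $ 3"] by simp
  have th: "\<theta> = \<theta>'" by (rule cos_inj_pi[OF _ _ _ _ ct]) (use assms(1-4) in linarith)+
  have "sin \<theta> > 0" by (rule sin_gt_zero[OF assms(1,2)])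
  with arg_cong[OF eq, of "\<lambda>v. v $ 1"] arg_cong[OF eq, of "\<lambda>v. v $ 2"] th
  have "cos \<phi> = cos \<phi>'" "sin \<phi> = sin \<phi>'" by simp_all
  then obtain k :: int where k: "\<phi> = \<phi>' + 2 * pi * k" using sin_cos_eq_iff by blast
  then have kk: "pi * (2 * real_of_int k) = \<phi> - \<phi>'" by simp
  have "pi * (2 * real_of_int k) < pi * 2" "pi * (- 2) < pi * (2 * real_of_int k)"
    unfolding kk using assms(5-8) by linarith+
  then have "2 * real_of_int k < 2" "- 2 < 2 * real_of_int k"
    using mult_less_cancel_left_pos[OF pi_gt_zero] by blast+
  then have "k = 0" by simp
  with th k show ?thesis by simp
qed

text \<open>The plane where the second component vanishes contains the polar axis and the half plane
  \<open>\<phi> = 0\<close>, the places not reached by the open coordinate ranges. It is a null set,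
  so integrals over the ball do not see it.\<close>

lemma sph_dir_surj:
  fixes x :: "real^3"
  assumes x: "x $ 2 \<noteq> 0"
  obtains \<theta> \<phi> where "0 < \<theta>" "\<theta> < pi" "0 < \<phi>" "\<phi> < 2 * pi" "x = norm x *\<^sub>R sph_dir \<theta> \<phi>"
proof -
  define r where "r = norm x"
  have n2: "r\<^sup>2 = (x$1)\<^sup>2 + (x$2)\<^sup>2 + (x$3)\<^sup>2"
    unfolding r_def power2_norm_eq_inner by (simp add: inner_vec_def sum_3 power2_eq_square)
  have x2: "(x$2)\<^sup>2 > 0" using x by simp
  have r: "r > 0" using x by (auto simp: r_def)
  have "(x$3)\<^sup>2 < r\<^sup>2" using x2 n2 by (smt (verit) zero_le_power2)
  then have x3: "\<bar>x$3\<bar> < r" using r abs_le_square_iff[of r "x$3"] by (simp add: not_le[symmetric])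
  define \<theta> where "\<theta> = arccos (x$3 / r)"
  have b: "-1 < x$3 / r" "x$3 / r < 1" using x3 r by (auto simp: field_simps)
  have th: "0 < \<theta>" "\<theta> < pi" unfolding \<theta>_def using arccos_lt_bounded[OF b] by auto
  have ct: "cos \<theta> = x$3 / r" unfolding \<theta>_def using b by simp
  have st: "sin \<theta> > 0" using th by (simp add: sin_gt_zero)
  have "(r * sin \<theta>)\<^sup>2 = r\<^sup>2 - (x$3)\<^sup>2"
    using r by (simp add: power_mult_distrib sin_squared_eq ct field_simps)
  then have rs: "(r * sin \<theta>)\<^sup>2 = (x$1)\<^sup>2 + (x$2)\<^sup>2" using n2 by simp
  have "(x$1 / (r * sin \<theta>))\<^sup>2 + (x$2 / (r * sin \<theta>))\<^sup>2 = 1"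
    using rs r st x by (simp add: power_divide add_divide_distrib[symmetric])
  then obtain \<phi> where p: "0 \<le> \<phi>" "\<phi> < 2 * pi" "x$1 / (r * sin \<theta>) = cos \<phi>" "x$2 / (r * sin \<theta>) = sin \<phi>"
    by (rule sincos_total_2pi)
  have c: "x$1 = r * (sin \<theta> * cos \<phi>)" "x$2 = r * (sin \<theta> * sin \<phi>)" "x$3 = r * cos \<theta>"
    using p r st ct by (simp_all add: field_simps)
  then have "\<phi> \<noteq> 0" using x by auto
  moreover have "x = r *\<^sub>R sph_dir \<theta> \<phi>" by (rule vec3_eqI) (simp_all add: c)
  ultimately show ?thesis using that[of \<theta> \<phi>] th p by (simp add: r_def)
qed

text \<open>The coordinates \<open>(r, \<theta>, \<phi>)\<close> are packed into one vector, so that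
  this is a map of \<open>real^3\<close> into itself with a Jacobian matrix.\<close>

definition sph_map :: "real^3 \<Rightarrow> real^3" where
  "sph_map p = p$1 *\<^sub>R sph_dir (p$2) (p$3)"

definition sph_map_deriv :: "real^3 \<Rightarrow> real^3 \<Rightarrow> real^3" where
  "sph_map_deriv p h = vector [
      h$1 * (sin (p$2) * cos (p$3)) + p$1 * (cos (p$2) * h$2 * cos (p$3) - sin (p$2) * sin (p$3) * h$3),
      h$1 * (sin (p$2) * sin (p$3)) + p$1 * (cos (p$2) * h$2 * sin (p$3) + sin (p$2) * cos (p$3) * h$3),
      h$1 * cos (p$2) - p$1 * sin (p$2) * h$2]"

lemma sph_map_has_derivative: "(sph_map has_derivative sph_map_deriv p) (at p within S)"
proof -
  have [derivative_intros]: "((\<lambda>x::real^3. x $ i) has_derivative (\<lambda>h. h $ i)) (at p within S)" for i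
    by (rule bounded_linear_imp_has_derivative[OF bounded_linear_vec_nth])
  show ?thesis
    unfolding sph_map_def[abs_def] sph_dir_alt
    by (auto intro!: derivative_eq_intros vec3_eqI ext simp: sph_map_deriv_def axis_def algebra_simps)
qed

lemma det_sph_map_deriv: "det (matrix (sph_map_deriv p)) = (p$1)\<^sup>2 * sin (p$2)"
proof -
  \<comment> \<open>The two Pythagorean factors are left unevaluated: in this form the determinant
    is a polynomial identity in the sines and cosines.\<close>
  have "det (matrix (sph_map_deriv p)) = (p$1)\<^sup>2 * sin (p$2) *
     (((cos (p$2))\<^sup>2 + (sin (p$2))\<^sup>2) * ((cos (p$3))\<^sup>2 + (sin (p$3))\<^sup>2))"
    unfolding det_3 by (simp add: matrix_def sph_map_deriv_def axis_def del: sin_cos_squared_add sin_cos_squared_add2) algebra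
  then show ?thesis by (simp only: sin_cos_squared_add sin_cos_squared_add2 mult_1_right)
qed

section \<open>Transfer of integrals from \<open>real^3\<close> to a product of three lines\<close>

lemma prod_Basis_real3:
  "(\<Prod>b\<in>Basis. (p :: real \<times> real \<times> real) \<bullet> b) = fst p * fst (snd p) * snd (snd p)"
proof -
  have B: "(Basis :: (real \<times> real \<times> real) set) = {(1,0,0), (0,1,0), (0,0,1)}"
    by (auto simp: Basis_prod_def zero_prod_def)
  show ?thesis unfolding B by (cases p) (simp add: mult.assoc)
qed

text \<open>Lebesgue measure is determined by its values on boxes, and regrouping coordinates
  preserves the volume of a box. The change of variables takes place in \<open>real^3\<close>,
  whereas iterated integration works on the product type; this identity joins the two.\<close>

lemma lborel_vec3_prod:
  "distr lborel borel (\<lambda>(r::real, s::real, t::real). vector [r, s, t] :: real^3) = lborel"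
proof (rule lborel_eqI[symmetric])
  let ?h = "\<lambda>(r::real, s::real, t::real). vector [r, s, t] :: real^3"
  have heq: "?h = (\<lambda>p. fst p *\<^sub>R axis 1 1 + fst (snd p) *\<^sub>R axis 2 1 + snd (snd p) *\<^sub>R axis 3 1)"
    by (auto intro!: ext vec3_eqI simp: axis_def)
  have "continuous_on UNIV ?h" unfolding heq by (intro continuous_intros)
  then have meas: "?h \<in> borel_measurable borel" by (rule borel_measurable_continuous_onI)
  then have meas': "?h \<in> borel_measurable lborel" by simp
  fix l u :: "real^3" assume le: "\<And>b. b \<in> Basis \<Longrightarrow> l \<bullet> b \<le> u \<bullet> b"
  have lei: "l $ i \<le> u $ i" for i
    using le[of "axis i 1"] by (simp add: inner_axis axis_in_Basis_iff)
  have B: "?h -` box l u = box (l$1, l$2, l$3) (u$1, u$2, u$3)"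
    by (auto simp: mem_box_cart forall_3 mem_box Basis_prod_def)
  have "emeasure (distr lborel borel ?h) (box l u) = emeasure lborel (?h -` box l u)"
    by (subst emeasure_distr) (use meas' in auto)
  also have "\<dots> = (\<Prod>b\<in>Basis. ((u$1, u$2, u$3) - (l$1, l$2, l$3)) \<bullet> b)"
    unfolding B using lei by (intro emeasure_lborel_box) (auto simp: Basis_prod_def)
  also have "(\<Prod>b\<in>Basis. ((u$1, u$2, u$3) - (l$1, l$2, l$3)) \<bullet> b) = (u$1 - l$1) * (u$2 - l$2) * (u$3 - l$3)"
    by (simp only: prod_Basis_real3 fst_conv snd_conv diff_Pair)
  also have "\<dots> = (\<Prod>b\<in>Basis. (u - l) \<bullet> b)"
  proof -
    have B3: "(Basis :: (real^3) set) = {axis 1 1, axis 2 1, axis 3 1}"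
      by (auto simp: Basis_vec_def UNIV_3)
    show ?thesis unfolding B3 by (simp add: axis_eq_axis inner_axis)
  qed
  finally show "emeasure (distr lborel borel ?h) (box l u) = ennreal (\<Prod>b\<in>Basis. (u - l) \<bullet> b)" by simp
qed simp

lemma integral_cbox_vec3:
  fixes F :: "real^3 \<Rightarrow> real"
  assumes F: "continuous_on (cbox l u) F"
  shows "integral (cbox l u) F =
    integral (cbox (l$1, l$2, l$3) (u$1, u$2, u$3)) (\<lambda>(r, s, t). F (vector [r, s, t]))"
proof -
  let ?h = "\<lambda>(r::real, s::real, t::real). vector [r, s, t] :: real^3"
  let ?C = "cbox (l$1, l$2, l$3) (u$1, u$2, u$3)"
  have heq: "?h = (\<lambda>p. fst p *\<^sub>R axis 1 1 + fst (snd p) *\<^sub>R axis 2 1 + snd (snd p) *\<^sub>R axis 3 1)"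
    by (auto intro!: ext vec3_eqI simp: axis_def)
  have hc: "continuous_on UNIV ?h" unfolding heq by (intro continuous_intros)
  then have meas: "?h \<in> borel_measurable lborel" by (simp add: borel_measurable_continuous_onI)
  have mem: "?h p \<in> cbox l u \<longleftrightarrow> p \<in> ?C" for p
    by (cases p) (auto simp: mem_box_cart forall_3 cbox_Pair_eq)
  have Fi: "integrable lborel (\<lambda>x. indicator (cbox l u) x *\<^sub>R F x)"
    by (rule borel_integrable_compact[OF compact_cbox F])
  have c2: "continuous_on ?C (F \<circ> ?h)"
    by (intro continuous_on_compose continuous_on_subset[OF hc] continuous_on_subset[OF F])
       (use mem in auto)
  have Fi2: "integrable lborel (\<lambda>x. indicator ?C x *\<^sub>R (F \<circ> ?h) x)"
    by (rule borel_integrable_compact[OF compact_cbox c2])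
  have "integral (cbox l u) F = integral\<^sup>L lborel (\<lambda>x. indicator (cbox l u) x *\<^sub>R F x)"
    using set_borel_integral_eq_integral(2)[of "cbox l u" F] Fi
    by (simp add: set_integrable_def set_lebesgue_integral_def)
  also have "\<dots> = integral\<^sup>L (distr lborel borel ?h) (\<lambda>x. indicator (cbox l u) x *\<^sub>R F x)"
    by (simp only: lborel_vec3_prod)
  also have "\<dots> = integral\<^sup>L lborel (\<lambda>p. indicator (cbox l u) (?h p) *\<^sub>R F (?h p))"
    by (rule integral_distr) (use meas Fi in auto)
  also have "\<dots> = integral\<^sup>L lborel (\<lambda>p. indicator ?C p *\<^sub>R (F \<circ> ?h) p)"
    using mem by (intro Bochner_Integration.integral_cong) (auto simp: indicator_def)
  also have "\<dots> = integral ?C (F \<circ> ?h)"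
    using set_borel_integral_eq_integral(2)[of ?C "F \<circ> ?h"] Fi2
    by (simp add: set_integrable_def set_lebesgue_integral_def)
  also have "F \<circ> ?h = (\<lambda>(r, s, t). F (vector [r, s, t]))" by (auto simp: fun_eq_iff)
  finally show ?thesis .
qed

text \<open>The coordinate map is injective on the open box, with Jacobian
  \<open>r\<^sup>2 * sin \<theta>\<close>. Its image misses only the sphere and points of the plane
  through the centre where the second coordinate agrees with that of \<open>x0\<close>, hence a null
  set. Continuity of the integrand then allows passing to the closed box of the product
  type.\<close>

lemma integral_cball_spherical:
  fixes f :: "real^3 \<Rightarrow> real"
  assumes f: "continuous_on (cball x0 R) f" and R: "R > 0"
  shows "integral (cball x0 R) f = integral (cbox (0, 0, 0) (R, pi, 2 * pi))
     (\<lambda>(r, \<theta>, \<phi>). r\<^sup>2 * sin \<theta> * f (x0 + r *\<^sub>R sph_dir \<theta> \<phi>))"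
proof -
  let ?u = "vector [R, pi, 2 * pi] :: real^3"
  let ?S = "box 0 ?u"
  let ?g = "\<lambda>p. x0 + sph_map p"
  have mem: "p \<in> ?S \<longleftrightarrow> 0 < p$1 \<and> p$1 < R \<and> 0 < p$2 \<and> p$2 < pi \<and> 0 < p$3 \<and> p$3 < 2 * pi" for p
    by (auto simp: mem_box_cart forall_3)
  have memc: "p \<in> cbox 0 ?u \<longleftrightarrow> 0 \<le> p$1 \<and> p$1 \<le> R \<and> 0 \<le> p$2 \<and> p$2 \<le> pi \<and> 0 \<le> p$3 \<and> p$3 \<le> 2 * pi" for p
    by (auto simp: mem_box_cart forall_3)
  have img: "?g ` ?S \<subseteq> cball x0 R" by (auto simp: mem sph_map_def dist_norm)
  have neg: "negligible (cball x0 R - ?g ` ?S)"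
  proof (rule negligible_subset)
    show "negligible ({x. axis 2 1 \<bullet> x = x0 $ 2} \<union> sphere x0 R)"
      by (intro negligible_Un negligible_hyperplane negligible_sphere) (auto simp: axis_eq_0_iff)
    show "cball x0 R - ?g ` ?S \<subseteq> {x. axis 2 1 \<bullet> x = x0 $ 2} \<union> sphere x0 R"
    proof
      fix x assume x: "x \<in> cball x0 R - ?g ` ?S"
      show "x \<in> {x. axis 2 1 \<bullet> x = x0 $ 2} \<union> sphere x0 R"
      proof (rule ccontr)
        assume "x \<notin> {x. axis 2 1 \<bullet> x = x0 $ 2} \<union> sphere x0 R"
        then have n: "(x - x0) $ 2 \<noteq> 0" and l: "norm (x - x0) < R"
          using x by (auto simp: inner_axis' dist_norm norm_minus_commute)
        from n obtain \<theta> \<phi> where p: "0 < \<theta>" "\<theta> < pi" "0 < \<phi>" "\<phi> < 2 * pi"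
          "x - x0 = norm (x - x0) *\<^sub>R sph_dir \<theta> \<phi>" by (rule sph_dir_surj)
        have "norm (x - x0) > 0" using n by auto
        then have "vector [norm (x - x0), \<theta>, \<phi>] \<in> ?S" using p l by (simp add: mem)
        moreover have "?g (vector [norm (x - x0), \<theta>, \<phi>]) = x" using p(5) by (simp add: sph_map_def)
        ultimately show False using x by (metis DiffD2 image_eqI)
      qed
    qed
  qed
  have inj: "inj_on ?g ?S"
  proof (rule inj_onI)
    fix p p' assume p: "p \<in> ?S" "p' \<in> ?S" and "?g p = ?g p'"
    then have eq: "p$1 *\<^sub>R sph_dir (p$2) (p$3) = p'$1 *\<^sub>R sph_dir (p'$2) (p'$3)" by (simp add: sph_map_def)
    from arg_cong[OF eq, of norm] p have 1: "p$1 = p'$1" by (simp add: mem)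
    then have "sph_dir (p$2) (p$3) = sph_dir (p'$2) (p'$3)" using eq p by (simp add: mem)
    from sph_dir_inj[OF _ _ _ _ _ _ _ _ this] p 1 show "p = p'" by (intro vec3_eqI) (auto simp: mem)
  qed
  have der: "(?g has_derivative sph_map_deriv p) (at p within ?S)" for p
    using has_derivative_add[OF has_derivative_const[of x0] sph_map_has_derivative[of p ?S]]
    by (simp only: add_0)
  \<comment> \<open>The change of variables is carried out for a function with values in the vector
    type \<open>real^1\<close>; its single component gives back \<open>f\<close>.\<close>
  let ?F = "\<lambda>x. vec (f x) :: real^1"
  have Fc: "continuous_on (cball x0 R) ?F"
    unfolding vec_def using f by (intro continuous_on_vec_lambda)
  have abs: "?F absolutely_integrable_on (cball x0 R)"
    using borel_integrable_compact[OF compact_cball Fc]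
    unfolding set_integrable_def by (simp add: integrable_completion)
  have e: "{p \<in> ?g ` ?S - cball x0 R. ?F p \<noteq> 0} = {}" using img by blast
  have neg': "negligible {p \<in> cball x0 R - ?g ` ?S. ?F p \<noteq> 0}"
    by (rule negligible_subset[OF neg]) blast
  have neg0: "negligible {p \<in> ?g ` ?S - cball x0 R. ?F p \<noteq> 0}" unfolding e by simp
  have abs': "?F absolutely_integrable_on (?g ` ?S)"
    using absolutely_integrable_spike_set_eq[OF neg' neg0] abs by blast
  have S: "?S \<in> sets lebesgue" by (simp add: lmeasurable_box fmeasurableD)
  note cv = has_absolute_integral_change_of_variables[OF S der inj, of ?F]
  have cov: "integral (?g ` ?S) ?F = integral ?S (\<lambda>p. \<bar>det (matrix (sph_map_deriv p))\<bar> *\<^sub>R ?F (?g p))"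
    and covi: "(\<lambda>p. \<bar>det (matrix (sph_map_deriv p))\<bar> *\<^sub>R ?F (?g p)) absolutely_integrable_on ?S"
    using cv abs' by blast+
  have "integral (cball x0 R) f = integral (cball x0 R) ?F $ 1"
    using integral_component_eq_cart[of ?F "cball x0 R" 1] abs
    by (simp add: set_lebesgue_integral_eq_integral(1))
  also have "integral (cball x0 R) ?F = integral (?g ` ?S) ?F"
    by (rule integral_spike_set[OF neg' neg0])
  also have "\<dots> $ 1 = integral ?S (\<lambda>p. \<bar>det (matrix (sph_map_deriv p))\<bar> * f (?g p))"
    unfolding cov using integral_component_eq_cart[OF set_lebesgue_integral_eq_integral(1)[OF covi], of 1]
    by simp
  also have "\<dots> = integral (cbox 0 ?u) (\<lambda>p. \<bar>det (matrix (sph_map_deriv p))\<bar> * f (?g p))"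
    by (rule integral_open_interval)
  also have "\<dots> = integral (cbox 0 ?u) (\<lambda>p. (p$1)\<^sup>2 * sin (p$2) * f (?g p))"
    by (rule integral_cong) (simp add: det_sph_map_deriv memc abs_mult sin_ge_zero)
  also have "\<dots> = integral (cbox (0, 0, 0) (R, pi, 2 * pi)) (\<lambda>(r, \<theta>, \<phi>). r\<^sup>2 * sin \<theta> * f (x0 + r *\<^sub>R sph_dir \<theta> \<phi>))"
  proof (subst integral_cbox_vec3)
    show "continuous_on (cbox 0 ?u) (\<lambda>p. (p$1)\<^sup>2 * sin (p$2) * f (?g p))"
      unfolding sph_map_def
      by (intro continuous_intros continuous_on_compose2[OF f]) (auto simp: memc dist_norm)
  qed (simp add: sph_map_def)
  finally show ?thesis .
qed

section \<open>The divergence theorem on a ball\<close>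

text \<open>Together with \<open>sph_dir\<close> and \<open>sph_ph\<close> this is the orthonormal
  frame of spherical coordinates: the unit vectors in the directions of growing radius, colatitude
  and azimuth.\<close>

definition sph_th :: "real \<Rightarrow> real \<Rightarrow> real^3" where
  "sph_th \<theta> \<phi> = (cos \<theta> * cos \<phi>) *\<^sub>R axis 1 1 + (cos \<theta> * sin \<phi>) *\<^sub>R axis 2 1 - sin \<theta> *\<^sub>R axis 3 1"

definition sph_ph :: "real \<Rightarrow> real \<Rightarrow> real^3" where
  "sph_ph \<theta> \<phi> = - sin \<phi> *\<^sub>R axis 1 1 + cos \<phi> *\<^sub>R axis 2 1"

lemma axis_vec3 [simp]:
  "axis (1::3) a $ 1 = a" "axis (1::3) a $ 2 = 0" "axis (1::3) a $ 3 = 0"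
  "axis (2::3) a $ 1 = 0" "axis (2::3) a $ 2 = a" "axis (2::3) a $ 3 = 0"
  "axis (3::3) a $ 1 = 0" "axis (3::3) a $ 2 = 0" "axis (3::3) a $ 3 = a"
  by (simp_all add: axis_def)

lemma sph_th_component [simp]:
  "sph_th \<theta> \<phi> $ 1 = cos \<theta> * cos \<phi>" "sph_th \<theta> \<phi> $ 2 = cos \<theta> * sin \<phi>" "sph_th \<theta> \<phi> $ 3 = - sin \<theta>"
  by (simp_all add: sph_th_def axis_def)

lemma sph_ph_component [simp]:
  "sph_ph \<theta> \<phi> $ 1 = - sin \<phi>" "sph_ph \<theta> \<phi> $ 2 = cos \<phi>" "sph_ph \<theta> \<phi> $ 3 = 0"
  by (simp_all add: sph_ph_def axis_def)

lemma continuous_on_sph_th [continuous_intros]: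
  fixes f g :: "'a::t2_space \<Rightarrow> real"
  assumes "continuous_on S f" "continuous_on S g"
  shows "continuous_on S (\<lambda>x. sph_th (f x) (g x))"
  unfolding sph_th_def by (intro continuous_intros assms)

lemma continuous_on_sph_ph [continuous_intros]:
  fixes f g :: "'a::t2_space \<Rightarrow> real"
  assumes "continuous_on S f" "continuous_on S g"
  shows "continuous_on S (\<lambda>x. sph_ph (f x) (g x))"
  unfolding sph_ph_def by (intro continuous_intros assms)

text \<open>Completeness of an orthonormal frame, applied to a coordinate vector: the coefficients
  are the inner products of \<open>axis i 1\<close> with the frame vectors, that is, their
  \<open>i\<close>-th components.\<close>

lemma sph_frame:
  "axis i 1 = sph_dir \<theta> \<phi> $ i *\<^sub>R sph_dir \<theta> \<phi> + sph_th \<theta> \<phi> $ i *\<^sub>R sph_th \<theta> \<phi> + sph_ph \<theta> \<phi> $ i *\<^sub>R sph_ph \<theta> \<phi>"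
proof -
  have s: "sin x * sin x = 1 - cos x * cos x" "sin x * (sin x * y) = y - cos x * (cos x * y)" for x y :: real
  proof -
    have a: "sin x * sin x = 1 - cos x * cos x"
      using sin_cos_squared_add[of x] unfolding power2_eq_square by linarith
    show "sin x * sin x = 1 - cos x * cos x" by (rule a)
    show "sin x * (sin x * y) = y - cos x * (cos x * y)"
      unfolding mult.assoc[symmetric] a by (simp add: left_diff_distrib)
  qed
  consider "i = 1" | "i = 2" | "i = 3" using exhaust_3 by blast
  then show ?thesis
    by cases (simp_all add: vec_eq_iff forall_3 s algebra_simps)
qed

lemma has_vector_derivative_sph_dir_1:
  "((\<lambda>\<theta>. sph_dir \<theta> \<phi>) has_vector_derivative sph_th \<theta> \<phi>) (at \<theta> within S)"
  unfolding sph_dir_alt sph_th_def has_vector_derivative_def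
  by (auto intro!: derivative_eq_intros simp: algebra_simps)

lemma has_vector_derivative_sph_dir_2:
  "((\<lambda>\<phi>. sph_dir \<theta> \<phi>) has_vector_derivative sin \<theta> *\<^sub>R sph_ph \<theta> \<phi>) (at \<phi> within S)"
  unfolding sph_dir_alt sph_ph_def has_vector_derivative_def
  by (auto intro!: derivative_eq_intros simp: algebra_simps)

lemma has_vector_derivative_sph_th:
  "((\<lambda>\<theta>. sph_th \<theta> \<phi>) has_vector_derivative - sph_dir \<theta> \<phi>) (at \<theta> within S)"
  unfolding sph_dir_alt sph_th_def has_vector_derivative_def
  by (auto intro!: derivative_eq_intros simp: algebra_simps)

lemma has_vector_derivative_sph_ph:
  "((\<lambda>\<phi>. sph_ph \<theta> \<phi>) has_vector_derivative - (sin \<theta> *\<^sub>R sph_dir \<theta> \<phi> + cos \<theta> *\<^sub>R sph_th \<theta> \<phi>)) (at \<phi> within S)"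
proof -
  have eq: "- (sin \<theta> *\<^sub>R sph_dir \<theta> \<phi> + cos \<theta> *\<^sub>R sph_th \<theta> \<phi>) = - cos \<phi> *\<^sub>R axis 1 1 - sin \<phi> *\<^sub>R axis 2 1"
  proof (rule vec3_eqI)
    have s: "(sin \<theta>)\<^sup>2 + (cos \<theta>)\<^sup>2 = 1" by simp
    show "(- (sin \<theta> *\<^sub>R sph_dir \<theta> \<phi> + cos \<theta> *\<^sub>R sph_th \<theta> \<phi>)) $ 1 = (- cos \<phi> *\<^sub>R axis 1 1 - sin \<phi> *\<^sub>R axis 2 1 :: real^3) $ 1"
      by simp (use s in algebra)
    show "(- (sin \<theta> *\<^sub>R sph_dir \<theta> \<phi> + cos \<theta> *\<^sub>R sph_th \<theta> \<phi>)) $ 2 = (- cos \<phi> *\<^sub>R axis 1 1 - sin \<phi> *\<^sub>R axis 2 1 :: real^3) $ 2"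
      by simp (use s in algebra)
  qed (simp add: axis_def)
  show ?thesis
    unfolding eq unfolding sph_ph_def has_vector_derivative_def
    by (auto intro!: derivative_eq_intros simp: algebra_simps)
qed

lemma linear_vec3_expand:
  fixes L :: "real^3 \<Rightarrow> 'b::real_vector"
  assumes "linear L"
  shows "L v = v$1 *\<^sub>R L (axis 1 1) + v$2 *\<^sub>R L (axis 2 1) + v$3 *\<^sub>R L (axis 3 1)"
proof -
  have "v = v$1 *\<^sub>R axis 1 1 + v$2 *\<^sub>R axis 2 1 + v$3 *\<^sub>R axis 3 1"
    by (rule vec3_eqI) (simp_all add: axis_def)
  from arg_cong[OF this, of L] show ?thesis
    by (simp only: linear_add[OF assms] linear_scale[OF assms])
qed

text \<open>In spherical coordinates the weighted partial derivative is a sum of three exact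
  derivatives, each integrated over its own variable innermost. The radial one leaves the value on
  the sphere, its value at the centre being killed by \<open>r\<^sup>2\<close>. The one in
  \<open>\<theta>\<close> vanishes because of the sine at both poles, the one in
  \<open>\<phi>\<close> because of periodicity.\<close>

lemma integral_ball_partial_derivative:
  fixes f :: "real^3 \<Rightarrow> real"
  assumes D: "\<And>x. x \<in> cball x0 R \<Longrightarrow> (f has_derivative D x) (at x)"
    and cD: "\<And>j. continuous_on (cball x0 R) (\<lambda>x. D x (axis j 1))"
    and R: "R > 0"
  shows "integral (cball x0 R) (\<lambda>x. D x (axis i 1)) = integral (cbox (0, 0) (pi, 2 * pi))
     (\<lambda>(\<theta>, \<phi>). f (x0 + R *\<^sub>R sph_dir \<theta> \<phi>) * sph_dir \<theta> \<phi> $ i * R\<^sup>2 * sin \<theta>)"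
proof -
  define X where "X r \<theta> \<phi> = x0 + r *\<^sub>R sph_dir \<theta> \<phi>" for r \<theta> \<phi>
  have Xin: "X r \<theta> \<phi> \<in> cball x0 R" if "0 \<le> r" "r \<le> R" for r \<theta> \<phi>
    using that by (simp add: X_def dist_norm)
  have lin: "linear (D x)" if "x \<in> cball x0 R" for x
    using D[OF that] has_derivative_linear by blast
  \<comment> \<open>Continuity in \<open>x\<close> is assumed only for derivatives along the axes,
    while the frame directions vary with the point. The expansion over the axes makes the integrands
    visibly continuous.\<close>
  define dd where "dd x v = v$1 * D x (axis 1 1) + v$2 * D x (axis 2 1) + v$3 * D x (axis 3 1)"
    for x and v :: "real^3"
  have dd: "D x v = dd x v" if "x \<in> cball x0 R" for x v
    using linear_vec3_expand[OF lin[OF that], of v] by (simp add: dd_def)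
  have dd_scale: "dd x (k *\<^sub>R v) = k * dd x v" for x k v
    by (simp add: dd_def algebra_simps)
  have fc: "continuous_on (cball x0 R) f"
    using D by (meson has_derivative_at_withinI has_derivative_continuous_on)
  let ?Q = "cbox (0::real, 0::real, 0::real) (R, pi, 2 * pi)"
  have Xc: "continuous_on S (\<lambda>p. X (a p) (b p) (c p))"
    if "continuous_on S a" "continuous_on S b" "continuous_on S c" for S :: "'c::t2_space set" and a b c
    unfolding X_def by (intro continuous_intros that)
  have fXc: "continuous_on ?Q (\<lambda>p. f (X (fst p) (fst (snd p)) (snd (snd p))))"
    by (rule continuous_on_compose2[OF fc Xc]) (auto intro!: continuous_intros Xin simp: cbox_Pair_eq)
  have dXc: "continuous_on ?Q (\<lambda>p. D (X (fst p) (fst (snd p)) (snd (snd p))) (axis j 1))" for j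
    by (rule continuous_on_compose2[OF cD Xc]) (auto intro!: continuous_intros Xin simp: cbox_Pair_eq)
  \<comment> \<open>In spherical coordinates the field \<open>f e\<^sub>i\<close> has the weighted components
    \<open>r\<^sup>2 sin \<theta> f \<omega>\<^sub>i\<close>, \<open>r sin \<theta> f \<theta>\<^sub>i\<close>, \<open>r f \<phi>\<^sub>i\<close>; \<open>A\<close>, \<open>B\<close>, \<open>C\<close> are their derivatives in \<open>r\<close>, \<open>\<theta>\<close>, \<open>\<phi>\<close>.\<close>
  define A where "A r \<theta> \<phi> = 2 * r * sin \<theta> * sph_dir \<theta> \<phi> $ i * f (X r \<theta> \<phi>)
      + r\<^sup>2 * sin \<theta> * sph_dir \<theta> \<phi> $ i * dd (X r \<theta> \<phi>) (sph_dir \<theta> \<phi>)" for r \<theta> \<phi>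
  define B where "B r \<theta> \<phi> = r * (cos \<theta> * sph_th \<theta> \<phi> $ i - sin \<theta> * sph_dir \<theta> \<phi> $ i) * f (X r \<theta> \<phi>)
      + r * sin \<theta> * sph_th \<theta> \<phi> $ i * (r * dd (X r \<theta> \<phi>) (sph_th \<theta> \<phi>))" for r \<theta> \<phi>
  define C where "C r \<theta> \<phi> = - r * (sin \<theta> * sph_dir \<theta> \<phi> $ i + cos \<theta> * sph_th \<theta> \<phi> $ i) * f (X r \<theta> \<phi>)
      + r * sph_ph \<theta> \<phi> $ i * (r * sin \<theta> * dd (X r \<theta> \<phi>) (sph_ph \<theta> \<phi>))" for r \<theta> \<phi>
  have Ac: "continuous_on ?Q (\<lambda>(r, \<theta>, \<phi>). A r \<theta> \<phi>)"
    and Bc: "continuous_on ?Q (\<lambda>(r, \<theta>, \<phi>). B r \<theta> \<phi>)"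
    and Cc: "continuous_on ?Q (\<lambda>(r, \<theta>, \<phi>). C r \<theta> \<phi>)"
    unfolding A_def B_def C_def dd_def case_prod_beta by (intro continuous_intros fXc dXc)+
  have Xr: "((\<lambda>r. f (X r \<theta> \<phi>)) has_vector_derivative dd (X r \<theta> \<phi>) (sph_dir \<theta> \<phi>)) (at r within S)"
    if "0 \<le> r" "r \<le> R" for r \<theta> \<phi> S
  proof -
    have "((\<lambda>r. X r \<theta> \<phi>) has_vector_derivative sph_dir \<theta> \<phi>) (at r within S)"
      unfolding X_def has_vector_derivative_def by (auto intro!: derivative_eq_intros)
    from vector_derivative_diff_chain_within[OF this has_derivative_at_withinI[OF D[OF Xin[OF that]]]]
    show ?thesis by (simp add: o_def dd[OF Xin[OF that]])
  qed
  have Xt: "((\<lambda>\<theta>. f (X r \<theta> \<phi>)) has_vector_derivative r * dd (X r \<theta> \<phi>) (sph_th \<theta> \<phi>)) (at \<theta> within S)"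
    if "0 \<le> r" "r \<le> R" for r \<theta> \<phi> S
  proof -
    have "((\<lambda>\<theta>. X r \<theta> \<phi>) has_vector_derivative r *\<^sub>R sph_th \<theta> \<phi>) (at \<theta> within S)"
      unfolding X_def by (auto intro!: derivative_eq_intros has_vector_derivative_sph_dir_1)
    from vector_derivative_diff_chain_within[OF this has_derivative_at_withinI[OF D[OF Xin[OF that]]]]
    show ?thesis by (simp add: o_def dd[OF Xin[OF that]] dd_scale)
  qed
  have Xp: "((\<lambda>\<phi>. f (X r \<theta> \<phi>)) has_vector_derivative r * sin \<theta> * dd (X r \<theta> \<phi>) (sph_ph \<theta> \<phi>)) (at \<phi> within S)"
    if "0 \<le> r" "r \<le> R" for r \<theta> \<phi> S
  proof -
    have "((\<lambda>\<phi>. X r \<theta> \<phi>) has_vector_derivative (r * sin \<theta>) *\<^sub>R sph_ph \<theta> \<phi>) (at \<phi> within S)"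
      unfolding X_def using has_vector_derivative_sph_dir_2[of \<theta> \<phi> S]
      by (auto intro!: derivative_eq_intros)
    from vector_derivative_diff_chain_within[OF this has_derivative_at_withinI[OF D[OF Xin[OF that]]]]
    show ?thesis by (simp add: o_def dd[OF Xin[OF that]] dd_scale)
  qed
  have comp: "((\<lambda>s. g s $ i) has_vector_derivative g' $ i) F"
    if "(g has_vector_derivative g') F" for g :: "real \<Rightarrow> real^3" and g' F
    using bounded_linear.has_vector_derivative[OF bounded_linear_vec_nth that] .
  have intA: "integral {0..R} (\<lambda>r. A r \<theta> \<phi>) = f (x0 + R *\<^sub>R sph_dir \<theta> \<phi>) * sph_dir \<theta> \<phi> $ i * R\<^sup>2 * sin \<theta>" for \<theta> \<phi>
  proof -
    have "((\<lambda>r. A r \<theta> \<phi>) has_integral R\<^sup>2 * sin \<theta> * sph_dir \<theta> \<phi> $ i * f (X R \<theta> \<phi>)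
       - 0\<^sup>2 * sin \<theta> * sph_dir \<theta> \<phi> $ i * f (X 0 \<theta> \<phi>)) {0..R}"
    proof (rule fundamental_theorem_of_calculus)
      fix r assume r: "r \<in> {0..R}"
      then show "((\<lambda>r. r\<^sup>2 * sin \<theta> * sph_dir \<theta> \<phi> $ i * f (X r \<theta> \<phi>)) has_vector_derivative A r \<theta> \<phi>) (at r within {0..R})"
        unfolding A_def has_real_derivative_iff_has_vector_derivative[symmetric]
        by (auto intro!: derivative_eq_intros Xr[unfolded has_real_derivative_iff_has_vector_derivative[symmetric]]
            simp: algebra_simps)
    qed (use R in simp)
    from integral_unique[OF this] show ?thesis by (simp add: X_def algebra_simps)
  qed
  have intB: "integral {0..pi} (\<lambda>\<theta>. B r \<theta> \<phi>) = 0" if r: "0 \<le> r" "r \<le> R" for r \<phi>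
  proof -
    have "((\<lambda>\<theta>. B r \<theta> \<phi>) has_integral r * sin pi * sph_th pi \<phi> $ i * f (X r pi \<phi>)
       - r * sin 0 * sph_th 0 \<phi> $ i * f (X r 0 \<phi>)) {0..pi}"
    proof (rule fundamental_theorem_of_calculus)
      fix \<theta> assume "\<theta> \<in> {0..pi}"
      show "((\<lambda>\<theta>. r * sin \<theta> * sph_th \<theta> \<phi> $ i * f (X r \<theta> \<phi>)) has_vector_derivative B r \<theta> \<phi>) (at \<theta> within {0..pi})"
        unfolding B_def has_real_derivative_iff_has_vector_derivative[symmetric]
        by (auto intro!: derivative_eq_intros r Xt[unfolded has_real_derivative_iff_has_vector_derivative[symmetric]]
            comp[OF has_vector_derivative_sph_th, unfolded has_real_derivative_iff_has_vector_derivative[symmetric]]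
            simp: algebra_simps)
    qed simp
    from integral_unique[OF this] show ?thesis by simp
  qed
  have intC: "integral {0..2*pi} (\<lambda>\<phi>. C r \<theta> \<phi>) = 0" if r: "0 \<le> r" "r \<le> R" for r \<theta>
  proof -
    have "((\<lambda>\<phi>. C r \<theta> \<phi>) has_integral r * sph_ph \<theta> (2*pi) $ i * f (X r \<theta> (2*pi))
       - r * sph_ph \<theta> 0 $ i * f (X r \<theta> 0)) {0..2*pi}"
    proof (rule fundamental_theorem_of_calculus)
      fix \<phi> assume "\<phi> \<in> {0..2*pi}"
      show "((\<lambda>\<phi>. r * sph_ph \<theta> \<phi> $ i * f (X r \<theta> \<phi>)) has_vector_derivative C r \<theta> \<phi>) (at \<phi> within {0..2*pi})"
        unfolding C_def has_real_derivative_iff_has_vector_derivative[symmetric]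
        by (auto intro!: derivative_eq_intros r Xp[unfolded has_real_derivative_iff_has_vector_derivative[symmetric]]
            comp[OF has_vector_derivative_sph_ph, unfolded has_real_derivative_iff_has_vector_derivative[symmetric]]
            simp: algebra_simps)
    qed simp
    moreover have "X r \<theta> (2*pi) = X r \<theta> 0" "sph_ph \<theta> (2*pi) = sph_ph \<theta> 0"
      by (simp_all add: X_def sph_dir_def sph_ph_def)
    ultimately show ?thesis by (metis cancel_comm_monoid_add_class.diff_cancel integral_unique)
  qed
  have prodQ: "integral ?Q (\<lambda>(r, \<theta>, \<phi>). H r \<theta> \<phi>)
      = integral (cbox 0 R) (\<lambda>r. integral (cbox (0, 0) (pi, 2 * pi)) (\<lambda>(\<theta>, \<phi>). H r \<theta> \<phi>))"
    if "continuous_on ?Q (\<lambda>(r, \<theta>, \<phi>). H r \<theta> \<phi>)" for H :: "real \<Rightarrow> real \<Rightarrow> real \<Rightarrow> real"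
    using integral_prod_continuous[OF that] by simp
  have slice: "continuous_on (cbox (0, 0) (pi, 2 * pi)) (\<lambda>(\<theta>, \<phi>). H r \<theta> \<phi>)"
    if "continuous_on ?Q (\<lambda>(r, \<theta>, \<phi>). H r \<theta> \<phi>)" "0 \<le> r" "r \<le> R" for H :: "real \<Rightarrow> real \<Rightarrow> real \<Rightarrow> real" and r
  proof -
    have "continuous_on (cbox (0, 0) (pi, 2 * pi)) (\<lambda>p. (\<lambda>(r, \<theta>, \<phi>). H r \<theta> \<phi>) (r, p))"
      by (rule continuous_on_compose2[OF that(1)])
         (use that(2,3) in \<open>auto intro!: continuous_intros simp: cbox_Pair_eq\<close>)
    then show ?thesis by (simp add: case_prod_beta)
  qed
  have IA: "integral ?Q (\<lambda>(r, \<theta>, \<phi>). A r \<theta> \<phi>) = integral (cbox (0, 0) (pi, 2 * pi))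
     (\<lambda>(\<theta>, \<phi>). f (x0 + R *\<^sub>R sph_dir \<theta> \<phi>) * sph_dir \<theta> \<phi> $ i * R\<^sup>2 * sin \<theta>)"
  proof -
    have "integral ?Q (\<lambda>(r, \<theta>, \<phi>). A r \<theta> \<phi>)
      = integral (cbox (0, 0) (pi, 2 * pi)) (\<lambda>p. integral (cbox 0 R) (\<lambda>r. (\<lambda>(\<theta>, \<phi>). A r \<theta> \<phi>) p))"
      unfolding prodQ[OF Ac]
      by (rule integral_swap_continuous) (use Ac in \<open>simp add: case_prod_beta\<close>)
    also have "\<dots> = integral (cbox (0, 0) (pi, 2 * pi))
       (\<lambda>(\<theta>, \<phi>). f (x0 + R *\<^sub>R sph_dir \<theta> \<phi>) * sph_dir \<theta> \<phi> $ i * R\<^sup>2 * sin \<theta>)"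
      by (rule integral_cong) (auto simp: intA cbox_interval)
    finally show ?thesis .
  qed
  have IB: "integral ?Q (\<lambda>(r, \<theta>, \<phi>). B r \<theta> \<phi>) = 0"
  proof -
    have "integral (cbox (0, 0) (pi, 2 * pi)) (\<lambda>(\<theta>, \<phi>). B r \<theta> \<phi>) = 0" if r: "r \<in> cbox 0 R" for r
    proof -
      have c: "continuous_on (cbox (0, 0) (pi, 2 * pi)) (\<lambda>(\<theta>, \<phi>). B r \<theta> \<phi>)"
        using slice[OF Bc] r by auto
      have "integral (cbox (0, 0) (pi, 2 * pi)) (\<lambda>(\<theta>, \<phi>). B r \<theta> \<phi>)
         = integral (cbox 0 (2*pi)) (\<lambda>\<phi>. integral (cbox 0 pi) (\<lambda>\<theta>. B r \<theta> \<phi>))"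
        using integral_prod_continuous[OF c] integral_swap_continuous[OF c] by simp
      also have "\<dots> = integral (cbox 0 (2*pi)) (\<lambda>\<phi>. 0)"
        by (rule integral_cong) (use r in \<open>simp add: intB cbox_interval\<close>)
      finally show ?thesis by simp
    qed
    then have "integral (cbox 0 R) (\<lambda>r. integral (cbox (0, 0) (pi, 2 * pi)) (\<lambda>(\<theta>, \<phi>). B r \<theta> \<phi>)) = integral (cbox 0 R) (\<lambda>r. 0)"
      by (intro integral_cong)
    then show ?thesis unfolding prodQ[OF Bc] by simp
  qed
  have IC: "integral ?Q (\<lambda>(r, \<theta>, \<phi>). C r \<theta> \<phi>) = 0"
  proof -
    have "integral (cbox (0, 0) (pi, 2 * pi)) (\<lambda>(\<theta>, \<phi>). C r \<theta> \<phi>) = 0" if r: "r \<in> cbox 0 R" for r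
    proof -
      have c: "continuous_on (cbox (0, 0) (pi, 2 * pi)) (\<lambda>(\<theta>, \<phi>). C r \<theta> \<phi>)"
        using slice[OF Cc] r by auto
      have "integral (cbox (0, 0) (pi, 2 * pi)) (\<lambda>(\<theta>, \<phi>). C r \<theta> \<phi>)
         = integral (cbox 0 pi) (\<lambda>\<theta>. integral (cbox 0 (2*pi)) (\<lambda>\<phi>. C r \<theta> \<phi>))"
        using integral_prod_continuous[OF c] by simp
      also have "\<dots> = integral (cbox 0 pi) (\<lambda>\<theta>. 0)"
        by (rule integral_cong) (use r in \<open>simp add: intC cbox_interval\<close>)
      finally show ?thesis by simp
    qed
    then have "integral (cbox 0 R) (\<lambda>r. integral (cbox (0, 0) (pi, 2 * pi)) (\<lambda>(\<theta>, \<phi>). C r \<theta> \<phi>)) = integral (cbox 0 R) (\<lambda>r. 0)"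
      by (intro integral_cong)
    then show ?thesis unfolding prodQ[OF Cc] by simp
  qed
  \<comment> \<open>The terms containing \<open>f\<close> itself cancel: the radial weight
    contributes \<open>2 * r * sin \<theta> * sph_dir \<theta> \<phi> $ i\<close>, and the angular
    weights take it away in two halves, their cosine terms being opposite. What remains is the frame
    expansion of the derivative along \<open>axis i 1\<close>.\<close>
  have key: "r\<^sup>2 * sin \<theta> * D (X r \<theta> \<phi>) (axis i 1) = A r \<theta> \<phi> + B r \<theta> \<phi> + C r \<theta> \<phi>"
    if r: "0 \<le> r" "r \<le> R" for r \<theta> \<phi>
  proof -
    let ?D = "D (X r \<theta> \<phi>)"
    note l = lin[OF Xin[OF r, of \<theta> \<phi>]]
    have "?D (axis i 1) = sph_dir \<theta> \<phi> $ i * ?D (sph_dir \<theta> \<phi>) + sph_th \<theta> \<phi> $ i * ?D (sph_th \<theta> \<phi>)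
       + sph_ph \<theta> \<phi> $ i * ?D (sph_ph \<theta> \<phi>)"
      by (subst sph_frame[of i \<theta> \<phi>]) (simp only: linear_add[OF l] linear_scale[OF l] real_scaleR_def)
    then show ?thesis unfolding A_def B_def C_def dd[OF Xin[OF r], symmetric] by algebra
  qed
  have "integral (cball x0 R) (\<lambda>x. D x (axis i 1)) = integral ?Q (\<lambda>(r, \<theta>, \<phi>). r\<^sup>2 * sin \<theta> * D (X r \<theta> \<phi>) (axis i 1))"
    unfolding X_def by (rule integral_cball_spherical[OF cD R])
  also have "\<dots> = integral ?Q (\<lambda>p. ((\<lambda>(r, \<theta>, \<phi>). A r \<theta> \<phi>) p + (\<lambda>(r, \<theta>, \<phi>). B r \<theta> \<phi>) p) + (\<lambda>(r, \<theta>, \<phi>). C r \<theta> \<phi>) p)"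
    by (rule integral_cong) (auto simp: key cbox_Pair_eq)
  also have "\<dots> = integral ?Q (\<lambda>(r, \<theta>, \<phi>). A r \<theta> \<phi>) + integral ?Q (\<lambda>(r, \<theta>, \<phi>). B r \<theta> \<phi>) + integral ?Q (\<lambda>(r, \<theta>, \<phi>). C r \<theta> \<phi>)"
    by (rule integral_unique[OF has_integral_add[OF has_integral_add[OF
          integrable_integral[OF integrable_continuous[OF Ac]] integrable_integral[OF integrable_continuous[OF Bc]]]
          integrable_integral[OF integrable_continuous[OF Cc]]]])
  finally show ?thesis unfolding IA IB IC add_0_right .
qed

lemma sphere_integral_alt:
  "sphere_integral x0 R g = integral (cbox (0, 0) (pi, 2 * pi))
     (\<lambda>(\<theta>, \<phi>). g (x0 + R *\<^sub>R sph_dir \<theta> \<phi>) * R\<^sup>2 * sin \<theta>)"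
  by (simp add: sphere_integral_def sph_dir_def)

lemma integral_ball_partial_bound:
  fixes f :: "real^3 \<Rightarrow> real"
  assumes D: "\<And>x. x \<in> cball x0 R \<Longrightarrow> (f has_derivative D x) (at x)"
    and cD: "\<And>j. continuous_on (cball x0 R) (\<lambda>x. D x (axis j 1))"
    and R: "R > 0"
    and M: "continuous_on (sphere x0 R) M" and fM: "\<And>x. x \<in> sphere x0 R \<Longrightarrow> \<bar>f x\<bar> \<le> M x"
  shows "\<bar>integral (cball x0 R) (\<lambda>x. D x (axis i 1))\<bar> \<le> sphere_integral x0 R M"
proof -
  have "continuous_on (cball x0 R) f"
    using D by (meson has_derivative_at_withinI has_derivative_continuous_on)
  from continuous_on_subset[OF this sphere_cball] have fc: "continuous_on (sphere x0 R) f" .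
  have c: "continuous_on (cbox (0, 0) (pi, 2 * pi)) (\<lambda>p. x0 + R *\<^sub>R sph_dir (fst p) (snd p))"
    by (intro continuous_intros)
  have sub: "x0 + R *\<^sub>R sph_dir \<theta> \<phi> \<in> sphere x0 R" for \<theta> \<phi> using R by (simp add: dist_norm)
  have fc': "continuous_on (cbox (0, 0) (pi, 2 * pi)) (\<lambda>p. f (x0 + R *\<^sub>R sph_dir (fst p) (snd p)))"
    and Mc': "continuous_on (cbox (0, 0) (pi, 2 * pi)) (\<lambda>p. M (x0 + R *\<^sub>R sph_dir (fst p) (snd p)))"
    by (rule continuous_on_compose2[OF fc c], use sub in auto)
       (rule continuous_on_compose2[OF M c], use sub in auto)
  have "norm (integral (cbox (0, 0) (pi, 2 * pi))
      (\<lambda>(\<theta>, \<phi>). f (x0 + R *\<^sub>R sph_dir \<theta> \<phi>) * sph_dir \<theta> \<phi> $ i * R\<^sup>2 * sin \<theta>))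
     \<le> integral (cbox (0, 0) (pi, 2 * pi)) (\<lambda>(\<theta>, \<phi>). M (x0 + R *\<^sub>R sph_dir \<theta> \<phi>) * R\<^sup>2 * sin \<theta>)"
  proof (rule integral_norm_bound_integral)
    show "(\<lambda>(\<theta>, \<phi>). f (x0 + R *\<^sub>R sph_dir \<theta> \<phi>) * sph_dir \<theta> \<phi> $ i * R\<^sup>2 * sin \<theta>) integrable_on cbox (0, 0) (pi, 2 * pi)"
      unfolding case_prod_beta by (intro integrable_continuous continuous_intros fc')
    show "(\<lambda>(\<theta>, \<phi>). M (x0 + R *\<^sub>R sph_dir \<theta> \<phi>) * R\<^sup>2 * sin \<theta>) integrable_on cbox (0, 0) (pi, 2 * pi)"
      unfolding case_prod_beta by (intro integrable_continuous continuous_intros Mc')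
    fix p :: "real \<times> real" assume "p \<in> cbox (0, 0) (pi, 2 * pi)"
    then obtain \<theta> \<phi> where p: "p = (\<theta>, \<phi>)" and th: "0 \<le> \<theta>" "\<theta> \<le> pi" by (cases p) (auto simp: cbox_Pair_eq)
    have s: "0 \<le> sin \<theta>" using th by (simp add: sin_ge_zero)
    have f1: "\<bar>f (x0 + R *\<^sub>R sph_dir \<theta> \<phi>)\<bar> \<le> M (x0 + R *\<^sub>R sph_dir \<theta> \<phi>)" by (rule fM[OF sub])
    have "\<bar>sph_dir \<theta> \<phi> $ i\<bar> \<le> 1" using component_le_norm_cart[of "sph_dir \<theta> \<phi>" i] by simp
    then have "\<bar>f (x0 + R *\<^sub>R sph_dir \<theta> \<phi>)\<bar> * \<bar>sph_dir \<theta> \<phi> $ i\<bar> \<le> M (x0 + R *\<^sub>R sph_dir \<theta> \<phi>) * 1"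
      by (intro mult_mono f1) (use f1 in linarith)+
    from mult_right_mono[OF this, of "R\<^sup>2 * sin \<theta>"] s
    show "norm (case p of (\<theta>, \<phi>) \<Rightarrow> f (x0 + R *\<^sub>R sph_dir \<theta> \<phi>) * sph_dir \<theta> \<phi> $ i * R\<^sup>2 * sin \<theta>)
      \<le> (case p of (\<theta>, \<phi>) \<Rightarrow> M (x0 + R *\<^sub>R sph_dir \<theta> \<phi>) * R\<^sup>2 * sin \<theta>)"
      by (simp add: p abs_mult mult.assoc)
  qed
  moreover have "integral (cball x0 R) (\<lambda>x. D x (axis i 1)) = integral (cbox (0, 0) (pi, 2 * pi))
     (\<lambda>(\<theta>, \<phi>). f (x0 + R *\<^sub>R sph_dir \<theta> \<phi>) * sph_dir \<theta> \<phi> $ i * R\<^sup>2 * sin \<theta>)"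
    by (rule integral_ball_partial_derivative[OF D cD R])
  ultimately show ?thesis
    unfolding sphere_integral_alt by simp
qed

section \<open>Differentiation of integrals over a ball with moving centre\<close>

lemma linear_spacetime_expand:
  fixes L :: "real \<times> (real^3) \<Rightarrow> real"
  assumes "linear L"
  shows "L (s, v) = s * L (1, 0) + v$1 * L (0, axis 1 1) + v$2 * L (0, axis 2 1) + v$3 * L (0, axis 3 1)"
proof -
  have "(s, v) = s *\<^sub>R (1, 0) + v$1 *\<^sub>R (0, axis 1 1) + v$2 *\<^sub>R (0, axis 2 1) + v$3 *\<^sub>R (0, axis 3 1)"
    by (auto intro!: vec3_eqI)
  from arg_cong[OF this, of L] show ?thesis
    by (simp only: linear_add[OF assms] linear_scale[OF assms] real_scaleR_def)
qed

text \<open>Spherical coordinates around \<open>rhat t\<close> have a domain that does not depend on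
  \<open>t\<close>, so the derivative passes under the integral sign. The motion of the centre shows
  up as the direction \<open>(1, v t)\<close>: the transport term is an integral of spatial
  derivatives of \<open>f\<close>, to which the divergence theorem applies as well. At the end
  points of the time interval all of this is one-sided, as is the derivative of
  \<open>rhat\<close>.\<close>

lemma moving_ball_integral_derivative:
  fixes f :: "real \<times> (real^3) \<Rightarrow> real"
  assumes Df: "\<And>z. z \<in> tube Tm Tp rhat R \<Longrightarrow> (f has_derivative Df z) (at z)"
    and cDf: "\<And>h. continuous_on (tube Tm Tp rhat R) (\<lambda>z. Df z h)"
    and R: "R > 0"
    and rhat: "\<And>t. t \<in> {Tm..Tp} \<Longrightarrow> (rhat has_vector_derivative v t) (at t within {Tm..Tp})"
    and cv: "continuous_on {Tm..Tp} v"
    and t: "t \<in> {Tm..Tp}"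
  shows "((\<lambda>t. integral (cball (rhat t) R) (\<lambda>x. f (t, x))) has_vector_derivative
     integral (cball (rhat t) R) (\<lambda>x. Df (t, x) (1, v t))) (at t within {Tm..Tp})"
proof -
  let ?T = "tube Tm Tp rhat R"
  let ?Q = "cbox (0::real, 0::real, 0::real) (R, pi, 2 * pi)"
  have lin: "linear (Df z)" if "z \<in> ?T" for z using Df[OF that] has_derivative_linear by blast
  have fc: "continuous_on ?T f"
    using Df by (meson has_derivative_at_withinI has_derivative_continuous_on)
  have rc: "continuous_on {Tm..Tp} rhat"
    using rhat by (meson continuous_on_eq_continuous_within has_vector_derivative_continuous)
  define Z where "Z s p = (s, rhat s + fst p *\<^sub>R sph_dir (fst (snd p)) (snd (snd p)))" for s p
  have Zin: "Z s p \<in> ?T" if "s \<in> {Tm..Tp}" "p \<in> ?Q" for s p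
    using that R by (cases p) (auto simp: Z_def tube_def dist_norm cbox_Pair_eq)
  have rc': "continuous_on ({Tm..Tp} \<times> ?Q) (\<lambda>q. rhat (fst q))"
    and vc': "continuous_on ({Tm..Tp} \<times> ?Q) (\<lambda>q. v (fst q))"
    by (rule continuous_on_compose2[OF rc], auto intro!: continuous_intros)
       (rule continuous_on_compose2[OF cv], auto intro!: continuous_intros)
  have Zc: "continuous_on ({Tm..Tp} \<times> ?Q) (\<lambda>q. Z (fst q) (snd q))"
    unfolding Z_def by (intro continuous_intros rc')
  have Zim: "(\<lambda>q. Z (fst q) (snd q)) ` ({Tm..Tp} \<times> ?Q) \<subseteq> ?T" using Zin by auto
  have fZ: "continuous_on ({Tm..Tp} \<times> ?Q) (\<lambda>q. f (Z (fst q) (snd q)))"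
    by (rule continuous_on_compose2[OF fc Zc Zim])
  have DZ: "continuous_on ({Tm..Tp} \<times> ?Q) (\<lambda>q. Df (Z (fst q) (snd q)) h)" for h
    by (rule continuous_on_compose2[OF cDf Zc Zim])
  define W where "W s p = (fst p)\<^sup>2 * sin (fst (snd p)) * Df (Z s p) (1, v s)" for s p
  have cW: "continuous_on ({Tm..Tp} \<times> ?Q) (\<lambda>(s, p). W s p)"
  proof -
    \<comment> \<open>The direction \<open>(1, v s)\<close> varies with time, whereas
      \<open>cDf\<close> covers fixed directions; hence the expansion over the four coordinate
      directions.\<close>
    have "continuous_on ({Tm..Tp} \<times> ?Q) (\<lambda>q. (fst (snd q))\<^sup>2 * sin (fst (snd (snd q))) *
       (1 * Df (Z (fst q) (snd q)) (1, 0) + v (fst q) $ 1 * Df (Z (fst q) (snd q)) (0, axis 1 1)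
         + v (fst q) $ 2 * Df (Z (fst q) (snd q)) (0, axis 2 1) + v (fst q) $ 3 * Df (Z (fst q) (snd q)) (0, axis 3 1)))"
      by (intro continuous_intros DZ vc')
    then show ?thesis
    proof (rule continuous_on_eq)
      fix q assume q: "q \<in> {Tm..Tp} \<times> ?Q"
      then have "Z (fst q) (snd q) \<in> ?T" using Zin by auto
      from linear_spacetime_expand[OF lin[OF this], of 1 "v (fst q)"]
      show "(fst (snd q))\<^sup>2 * sin (fst (snd (snd q))) *
       (1 * Df (Z (fst q) (snd q)) (1, 0) + v (fst q) $ 1 * Df (Z (fst q) (snd q)) (0, axis 1 1)
         + v (fst q) $ 2 * Df (Z (fst q) (snd q)) (0, axis 2 1) + v (fst q) $ 3 * Df (Z (fst q) (snd q)) (0, axis 3 1))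
        = (case q of (s, p) \<Rightarrow> W s p)"
        by (simp only: W_def case_prod_beta)
    qed
  qed
  have slice: "continuous_on (cball (rhat s) R) (\<lambda>x. g (s, x))" if "continuous_on ?T g" "s \<in> {Tm..Tp}"
    for g :: "real \<times> (real^3) \<Rightarrow> real" and s
    by (rule continuous_on_compose2[OF that(1)]) (use that(2) in \<open>auto intro!: continuous_intros simp: tube_def\<close>)
  have cD1: "continuous_on (cball (rhat t) R) (\<lambda>x. Df (t, x) (1, v t))"
    using slice[OF cDf t] .
  have eq1: "integral (cball (rhat s) R) (\<lambda>x. f (s, x)) = integral ?Q (\<lambda>p. (fst p)\<^sup>2 * sin (fst (snd p)) * f (Z s p))"
    if s: "s \<in> {Tm..Tp}" for s
    using integral_cball_spherical[OF slice[OF fc s] R] by (simp add: Z_def case_prod_unfold)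
  have eq2: "integral (cball (rhat t) R) (\<lambda>x. Df (t, x) (1, v t)) = integral ?Q (W t)"
    using integral_cball_spherical[OF cD1 R] by (simp add: Z_def W_def[abs_def] case_prod_unfold)
  have "((\<lambda>s. integral ?Q (\<lambda>p. (fst p)\<^sup>2 * sin (fst (snd p)) * f (Z s p))) has_vector_derivative integral ?Q (W t)) (at t within {Tm..Tp})"
  proof (rule leibniz_rule_vector_derivative[OF _ _ cW t])
    fix s p assume s: "s \<in> {Tm..Tp}" and p: "p \<in> ?Q"
    have "((\<lambda>s. Z s p) has_vector_derivative (1, v s)) (at s within {Tm..Tp})"
      unfolding Z_def using has_vector_derivative_Pair[OF has_vector_derivative_id
          has_vector_derivative_add[OF rhat[OF s] has_vector_derivative_const]] by simp
    from vector_derivative_diff_chain_within[OF this has_derivative_at_withinI[OF Df[OF Zin[OF s p]]]]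
    have "((\<lambda>s. f (Z s p)) has_vector_derivative Df (Z s p) (1, v s)) (at s within {Tm..Tp})" by (simp add: o_def)
    from bounded_linear.has_vector_derivative[OF bounded_linear_mult_right[of "(fst p)\<^sup>2 * sin (fst (snd p))"] this]
    show "((\<lambda>s. (fst p)\<^sup>2 * sin (fst (snd p)) * f (Z s p)) has_vector_derivative W s p) (at s within {Tm..Tp})"
      by (simp add: W_def)
  next
    fix s assume s: "s \<in> {Tm..Tp}"
    have "continuous_on ?Q (\<lambda>p. f (Z (fst (s, p)) (snd (s, p))))"
      by (rule continuous_on_compose2[OF fZ]) (use s in \<open>auto intro!: continuous_intros\<close>)
    then have "continuous_on ?Q (\<lambda>p. f (Z s p))" by simp
    then show "(\<lambda>p. (fst p)\<^sup>2 * sin (fst (snd p)) * f (Z s p)) integrable_on ?Q"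
      by (intro integrable_continuous continuous_intros)
  qed simp
  then show ?thesis unfolding eq2
    by (rule has_vector_derivative_transform[OF t, rotated]) (simp add: eq1)
qed

section \<open>The nonlinearity and partial derivatives\<close>

lemma square_norm_gradient:
  assumes G: "\<forall>s>0. (G1 has_real_derivative dG1 s) (at s)"
    and D: "((\<lambda>w::complex. G1 ((cmod w)\<^sup>2)) has_derivative L) (at w)"
  shows "L h = 2 * ((dG1 ((cmod w)\<^sup>2) *\<^sub>R w) \<bullet> h)"
proof (cases "w = 0")
  \<comment> \<open>The function is even, hence its derivative at \<open>0\<close> vanishes, whatever the value \<open>dG1 0\<close> is.\<close>
  case True
  have "((\<lambda>w::complex. G1 ((cmod (- w))\<^sup>2)) has_derivative (\<lambda>h. L (- h))) (at 0)"
    by (rule has_derivative_compose[of "\<lambda>w. - w" "\<lambda>h. - h" 0 UNIV "\<lambda>w::complex. G1 ((cmod w)\<^sup>2)" L])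
       (use D True in \<open>auto intro!: derivative_eq_intros\<close>)
  then have "((\<lambda>w::complex. G1 ((cmod w)\<^sup>2)) has_derivative (\<lambda>h. L (- h))) (at w)" using True by simp
  from has_derivative_unique[OF D this] have "L h = L (- h)" by metis
  also have "\<dots> = - L h" using has_derivative_linear[OF D] by (simp add: linear_neg)
  finally show ?thesis using True by simp
next
  case False
  then have "(cmod w)\<^sup>2 > 0" by simp
  with G have G': "(G1 has_derivative (\<lambda>k. dG1 ((cmod w)\<^sup>2) * k)) (at ((cmod w)\<^sup>2))"
    by (simp add: has_field_derivative_def)
  have "((\<lambda>w::complex. (cmod w)\<^sup>2) has_derivative (\<lambda>h. w \<bullet> h + h \<bullet> w)) (at w)"
    unfolding power2_norm_eq_inner by (intro has_derivative_inner has_derivative_ident)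
  from has_derivative_compose[OF this G']
  have "((\<lambda>w::complex. G1 ((cmod w)\<^sup>2)) has_derivative (\<lambda>h. dG1 ((cmod w)\<^sup>2) * (w \<bullet> h + h \<bullet> w))) (at w)" .
  from has_derivative_unique[OF D this] show ?thesis by (simp add: inner_commute)
qed

lemma holder_loc_imp_continuous:
  assumes "holder_loc \<alpha> g" and \<alpha>: "\<alpha> > 0"
  shows "continuous_on UNIV g"
proof -
  have "isCont g z" for z
  proof -
    from assms obtain L where L: "\<And>u w. norm u \<le> norm z + 1 \<Longrightarrow> norm w \<le> norm z + 1 \<Longrightarrow>
        norm (g u - g w) \<le> L * norm (u - w) powr \<alpha>"
      unfolding holder_loc_def by blast
    have "((\<lambda>w. g w - g z) \<longlongrightarrow> 0) (at z)"
    proof (rule Lim_null_comparison)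
      have "\<forall>\<^sub>F w in at z. dist w z < 1" by (auto simp: eventually_at intro!: exI[of _ 1])
      then show "\<forall>\<^sub>F w in at z. norm (g w - g z) \<le> L * norm (w - z) powr \<alpha>"
      proof eventually_elim
        case (elim w)
        have "norm w \<le> norm z + 1" using elim norm_triangle_sub[of w z] by (simp add: dist_norm)
        then show ?case by (intro L) auto
      qed
      have "((\<lambda>w. L * norm (w - z) powr \<alpha>) \<longlongrightarrow> L * 0) (at z)"
        by (intro tendsto_intros tendsto_zero_powrI) (use \<alpha> in \<open>auto intro!: tendsto_eq_intros\<close>)
      then show "((\<lambda>w. L * norm (w - z) powr \<alpha>) \<longlongrightarrow> 0) (at z)" by simp
    qed
    then show ?thesis unfolding isCont_def using Lim_null by blast
  qed
  then show ?thesis by (simp add: continuous_at_imp_continuous_on)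
qed

text \<open>Since \<open>a ^ 3 * (cmod w)\<^sup>2\<close> is the squared modulus of
  \<open>s *\<^sub>R w\<close> with \<open>s = sqrt (a ^ 3)\<close>, both claims reduce to the
  unscaled function. Continuity, including at 0, comes from the Hoelder continuous derivative
  \<open>D\<close>: up to a constant factor, the real and imaginary parts of the nonlinear term are
  \<open>D\<close> applied to 1 and to \<open>\<i>\<close>.\<close>

lemma Ga_gradient:
  fixes D :: "complex \<Rightarrow> (complex \<Rightarrow>\<^sub>L real)"
  assumes G: "\<forall>s>0. (G1 has_real_derivative dG1 s) (at s)"
    and D: "\<And>z. ((\<lambda>w. G1 ((cmod w)\<^sup>2)) has_derivative blinfun_apply (D z)) (at z)"
    and h: "holder_loc \<alpha> D" and \<alpha>: "\<alpha> > 0" and a: "a > 0"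
  shows "((\<lambda>w. Ga G1 a ((cmod w)\<^sup>2)) has_derivative (\<lambda>h. 2 * ((dGa dG1 a ((cmod w)\<^sup>2) *\<^sub>R w) \<bullet> h))) (at w)"
    and "continuous_on UNIV (\<lambda>w. dGa dG1 a ((cmod w)\<^sup>2) *\<^sub>R w)"
proof -
  define s where "s = sqrt (a ^ 3)"
  have s: "s > 0" "s\<^sup>2 = a ^ 3" "s * s = a ^ 3" using a by (simp_all add: s_def)
  have sc: "a ^ 3 * (cmod w)\<^sup>2 = (cmod (s *\<^sub>R w))\<^sup>2" for w
    using s by (simp add: power_mult_distrib)
  have "((\<lambda>w. G1 ((cmod (s *\<^sub>R w))\<^sup>2)) has_derivative (\<lambda>h. D (s *\<^sub>R w) (s *\<^sub>R h))) (at w)"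
    by (rule has_derivative_compose[of "\<lambda>w. s *\<^sub>R w" "\<lambda>h. s *\<^sub>R h" w UNIV "\<lambda>w. G1 ((cmod w)\<^sup>2)" "blinfun_apply (D (s *\<^sub>R w))"])
       (auto intro!: derivative_eq_intros D)
  then have "((\<lambda>w. G1 ((cmod (s *\<^sub>R w))\<^sup>2) / a ^ 5) has_derivative (\<lambda>h. D (s *\<^sub>R w) (s *\<^sub>R h) / a ^ 5)) (at w)"
    by (rule bounded_linear.has_derivative[OF bounded_linear_divide])
  moreover have "D (s *\<^sub>R w) (s *\<^sub>R h) / a ^ 5 = 2 * ((dGa dG1 a ((cmod w)\<^sup>2) *\<^sub>R w) \<bullet> h)" for h
  proof -
    have "D (s *\<^sub>R w) (s *\<^sub>R h) = 2 * ((dG1 (a ^ 3 * (cmod w)\<^sup>2) *\<^sub>R s *\<^sub>R w) \<bullet> (s *\<^sub>R h))"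
      unfolding square_norm_gradient[OF G D] sc ..
    also have "\<dots> = 2 * (dG1 (a ^ 3 * (cmod w)\<^sup>2) * (s * s) * (w \<bullet> h))" by simp
    finally show ?thesis unfolding s(3) dGa_def by (simp add: mult.commute)
  qed
  ultimately show "((\<lambda>w. Ga G1 a ((cmod w)\<^sup>2)) has_derivative (\<lambda>h. 2 * ((dGa dG1 a ((cmod w)\<^sup>2) *\<^sub>R w) \<bullet> h))) (at w)"
    unfolding Ga_def sc by simp
  have Dc: "continuous_on UNIV D" by (rule holder_loc_imp_continuous[OF h \<alpha>])
  have eq: "dGa dG1 a ((cmod w)\<^sup>2) *\<^sub>R w = (a ^ 3 / (2 * s * a ^ 5)) *\<^sub>R Complex (D (s *\<^sub>R w) 1) (D (s *\<^sub>R w) \<i>)" for w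
    unfolding square_norm_gradient[OF G D] sc[symmetric] using s a
    by (intro complex_eqI) (simp_all add: dGa_def inner_complex_def field_simps)
  have c2: "continuous_on UNIV (\<lambda>w. D (s *\<^sub>R w))"
    by (rule continuous_on_compose2[OF Dc]) (auto intro!: continuous_intros)
  show "continuous_on UNIV (\<lambda>w. dGa dG1 a ((cmod w)\<^sup>2) *\<^sub>R w)"
    unfolding eq Complex_eq by (intro continuous_intros c2)
qed

section \<open>Partial derivatives read off from a derivative in spacetime\<close>

lemma has_vector_derivative_time:
  assumes "(F has_derivative L) (at (t, x))"
  shows "((\<lambda>s. F (s, x)) has_vector_derivative L (1, 0)) (at t)"
proof -
  have "((\<lambda>s. (s, x)) has_vector_derivative (1, 0)) (at t)"
    by (intro has_vector_derivative_Pair has_vector_derivative_id has_vector_derivative_const)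
  from vector_derivative_diff_chain_within[OF this, of F L] has_derivative_at_withinI[OF assms]
  show ?thesis by (simp add: o_def)
qed

lemma has_vector_derivative_space:
  assumes "(F has_derivative L) (at (t, x))"
  shows "((\<lambda>s. F (t, x + s *\<^sub>R e)) has_vector_derivative L (0, e)) (at 0)"
proof -
  have 1: "((\<lambda>s. (t, x + s *\<^sub>R e)) has_vector_derivative (0, e)) (at 0)"
    by (auto intro!: derivative_eq_intros has_vector_derivative_Pair)
  have "(F has_derivative L) (at ((\<lambda>s. (t, x + s *\<^sub>R e)) 0) within range (\<lambda>s. (t, x + s *\<^sub>R e)))"
    using has_derivative_at_withinI[OF assms] by simp
  from vector_derivative_diff_chain_within[OF 1 this]
  show ?thesis by (simp add: o_def)
qed

text \<open>Agreement of \<open>f\<close> and \<open>F\<close> on an open set suffices because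
  differentiation is local. This locality makes iterated derivatives accessible: the inner
  derivative is known by a formula only on \<open>U\<close>.\<close>

lemma dt_eq:
  assumes U: "open U" "(t, x) \<in> U" and eq: "\<And>s y. (s, y) \<in> U \<Longrightarrow> f s y = F (s, y)"
    and F: "(F has_derivative L) (at (t, x))"
  shows "dt f t x = L (1, 0)"
proof -
  have o: "open ((\<lambda>s. (s, x)) -` U)" by (intro open_vimage U continuous_intros)
  have "((\<lambda>s. f s x) has_vector_derivative L (1, 0)) (at t)"
    by (rule has_vector_derivative_transform_within_open[OF has_vector_derivative_time[OF F] o])
       (use U eq in auto)
  then show ?thesis unfolding dt_def by (rule vector_derivative_at)
qed

lemma dx_eq:
  assumes U: "open U" "(t, x) \<in> U" and eq: "\<And>s y. (s, y) \<in> U \<Longrightarrow> f s y = F (s, y)"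
    and F: "(F has_derivative L) (at (t, x))"
  shows "dx i f t x = L (0, axis i 1)"
proof -
  have o: "open ((\<lambda>s. (t, x + s *\<^sub>R axis i 1)) -` U)" by (intro open_vimage U continuous_intros)
  have "((\<lambda>s. f t (x + s *\<^sub>R axis i 1)) has_vector_derivative L (0, axis i 1)) (at 0)"
    by (rule has_vector_derivative_transform_within_open[OF has_vector_derivative_space[OF F] o])
       (use U eq in auto)
  then show ?thesis unfolding dx_def by (rule vector_derivative_at)
qed

section \<open>Local balance laws\<close>

text \<open>One member of the sequence. The derivatives live on an open set \<open>U\<close> around
  the tube, so that they are two-sided; the equation itself holds on the tube only. Accordingly,
  derivative formulas below are stated on \<open>U\<close> and balance laws on the tube.\<close>

locale kg_solution =
  fixes c m q chi a Tm Tp R :: real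
    and G1 dG1 :: "real \<Rightarrow> real"
    and rhat v :: "real \<Rightarrow> real^3"
    and phi :: "real \<Rightarrow> real^3 \<Rightarrow> real" and psi :: "real \<Rightarrow> real^3 \<Rightarrow> complex"
    and U :: "(real \<times> (real^3)) set"
    and Dp :: "real \<times> (real^3) \<Rightarrow> (real \<times> (real^3)) \<Rightarrow>\<^sub>L complex"
    and D2p :: "real \<times> (real^3) \<Rightarrow> (real \<times> (real^3)) \<Rightarrow>\<^sub>L ((real \<times> (real^3)) \<Rightarrow>\<^sub>L complex)"
    and Df :: "real \<times> (real^3) \<Rightarrow> (real \<times> (real^3)) \<Rightarrow>\<^sub>L real"
  assumes c: "c > 0" and m: "m > 0" and chi: "chi > 0" and R: "R > 0"
    and U: "open U" and tube_U: "tube Tm Tp rhat R \<subseteq> U"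
    and Dp: "\<And>z. z \<in> U \<Longrightarrow> ((\<lambda>(t, x). psi t x) has_derivative blinfun_apply (Dp z)) (at z)"
    and D2p: "\<And>z. z \<in> U \<Longrightarrow> (Dp has_derivative blinfun_apply (D2p z)) (at z)"
    and cD2p: "continuous_on U D2p"
    and Df: "\<And>z. z \<in> U \<Longrightarrow> ((\<lambda>(t, x). phi t x) has_derivative blinfun_apply (Df z)) (at z)"
    and cDf: "continuous_on U Df"
    and N: "\<And>w. ((\<lambda>w. Ga G1 a ((cmod w)\<^sup>2)) has_derivative (\<lambda>h. 2 * ((dGa dG1 a ((cmod w)\<^sup>2) *\<^sub>R w) \<bullet> h))) (at w)"
    and cg: "continuous_on UNIV (\<lambda>w. dGa dG1 a ((cmod w)\<^sup>2) *\<^sub>R w)"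
    and KG: "\<And>t x. (t, x) \<in> tube Tm Tp rhat R \<Longrightarrow> KG c m q chi a dG1 phi psi t x = 0"
    and rhat: "\<And>t. t \<in> {Tm..Tp} \<Longrightarrow> (rhat has_vector_derivative v t) (at t within {Tm..Tp})"
    and cv: "continuous_on {Tm..Tp} v"
begin

abbreviation "tub \<equiv> tube Tm Tp rhat R"

abbreviation e0 :: "real \<times> (real^3)" where "e0 \<equiv> (1, 0)"
abbreviation ei :: "3 \<Rightarrow> real \<times> (real^3)" where "ei i \<equiv> (0, axis i 1)"

text \<open>
  Fields are functions of the spacetime point \<open>z = (t, x)\<close>; a name starting with \<open>D\<close> denotes a
  derivative, its last argument being the direction.  \<open>K\<close> is the covariant time derivative of the
  wave function \<open>P\<close>.  Below, \<open>en\<close>, \<open>mom\<close>, \<open>str\<close>, \<open>rho\<close> and \<open>cur\<close> are the energy, momentum, stress,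
  charge and current densities; \<open>lagr\<close> is minus the Lagrangian density.
\<close>

definition "P z = (case z of (t, x) \<Rightarrow> psi t x)"
definition "F z = (case z of (t, x) \<Rightarrow> phi t x)"
definition "gP z = dGa dG1 a ((cmod (P z))\<^sup>2) *\<^sub>R P z"
definition "K z = Dp z e0 + (q / chi * F z) *\<^sub>R (\<i> * P z)"
definition "DK z h = D2p z h e0 + (q / chi) *\<^sub>R (Df z h *\<^sub>R (\<i> * P z) + F z *\<^sub>R (\<i> * Dp z h))"

lemma P_deriv: "z \<in> U \<Longrightarrow> (P has_derivative Dp z) (at z)"
  using Dp[of z] by (simp add: P_def[abs_def])

lemma F_deriv: "z \<in> U \<Longrightarrow> (F has_derivative Df z) (at z)"
  using Df[of z] by (simp add: F_def[abs_def])

lemma Dp_deriv: "z \<in> U \<Longrightarrow> ((\<lambda>z. Dp z k) has_derivative (\<lambda>h. D2p z h k)) (at z)"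
  by (rule bounded_linear.has_derivative[OF blinfun.bounded_linear_left D2p])

lemma K_deriv: "z \<in> U \<Longrightarrow> (K has_derivative DK z) (at z)"
  unfolding K_def[abs_def] DK_def
  by (rule has_derivative_eq_rhs, (rule derivative_intros Dp_deriv P_deriv F_deriv | assumption)+)
     (simp add: fun_eq_iff algebra_simps scaleR_add_right)

lemma continuous_fields [continuous_intros]:
  "continuous_on U P" "continuous_on U F" "continuous_on U Dp" "continuous_on U gP"
proof -
  show P: "continuous_on U P" "continuous_on U F" "continuous_on U Dp"
    using P_deriv F_deriv D2p by (meson has_derivative_at_withinI has_derivative_continuous_on)+
  show "continuous_on U gP"
    unfolding gP_def[abs_def] by (rule continuous_on_compose2[OF cg P(1)]) auto
qed

lemma continuous_K [continuous_intros]: "continuous_on U K" "continuous_on U (\<lambda>z. DK z h)"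
  unfolding K_def[abs_def] DK_def by (intro continuous_intros cD2p cDf)+

lemma D2p_sym: "z \<in> U \<Longrightarrow> D2p z h k = D2p z k h"
  by (rule second_derivative_symmetric[OF Dp D2p cD2p U])

lemma psi_dt: "(t, x) \<in> U \<Longrightarrow> dt psi t x = Dp (t, x) e0"
  by (rule dt_eq[OF U _ _ P_deriv]) (auto simp: P_def)

lemma psi_dx: "(t, x) \<in> U \<Longrightarrow> dx i psi t x = Dp (t, x) (ei i)"
  by (rule dx_eq[OF U _ _ P_deriv]) (auto simp: P_def)

lemma phi_dx: "(t, x) \<in> U \<Longrightarrow> dx i phi t x = Df (t, x) (ei i)"
  by (rule dx_eq[OF U _ _ F_deriv]) (auto simp: F_def)

lemma psi_tdt: "(t, x) \<in> U \<Longrightarrow> tdt q chi phi psi t x = K (t, x)"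
  by (simp add: tdt_def psi_dt K_def P_def F_def scaleR_conv_of_real)

lemma psi_tdt_tdt:
  assumes "(t, x) \<in> U"
  shows "tdt q chi phi (tdt q chi phi psi) t x = DK (t, x) e0 + (q / chi * F (t, x)) *\<^sub>R (\<i> * K (t, x))"
proof -
  have "dt (tdt q chi phi psi) t x = DK (t, x) e0"
    by (rule dt_eq[OF U assms _ K_deriv[OF assms]]) (simp add: psi_tdt)
  then show ?thesis by (subst tdt_def) (simp add: psi_tdt[OF assms] F_def scaleR_conv_of_real)
qed

lemma psi_lap:
  assumes "(t, x) \<in> U"
  shows "lap psi t x = (\<Sum>i\<in>UNIV. D2p (t, x) (ei i) (ei i))"
  unfolding lap_def
  by (intro sum.cong refl dx_eq[OF U assms _ Dp_deriv[OF assms]]) (simp add: psi_dx)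

text \<open>The field equation solved for the time derivative of \<open>K\<close>. This is the form
  in which it is substituted into both balance laws.\<close>

lemma wave_equation:
  assumes "z \<in> tub"
  shows "DK z e0 = c\<^sup>2 *\<^sub>R ((\<Sum>i\<in>UNIV. D2p z (ei i) (ei i)) - gP z - ((m * c / chi)\<^sup>2) *\<^sub>R P z)
     - (q / chi * F z) *\<^sub>R (\<i> * K z)"
proof -
  obtain t x where z: "z = (t, x)" by (cases z)
  have zU: "(t, x) \<in> U" using assms z tube_U by auto
  define X where "X = DK z e0 + (q / chi * F z) *\<^sub>R (\<i> * K z)"
  define Y where "Y = (\<Sum>i\<in>UNIV. D2p z (ei i) (ei i)) - gP z - ((m * c / chi)\<^sup>2) *\<^sub>R P z"
  have "- X / complex_of_real (c\<^sup>2) + (\<Sum>i\<in>UNIV. D2p z (ei i) (ei i)) - gP z - ((m * c / chi)\<^sup>2) *\<^sub>R P z = 0"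
    using KG[of t x] assms unfolding KG_def psi_tdt_tdt[OF zU] psi_lap[OF zU] z[symmetric] X_def
    by (simp add: z gP_def P_def scaleR_conv_of_real)
  then have "- X / complex_of_real (c\<^sup>2) + Y = 0"
    unfolding Y_def by (simp only: add_diff_eq)
  then have "X = complex_of_real (c\<^sup>2) * Y"
    using c by (simp add: field_simps)
  then show ?thesis by (simp only: X_def Y_def scaleR_conv_of_real eq_diff_eq)
qed

definition "en z = chi\<^sup>2 / (2 * m) * ((K z \<bullet> K z) / c\<^sup>2 + (\<Sum>i\<in>UNIV. Dp z (ei i) \<bullet> Dp z (ei i))
    + Ga G1 a ((cmod (P z))\<^sup>2) + (m * c / chi)\<^sup>2 * (P z \<bullet> P z))"
definition "De z h = chi\<^sup>2 / m * ((K z \<bullet> DK z h) / c\<^sup>2 + (\<Sum>i\<in>UNIV. Dp z (ei i) \<bullet> D2p z h (ei i))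
    + gP z \<bullet> Dp z h + (m * c / chi)\<^sup>2 * (P z \<bullet> Dp z h))"
definition "mom j z = - (chi\<^sup>2 / (m * c\<^sup>2)) * (K z \<bullet> Dp z (ei j))"
definition "Dmom j z h = - (chi\<^sup>2 / (m * c\<^sup>2)) * (DK z h \<bullet> Dp z (ei j) + K z \<bullet> D2p z h (ei j))"
definition "lagr z = chi\<^sup>2 / (2 * m) * ((\<Sum>i\<in>UNIV. Dp z (ei i) \<bullet> Dp z (ei i))
    + Ga G1 a ((cmod (P z))\<^sup>2) + (m * c / chi)\<^sup>2 * (P z \<bullet> P z) - (K z \<bullet> K z) / c\<^sup>2)"
definition "Dlagr z h = chi\<^sup>2 / m * ((\<Sum>i\<in>UNIV. Dp z (ei i) \<bullet> D2p z h (ei i))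
    + gP z \<bullet> Dp z h + (m * c / chi)\<^sup>2 * (P z \<bullet> Dp z h) - (K z \<bullet> DK z h) / c\<^sup>2)"
definition "str i j z = chi\<^sup>2 / m * (Dp z (ei i) \<bullet> Dp z (ei j)) - (if i = j then lagr z else 0)"
definition "Dstr i j z h = chi\<^sup>2 / m * (D2p z h (ei i) \<bullet> Dp z (ei j) + Dp z (ei i) \<bullet> D2p z h (ei j))
    - (if i = j then Dlagr z h else 0)"
text \<open>The inner product of complex numbers is the real part of \<open>cnj x * y\<close>; hence
  \<open>(\<i> * P z) \<bullet> K z\<close> is the imaginary part of \<open>cnj (P z) * K z\<close>,
  and likewise in \<open>cur\<close>.\<close>

definition "rho z = - (chi * q / (m * c\<^sup>2)) * ((\<i> * P z) \<bullet> K z)"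
definition "cur j z = (chi * q / m) * ((\<i> * P z) \<bullet> Dp z (ei j))"

lemma GP_deriv:
  assumes "z \<in> U"
  shows "((\<lambda>z. Ga G1 a ((cmod (P z))\<^sup>2)) has_derivative (\<lambda>h. 2 * (gP z \<bullet> Dp z h))) (at z)"
  using has_derivative_compose[OF P_deriv[OF assms] N] by (simp add: gP_def)

lemma quadratic_derivs:
  assumes z: "z \<in> U"
  shows "((\<lambda>z. (K z \<bullet> K z) / c\<^sup>2) has_derivative (\<lambda>h. 2 * (K z \<bullet> DK z h) / c\<^sup>2)) (at z)"
    and "((\<lambda>z. \<Sum>i\<in>UNIV. Dp z (ei i) \<bullet> Dp z (ei i)) has_derivative (\<lambda>h. \<Sum>i\<in>UNIV. 2 * (Dp z (ei i) \<bullet> D2p z h (ei i)))) (at z)"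
    and "((\<lambda>z. (m * c / chi)\<^sup>2 * (P z \<bullet> P z)) has_derivative (\<lambda>h. (m * c / chi)\<^sup>2 * (2 * (P z \<bullet> Dp z h)))) (at z)"
proof -
  have sq: "((\<lambda>z. f z \<bullet> f z) has_derivative (\<lambda>h. 2 * (f z \<bullet> f' h))) (at z)"
    if "(f has_derivative f') (at z)" for f f'
    by (rule has_derivative_eq_rhs[OF has_derivative_inner[OF that that]]) (simp add: inner_commute)
  show "((\<lambda>z. (K z \<bullet> K z) / c\<^sup>2) has_derivative (\<lambda>h. 2 * (K z \<bullet> DK z h) / c\<^sup>2)) (at z)"
    by (rule bounded_linear.has_derivative[OF bounded_linear_divide sq[OF K_deriv[OF z]]])
  show "((\<lambda>z. \<Sum>i\<in>UNIV. Dp z (ei i) \<bullet> Dp z (ei i)) has_derivative (\<lambda>h. \<Sum>i\<in>UNIV. 2 * (Dp z (ei i) \<bullet> D2p z h (ei i)))) (at z)"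
    by (intro has_derivative_sum sq[OF Dp_deriv[OF z]])
  show "((\<lambda>z. (m * c / chi)\<^sup>2 * (P z \<bullet> P z)) has_derivative (\<lambda>h. (m * c / chi)\<^sup>2 * (2 * (P z \<bullet> Dp z h)))) (at z)"
    by (rule has_derivative_mult_right[OF sq[OF P_deriv[OF z]]])
qed

lemma en_deriv: assumes z: "z \<in> U" shows "(en has_derivative De z) (at z)"
  unfolding en_def[abs_def]
  by (rule has_derivative_eq_rhs[OF has_derivative_mult_right[OF has_derivative_add[OF has_derivative_add[OF
        has_derivative_add[OF quadratic_derivs(1,2)[OF z]] GP_deriv[OF z]] quadratic_derivs(3)[OF z]]]])
     (use m in \<open>simp add: fun_eq_iff De_def sum_distrib_left[symmetric] field_simps\<close>)

lemma lagr_deriv: assumes z: "z \<in> U" shows "(lagr has_derivative Dlagr z) (at z)"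
  unfolding lagr_def[abs_def]
  by (rule has_derivative_eq_rhs[OF has_derivative_mult_right[OF has_derivative_diff[OF has_derivative_add[OF
        has_derivative_add[OF quadratic_derivs(2)[OF z] GP_deriv[OF z]] quadratic_derivs(3)[OF z]] quadratic_derivs(1)[OF z]]]])
     (use m in \<open>simp add: fun_eq_iff Dlagr_def sum_distrib_left[symmetric] field_simps\<close>)

lemma mom_deriv: assumes z: "z \<in> U" shows "(mom j has_derivative Dmom j z) (at z)"
  unfolding mom_def[abs_def]
  by (rule has_derivative_eq_rhs, (rule derivative_intros Dp_deriv[OF z] K_deriv[OF z])+)
     (simp add: fun_eq_iff Dmom_def algebra_simps)

lemma str_deriv: assumes z: "z \<in> U" shows "(str i j has_derivative Dstr i j z) (at z)"
proof -
  have 1: "((\<lambda>z. if i = j then lagr z else 0) has_derivative (\<lambda>h. if i = j then Dlagr z h else 0)) (at z)"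
    using lagr_deriv[OF z] by (cases "i = j") simp_all
  show ?thesis unfolding str_def[abs_def]
    by (rule has_derivative_eq_rhs, (rule derivative_intros Dp_deriv[OF z] 1)+)
     (simp add: fun_eq_iff Dstr_def algebra_simps)
qed

lemma continuous_densities [continuous_intros]:
  "continuous_on U en" "continuous_on U (mom j)" "continuous_on U rho" "continuous_on U (cur j)"
  "continuous_on U (str i j)"
proof -
  show "continuous_on U en" "continuous_on U (mom j)" "continuous_on U (str i j)"
    by (rule has_derivative_continuous_on, rule has_derivative_at_withinI, erule en_deriv mom_deriv str_deriv)+
  show "continuous_on U rho" "continuous_on U (cur j)"
    unfolding rho_def[abs_def] cur_def[abs_def] by (intro continuous_intros)+
qed

lemma continuous_density_derivatives [continuous_intros]:
  "continuous_on U (\<lambda>z. De z h)" "continuous_on U (\<lambda>z. Dmom j z h)" "continuous_on U (\<lambda>z. Dstr i j z h)"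
proof -
  have c2: "continuous_on U (\<lambda>z. D2p z h k)" for k by (intro continuous_intros cD2p)
  show "continuous_on U (\<lambda>z. De z h)" "continuous_on U (\<lambda>z. Dmom j z h)"
    unfolding De_def Dmom_def using c by (intro continuous_intros c2; simp)+
  have "continuous_on U (\<lambda>z. Dlagr z h)"
    unfolding Dlagr_def using c by (intro continuous_intros c2; simp)+
  then have "continuous_on U (\<lambda>z. if i = j then Dlagr z h else 0)" by (cases "i = j") auto
  then show "continuous_on U (\<lambda>z. Dstr i j z h)"
    unfolding Dstr_def by (intro continuous_intros c2)
qed

lemma i_inner [simp]: "(\<i> * w) \<bullet> w = 0" "w \<bullet> (\<i> * w) = 0" for w :: complex
  by (simp_all add: inner_complex_def)

text \<open>The potential enters \<open>K\<close> through a real multiple of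
  \<open>\<i> * P z\<close>, which is orthogonal to \<open>P z\<close> and to its real multiple
  \<open>gP z\<close>.\<close>

lemma gauge_cancel: "gP z \<bullet> K z = gP z \<bullet> Dp z e0" "P z \<bullet> K z = P z \<bullet> Dp z e0"
  by (simp_all add: K_def gP_def inner_add_right)

text \<open>After substitution of the wave equation the nonlinear and mass terms cancel those in
  \<open>De\<close>, and the potential itself drops out by orthogonality to
  \<open>\<i> * K z\<close>. What is left is the divergence of the flux, except that differentiating
  \<open>K\<close> there also hits the potential; this produces the term with
  \<open>cur\<close>.\<close>

lemma energy_balance:
  assumes z: "z \<in> tub"
  shows "De z e0 = - (c\<^sup>2 * (\<Sum>i\<in>UNIV. Dmom i z (ei i))) - (\<Sum>i\<in>UNIV. Df z (ei i) * cur i z)"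
proof -
  have zU: "z \<in> U" using z tube_U by auto
  have A: "(K z \<bullet> DK z e0) / c\<^sup>2 = (\<Sum>i\<in>UNIV. K z \<bullet> D2p z (ei i) (ei i)) - gP z \<bullet> Dp z e0
      - (m * c / chi)\<^sup>2 * (P z \<bullet> Dp z e0)"
    unfolding wave_equation[OF z] gauge_cancel[symmetric] using c
    by (simp add: inner_diff_right inner_sum_right inner_commute)
  have L: "De z e0 = (\<Sum>i\<in>UNIV. chi\<^sup>2 / m * (K z \<bullet> D2p z (ei i) (ei i) + Dp z (ei i) \<bullet> D2p z e0 (ei i)))"
    by (simp only: De_def A sum.distrib sum_distrib_left[symmetric] distrib_left) (simp add: algebra_simps)
  have "- (c\<^sup>2 * Dmom i z (ei i)) - Df z (ei i) * cur i z
     = chi\<^sup>2 / m * (K z \<bullet> D2p z (ei i) (ei i) + Dp z (ei i) \<bullet> D2p z e0 (ei i))" for i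
    unfolding Dmom_def cur_def DK_def D2p_sym[OF zU, of e0 "ei i"] using c m chi
    by (simp add: inner_add_left inner_add_right inner_commute field_simps power2_eq_square)
  then show ?thesis unfolding L by (simp add: sum_distrib_left sum_negf[symmetric] sum_subtractf[symmetric])
qed

lemma momentum_balance:
  assumes z: "z \<in> tub"
  shows "Dmom j z e0 = - (\<Sum>i\<in>UNIV. Dstr i j z (ei i)) - rho z * Df z (ei j)"
proof -
  have zU: "z \<in> U" using z tube_U by auto
  let ?D = "Dp z (ei j)"
  have A: "DK z e0 \<bullet> ?D / c\<^sup>2 = (\<Sum>i\<in>UNIV. D2p z (ei i) (ei i) \<bullet> ?D) - gP z \<bullet> ?D
      - (m * c / chi)\<^sup>2 * (P z \<bullet> ?D) - q / chi * F z * ((\<i> * K z) \<bullet> ?D) / c\<^sup>2"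
    unfolding wave_equation[OF z] using c
    by (simp add: inner_diff_left inner_sum_left diff_divide_distrib)
  \<comment> \<open>The mixed derivative of the wave function is traded for the spatial derivative
    of \<open>K\<close>, the quantity that occurs in \<open>Dlagr\<close>. Of the two gauge terms
    created, the one with \<open>F z\<close> cancels against the one in \<open>A\<close>; the one
    with the gradient of the potential is the force on the charge.\<close>
  have B: "K z \<bullet> D2p z e0 (ei j) = K z \<bullet> DK z (ei j) - q / chi * (Df z (ei j) * ((\<i> * P z) \<bullet> K z) - F z * ((\<i> * K z) \<bullet> ?D))"
  proof -
    have "K z \<bullet> (\<i> * ?D) = - ((\<i> * K z) \<bullet> ?D)" by (simp add: inner_complex_def)
    then show ?thesis unfolding DK_def D2p_sym[OF zU, of e0 "ei j"]
      by (simp add: inner_add_right inner_commute algebra_simps)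
  qed
  have S: "(\<Sum>i\<in>UNIV. Dstr i j z (ei i)) = chi\<^sup>2 / m * ((\<Sum>i\<in>UNIV. D2p z (ei i) (ei i) \<bullet> ?D) 
      + (\<Sum>i\<in>UNIV. Dp z (ei i) \<bullet> D2p z (ei j) (ei i))) - Dlagr z (ei j)"
  proof -
    have "Dp z (ei i) \<bullet> D2p z (ei i) (ei j) = Dp z (ei i) \<bullet> D2p z (ei j) (ei i)" for i
      by (subst D2p_sym[OF zU]) simp
    then show ?thesis
      by (simp only: Dstr_def sum_subtractf sum.distrib sum_distrib_left[symmetric] distrib_left) simp
  qed
  have M: "Dmom j z e0 = - (chi\<^sup>2 / m) * (DK z e0 \<bullet> ?D / c\<^sup>2 + K z \<bullet> D2p z e0 (ei j) / c\<^sup>2)"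
    unfolding Dmom_def using c m by (simp add: field_simps)
  have r: "rho z = - (chi\<^sup>2 / m * (q / chi) / c\<^sup>2) * ((\<i> * P z) \<bullet> K z)"
    unfolding rho_def using chi by (simp add: power2_eq_square)
  have alg: "- k * ((S1 - g - kp - w * f0 * b / C) + (d - w * (f * p - f0 * b)) / C)
      = - (k * (S1 + S2) - k * (S2 + g + kp - d / C)) - (- (k * w / C) * p) * f" for k w S1 S2 g kp f0 b d f p C :: real
    by (simp add: diff_divide_distrib add_divide_distrib algebra_simps)
  show ?thesis
    unfolding M S A B Dlagr_def r by (rule alg)
qed

lemma energy_density_eq: "(t, x) \<in> U \<Longrightarrow> energy_density c m q chi a G1 phi psi t x = en (t, x)"
  by (simp add: energy_density_def en_def psi_tdt grad_sq_def psi_dx P_def power2_norm_eq_inner)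

lemma charge_density_eq: "(t, x) \<in> U \<Longrightarrow> charge_density c m q chi phi psi t x = rho (t, x)"
  by (simp add: charge_density_def rho_def psi_tdt P_def inner_complex_def)

end

section \<open>Density bounds\<close>

text \<open>This equals \<open>3 * A * (1 + \<bar>q\<bar>) * (u + w)\<close> with
  \<open>u = 1 / m\<close>, \<open>w = 1 / (m * c\<^sup>2)\<close> and \<open>A\<close> the constant
  of \<open>square_bounds\<close>. In \<open>A\<close>, the summand with \<open>c ^ 4\<close> comes
  from the time derivative, the one with \<open>B\<close> from the potential,
  \<open>m\<^sup>2 * c\<^sup>2\<close> from the gradient, nonlinear and mass terms, and 1 from the
  squared wave function. Neither \<open>chi\<close> nor \<open>a\<close> occurs.\<close>

definition dens_const :: "real \<Rightarrow> real \<Rightarrow> real \<Rightarrow> real \<Rightarrow> real" where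
  "dens_const c m q B = 3 * (2 * m\<^sup>2 * c ^ 4 + 2 * q\<^sup>2 * B\<^sup>2 + m\<^sup>2 * c\<^sup>2) * (1 + \<bar>q\<bar>) * (1 / m + 1 / (m * c\<^sup>2))
     + 3 * (1 + \<bar>q\<bar>) * (1 / m + 1 / (m * c\<^sup>2))"

lemma abs_inner_le_of_squares:
  fixes x y :: "'a::real_inner"
  assumes "x \<bullet> x \<le> A" "y \<bullet> y \<le> A"
  shows "\<bar>x \<bullet> y\<bar> \<le> A"
proof -
  have "\<bar>x \<bullet> y\<bar>\<^sup>2 \<le> (x \<bullet> x) * (y \<bullet> y)" using Cauchy_Schwarz_ineq[of x y] by simp
  also have "\<dots> \<le> A * A" using assms order_trans[OF inner_ge_zero] by (intro mult_mono) auto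
  finally have "\<bar>x \<bullet> y\<bar>\<^sup>2 \<le> A\<^sup>2" by (simp add: power2_eq_square)
  then show ?thesis by (rule power2_le_imp_le) (use assms order_trans[OF inner_ge_zero] in blast)
qed

lemma abs_add4_le:
  fixes x1 x2 x3 x4 :: real
  assumes "\<bar>x1\<bar> \<le> y1" "\<bar>x2\<bar> \<le> y2" "\<bar>x3\<bar> \<le> y3" "\<bar>x4\<bar> \<le> y4"
  shows "\<bar>x1 + x2 + x3 + x4\<bar> \<le> y1 + y2 + y3 + y4"
  using assms by linarith

context kg_solution
begin

definition "lc z = (chi / (m * c))\<^sup>2 * ((Dp z e0 \<bullet> Dp z e0) / c\<^sup>2 + (\<Sum>i\<in>UNIV. Dp z (ei i) \<bullet> Dp z (ei i)))
   + (chi / (m * c))\<^sup>2 * \<bar>Ga G1 a ((cmod (P z))\<^sup>2)\<bar> + P z \<bullet> P z"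

lemma loc_integrand_eq: "(t, x) \<in> U \<Longrightarrow> loc_integrand c (chi / (m * c)) a G1 psi t x = lc (t, x)"
  by (simp add: loc_integrand_def lc_def grad0_sq_def grad_sq_def psi_dt psi_dx P_def power2_norm_eq_inner)

lemma continuous_lc [continuous_intros]: "continuous_on U lc"
proof -
  have "continuous_on U (\<lambda>z. Ga G1 a ((cmod (P z))\<^sup>2))"
    by (rule has_derivative_continuous_on[OF has_derivative_at_withinI[OF GP_deriv]])
  then show ?thesis unfolding lc_def[abs_def] using c by (intro continuous_intros) auto
qed

text \<open>Multiplication by \<open>chi\<close> is what makes the bounds uniform: it cancels the
  factor \<open>1 / chi\<close> in front of the potential in \<open>K\<close>, and
  \<open>chi\<^sup>2\<close> is \<open>m\<^sup>2 * c\<^sup>2\<close> times the squared Compton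
  length that weights the gradient and nonlinear terms of \<open>lc\<close>.\<close>

lemma square_bounds:
  assumes B: "\<bar>F z\<bar> \<le> B"
  defines "A \<equiv> (2 * m\<^sup>2 * c ^ 4 + 2 * q\<^sup>2 * B\<^sup>2 + m\<^sup>2 * c\<^sup>2) + 1"
  shows "(chi *\<^sub>R K z) \<bullet> (chi *\<^sub>R K z) \<le> A * lc z" "(chi *\<^sub>R Dp z (ei i)) \<bullet> (chi *\<^sub>R Dp z (ei i)) \<le> A * lc z"
    "chi\<^sup>2 * (\<Sum>i\<in>UNIV. Dp z (ei i) \<bullet> Dp z (ei i)) \<le> A * lc z" "chi\<^sup>2 * \<bar>Ga G1 a ((cmod (P z))\<^sup>2)\<bar> \<le> A * lc z"
    "P z \<bullet> P z \<le> A * lc z" "chi\<^sup>2 * ((m * c / chi)\<^sup>2 * (P z \<bullet> P z)) \<le> A * lc z" "0 \<le> lc z"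
proof -
  define s where "s = (chi / (m * c))\<^sup>2"
  have cm: "chi\<^sup>2 = m\<^sup>2 * c\<^sup>2 * s" unfolding s_def using c m by (simp add: power_divide power_mult_distrib)
  have s0: "0 \<le> s" by (simp add: s_def)
  define d0 where "d0 = s * ((Dp z e0 \<bullet> Dp z e0) / c\<^sup>2)"
  define d1 where "d1 = s * (\<Sum>i\<in>UNIV. Dp z (ei i) \<bullet> Dp z (ei i))"
  define d2 where "d2 = s * \<bar>Ga G1 a ((cmod (P z))\<^sup>2)\<bar>"
  define d3 where "d3 = P z \<bullet> P z"
  have nn: "0 \<le> d0" "0 \<le> d1" "0 \<le> d2" "0 \<le> d3"
    unfolding d0_def d1_def d2_def d3_def using s0 by (auto intro!: mult_nonneg_nonneg divide_nonneg_nonneg sum_nonneg)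
  have lcd: "lc z = d0 + d1 + d2 + d3"
    unfolding lc_def d0_def d1_def d2_def d3_def s_def by (simp add: distrib_left)
  have Ag: "1 \<le> A" "m\<^sup>2 * c\<^sup>2 \<le> A" "2 * m\<^sup>2 * c ^ 4 \<le> A" "2 * q\<^sup>2 * B\<^sup>2 \<le> A" by (simp_all add: A_def)
  have le: "k * x \<le> A * lc z" if "k \<le> A" "0 \<le> x" "x \<le> lc z" for k x
    using that Ag by (intro mult_mono) auto
  show "0 \<le> lc z" using nn lcd by simp
  show "chi\<^sup>2 * (\<Sum>i\<in>UNIV. Dp z (ei i) \<bullet> Dp z (ei i)) \<le> A * lc z"
    using le[OF Ag(2), of d1] nn lcd unfolding cm d1_def by (simp add: mult.assoc)
  moreover have "Dp z (ei i) \<bullet> Dp z (ei i) \<le> (\<Sum>i\<in>UNIV. Dp z (ei i) \<bullet> Dp z (ei i))"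
    by (rule member_le_sum) auto
  then have "chi\<^sup>2 * (Dp z (ei i) \<bullet> Dp z (ei i)) \<le> chi\<^sup>2 * (\<Sum>i\<in>UNIV. Dp z (ei i) \<bullet> Dp z (ei i))"
    by (intro mult_left_mono) auto
  ultimately show "(chi *\<^sub>R Dp z (ei i)) \<bullet> (chi *\<^sub>R Dp z (ei i)) \<le> A * lc z"
    by (simp add: power2_eq_square mult.assoc)
  show "chi\<^sup>2 * \<bar>Ga G1 a ((cmod (P z))\<^sup>2)\<bar> \<le> A * lc z"
    using le[OF Ag(2), of d2] nn lcd unfolding cm d2_def by (simp add: mult.assoc)
  show "P z \<bullet> P z \<le> A * lc z" using le[OF Ag(1), of d3] nn lcd unfolding d3_def by simp
  have "chi\<^sup>2 * ((m * c / chi)\<^sup>2 * (P z \<bullet> P z)) = m\<^sup>2 * c\<^sup>2 * d3"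
    unfolding d3_def using chi by (simp add: power_divide power_mult_distrib)
  then show "chi\<^sup>2 * ((m * c / chi)\<^sup>2 * (P z \<bullet> P z)) \<le> A * lc z"
    using le[OF Ag(2), of d3] nn lcd by simp
  define x where "x = chi *\<^sub>R Dp z e0"
  define y where "y = (q * F z) *\<^sub>R (\<i> * P z)"
  have K: "chi *\<^sub>R K z = x + y" unfolding K_def x_def y_def using chi by (simp add: scaleR_add_right)
  have "(x + y) \<bullet> (x + y) \<le> 2 * (x \<bullet> x) + 2 * (y \<bullet> y)"
    using inner_ge_zero[of "x - y"] by (simp add: inner_diff_left inner_diff_right inner_add_left inner_add_right inner_commute)
  also have "x \<bullet> x = m\<^sup>2 * c ^ 4 * d0"
    unfolding x_def d0_def using cm c by (simp add: power2_eq_square power4_eq_xxxx mult.assoc[symmetric])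
  also have "2 * (y \<bullet> y) \<le> 2 * q\<^sup>2 * B\<^sup>2 * d3"
  proof -
    have "(F z)\<^sup>2 \<le> B\<^sup>2" using B by (metis abs_ge_zero order_trans power2_abs power_mono)
    then have "2 * q\<^sup>2 * (F z)\<^sup>2 * d3 \<le> 2 * q\<^sup>2 * B\<^sup>2 * d3"
      using nn by (intro mult_right_mono mult_left_mono) auto
    moreover have "(\<i> * P z) \<bullet> (\<i> * P z) = d3" by (simp add: inner_complex_def d3_def)
    ultimately show ?thesis by (simp add: y_def power2_eq_square algebra_simps)
  qed
  also have "2 * (m\<^sup>2 * c ^ 4 * d0) + 2 * q\<^sup>2 * B\<^sup>2 * d3 \<le> A * d0 + A * d3"
    using mult_right_mono[OF Ag(3) nn(1)] mult_right_mono[OF Ag(4) nn(4)] by (simp add: mult.assoc)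
  also have "\<dots> \<le> A * lc z" using nn Ag lcd by (simp add: distrib_left)
  finally show "(chi *\<^sub>R K z) \<bullet> (chi *\<^sub>R K z) \<le> A * lc z" using K by simp
qed

text \<open>The powers of \<open>chi\<close> in the densities match those in
  \<open>square_bounds\<close>: every density is a combination of products of two of
  \<open>chi *\<^sub>R K z\<close>, \<open>chi *\<^sub>R Dp z (ei i)\<close>,
  \<open>\<i> * P z\<close>, and of the nonlinear and mass terms. Products are handled by
  Cauchy-Schwarz; the prefactors are \<open>u\<close> and \<open>w\<close> up to a factor one half
  or \<open>\<bar>q\<bar>\<close>.\<close>

lemma density_bounds:
  assumes B: "\<bar>F z\<bar> \<le> B"
  defines "W \<equiv> dens_const c m q B"
  shows "\<bar>en z\<bar> \<le> W * lc z" "\<bar>mom j z\<bar> \<le> W * lc z" "\<bar>str i j z\<bar> \<le> W * lc z"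
    "\<bar>rho z\<bar> \<le> W * lc z" "\<bar>cur j z\<bar> \<le> W * lc z"
proof -
  define A where "A = (2 * m\<^sup>2 * c ^ 4 + 2 * q\<^sup>2 * B\<^sup>2 + m\<^sup>2 * c\<^sup>2) + 1"
  note sq = square_bounds[OF B, folded A_def]
  define X where "X = A * lc z"
  define u where "u = 1 / m"
  define w where "w = 1 / (m * c\<^sup>2)"
  have uw: "0 < u" "0 < w" using c m by (auto simp: u_def w_def)
  have "0 \<le> A" unfolding A_def by (auto intro!: add_nonneg_nonneg mult_nonneg_nonneg)
  then have X: "0 \<le> X" using sq(7) by (simp add: X_def)
  have W: "W * lc z = 3 * (1 + \<bar>q\<bar>) * (u + w) * X"
    unfolding W_def dens_const_def X_def u_def w_def A_def by (simp add: algebra_simps)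
  have iP: "(\<i> * P z) \<bullet> (\<i> * P z) \<le> X" using sq(5) by (simp add: X_def inner_complex_def)
  have KK: "\<bar>chi\<^sup>2 * (K z \<bullet> K z)\<bar> \<le> X"
    using abs_inner_le_of_squares[OF sq(1) sq(1)] by (simp add: X_def power2_eq_square mult.assoc)
  have GG: "\<bar>chi\<^sup>2 * Ga G1 a ((cmod (P z))\<^sup>2)\<bar> \<le> X" using sq(4) by (simp add: X_def abs_mult)
  have SS: "\<bar>chi\<^sup>2 * (\<Sum>i\<in>UNIV. Dp z (ei i) \<bullet> Dp z (ei i))\<bar> \<le> X"
    using sq(3) by (simp add: X_def abs_mult sum_nonneg)
  have PP: "\<bar>chi\<^sup>2 * ((m * c / chi)\<^sup>2 * (P z \<bullet> P z))\<bar> \<le> X"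
    using sq(6) by (simp add: X_def abs_mult)
  have DK: "\<bar>chi\<^sup>2 * (K z \<bullet> Dp z (ei j))\<bar> \<le> X" for j
    using abs_inner_le_of_squares[OF sq(1) sq(2)[of j]] by (simp add: X_def power2_eq_square mult.assoc)
  have DD: "\<bar>chi\<^sup>2 * (Dp z (ei i) \<bullet> Dp z (ei j))\<bar> \<le> X"
    using abs_inner_le_of_squares[OF sq(2)[of i] sq(2)[of j]] by (simp add: X_def power2_eq_square mult.assoc)
  have PK: "\<bar>chi * ((\<i> * P z) \<bullet> K z)\<bar> \<le> X"
    using abs_inner_le_of_squares[OF iP sq(1)[folded X_def]] by simp
  have PD: "\<bar>chi * ((\<i> * P z) \<bullet> Dp z (ei j))\<bar> \<le> X"
    using abs_inner_le_of_squares[OF iP sq(2)[folded X_def]] by simp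
  have scale: "\<bar>k * x\<bar> \<le> k * X" if "0 \<le> k" "\<bar>x\<bar> \<le> X" for k x
    using that by (simp add: abs_mult mult_left_mono)
  have uX: "0 \<le> u * X" "0 \<le> w * X" "0 \<le> \<bar>q\<bar> * (u * X)" "0 \<le> \<bar>q\<bar> * (w * X)" using uw X by simp_all
  have W': "W * lc z = 3 * (u * X) + 3 * (w * X) + 3 * (\<bar>q\<bar> * (u * X)) + 3 * (\<bar>q\<bar> * (w * X))"
    unfolding W by (simp add: algebra_simps)
  have "en z = (w / 2) * (chi\<^sup>2 * (K z \<bullet> K z)) + (u / 2) * (chi\<^sup>2 * (\<Sum>i\<in>UNIV. Dp z (ei i) \<bullet> Dp z (ei i)))
     + (u / 2) * (chi\<^sup>2 * Ga G1 a ((cmod (P z))\<^sup>2)) + (u / 2) * (chi\<^sup>2 * ((m * c / chi)\<^sup>2 * (P z \<bullet> P z)))"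
    unfolding en_def u_def w_def by (simp add: distrib_left mult.commute)
  then have "\<bar>en z\<bar> \<le> (w / 2) * X + (u / 2) * X + (u / 2) * X + (u / 2) * X"
    by (simp only:) (intro abs_add4_le scale KK SS GG PP, use uw in auto)
  then show "\<bar>en z\<bar> \<le> W * lc z" unfolding W' using uX by linarith
  have "lagr z = (u / 2) * (chi\<^sup>2 * (\<Sum>i\<in>UNIV. Dp z (ei i) \<bullet> Dp z (ei i)))
     + (u / 2) * (chi\<^sup>2 * Ga G1 a ((cmod (P z))\<^sup>2)) + (u / 2) * (chi\<^sup>2 * ((m * c / chi)\<^sup>2 * (P z \<bullet> P z)))
     + (w / 2) * (- (chi\<^sup>2 * (K z \<bullet> K z)))"
    unfolding lagr_def u_def w_def by (simp add: distrib_left right_diff_distrib mult.commute)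
  then have lg: "\<bar>lagr z\<bar> \<le> (u / 2) * X + (u / 2) * X + (u / 2) * X + (w / 2) * X"
    by (simp only:) (intro abs_add4_le scale SS GG PP, use uw KK in auto)
  have "str i j z = u * (chi\<^sup>2 * (Dp z (ei i) \<bullet> Dp z (ei j))) - (if i = j then lagr z else 0)"
    unfolding str_def u_def by simp
  moreover have "\<bar>u * (chi\<^sup>2 * (Dp z (ei i) \<bullet> Dp z (ei j)))\<bar> \<le> u * X" by (rule scale[OF _ DD]) (use uw in simp)
  ultimately have "\<bar>str i j z\<bar> \<le> u * X + \<bar>lagr z\<bar>" by (auto split: if_splits)
  then show "\<bar>str i j z\<bar> \<le> W * lc z" unfolding W' using lg uX by linarith
  have "mom j z = - (w * (chi\<^sup>2 * (K z \<bullet> Dp z (ei j))))" unfolding mom_def w_def by simp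
  then have "\<bar>mom j z\<bar> = \<bar>w * (chi\<^sup>2 * (K z \<bullet> Dp z (ei j)))\<bar>" by (simp only: abs_minus_cancel)
  also have "\<dots> \<le> w * X" by (rule scale[OF _ DK]) (use uw in simp)
  finally show "\<bar>mom j z\<bar> \<le> W * lc z" unfolding W' using uX by linarith
  have "rho z = - q * (w * (chi * ((\<i> * P z) \<bullet> K z)))" unfolding rho_def w_def by simp
  then have "\<bar>rho z\<bar> = \<bar>q\<bar> * \<bar>w * (chi * ((\<i> * P z) \<bullet> K z))\<bar>" by (simp only: abs_mult abs_minus_cancel)
  also have "\<dots> \<le> \<bar>q\<bar> * (w * X)" by (rule mult_left_mono[OF scale[OF _ PK]]) (use uw in auto)
  finally show "\<bar>rho z\<bar> \<le> W * lc z" unfolding W' using uX by linarith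
  have "cur j z = q * (u * (chi * ((\<i> * P z) \<bullet> Dp z (ei j))))" unfolding cur_def u_def by simp
  then have "\<bar>cur j z\<bar> = \<bar>q\<bar> * \<bar>u * (chi * ((\<i> * P z) \<bullet> Dp z (ei j)))\<bar>" by (simp only: abs_mult)
  also have "\<dots> \<le> \<bar>q\<bar> * (u * X)" by (rule mult_left_mono[OF scale[OF _ PD]]) (use uw in auto)
  finally show "\<bar>cur j z\<bar> \<le> W * lc z" unfolding W' using uX by linarith
qed

end

section \<open>Integrals over the moving ball\<close>

context kg_solution
begin

definition ball_int :: "real \<Rightarrow> (real \<times> (real^3) \<Rightarrow> real) \<Rightarrow> real" where
  "ball_int t g = integral (cball (rhat t) R) (\<lambda>x. g (t, x))"

lemma slice_U: "t \<in> {Tm..Tp} \<Longrightarrow> x \<in> cball (rhat t) R \<Longrightarrow> (t, x) \<in> U"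
  using tube_U by (auto simp: tube_def)

lemma slice_tub: "t \<in> {Tm..Tp} \<Longrightarrow> x \<in> cball (rhat t) R \<Longrightarrow> (t, x) \<in> tub"
  by (auto simp: tube_def)

lemma slice_continuous:
  fixes g :: "real \<times> (real^3) \<Rightarrow> real"
  assumes "continuous_on U g" "t \<in> {Tm..Tp}"
  shows "continuous_on (cball (rhat t) R) (\<lambda>x. g (t, x))"
  by (rule continuous_on_compose2[OF assms(1)]) (use slice_U[OF assms(2)] in \<open>auto intro!: continuous_intros\<close>)

lemma slice_integrable:
  fixes g :: "real \<times> (real^3) \<Rightarrow> real"
  assumes "continuous_on U g" "t \<in> {Tm..Tp}"
  shows "(\<lambda>x. g (t, x)) integrable_on cball (rhat t) R"
  using borel_integrable_compact[OF compact_cball slice_continuous[OF assms]]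
    set_borel_integral_eq_integral(1)[of "cball (rhat t) R" "\<lambda>x. g (t, x)"]
  by (simp add: set_integrable_def)

lemma ball_int_add:
  assumes "continuous_on U f" "continuous_on U g" "t \<in> {Tm..Tp}"
  shows "ball_int t (\<lambda>z. f z + g z) = ball_int t f + ball_int t g"
  unfolding ball_int_def
  by (intro Henstock_Kurzweil_Integration.integral_add slice_integrable assms)

lemma ball_int_cmult: "ball_int t (\<lambda>z. k * g z) = k * ball_int t g"
  unfolding ball_int_def by simp

lemma ball_int_uminus: "ball_int t (\<lambda>z. - g z) = - ball_int t g"
  using ball_int_cmult[of t "- 1" g] by simp

lemma ball_int_sum:
  fixes f :: "3 \<Rightarrow> real \<times> (real^3) \<Rightarrow> real"
  assumes "\<And>i. continuous_on U (f i)" "t \<in> {Tm..Tp}"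
  shows "ball_int t (\<lambda>z. \<Sum>i\<in>UNIV. f i z) = (\<Sum>i\<in>UNIV. ball_int t (f i))"
  unfolding ball_int_def by (intro integral_sum slice_integrable assms) simp

lemma ball_int_cong:
  assumes "\<And>z. z \<in> tub \<Longrightarrow> f z = g z" "t \<in> {Tm..Tp}"
  shows "ball_int t f = ball_int t g"
  unfolding ball_int_def by (rule integral_cong) (use assms slice_tub in auto)

lemma ball_int_bound:
  assumes "continuous_on U g" "t \<in> {Tm..Tp}" "\<And>x. x \<in> cball (rhat t) R \<Longrightarrow> \<bar>g (t, x)\<bar> \<le> k * lc (t, x)"
  shows "\<bar>ball_int t g\<bar> \<le> k * ball_int t lc"
proof -
  have "norm (ball_int t g) \<le> ball_int t (\<lambda>z. k * lc z)"
    unfolding ball_int_def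
    by (rule integral_norm_bound_integral)
       (use assms in \<open>auto intro!: slice_integrable continuous_intros\<close>)
  then show ?thesis by (simp add: ball_int_cmult)
qed

lemma ball_int_loc_integrand:
  assumes "t \<in> {Tm..Tp}"
  shows "integral (cball (rhat t) R) (loc_integrand c (chi / (m * c)) a G1 psi t) = ball_int t lc"
  unfolding ball_int_def by (rule integral_cong) (use slice_U[OF assms] in \<open>auto simp: loc_integrand_eq\<close>)

text \<open>The gate through which the smallness of the sphere integrals enters: the total of a
  spatial derivative is a boundary term, and a density dominated by \<open>k * lc\<close> leaves at
  most \<open>k * d\<close>.\<close>

lemma ball_int_partial_bound:
  assumes D: "\<And>z. z \<in> U \<Longrightarrow> (g has_derivative Dg z) (at z)"
    and cD: "\<And>h. continuous_on U (\<lambda>z. Dg z h)"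
    and t: "t \<in> {Tm..Tp}" and k: "\<And>x. x \<in> cball (rhat t) R \<Longrightarrow> \<bar>g (t, x)\<bar> \<le> k * lc (t, x)"
    and d: "sphere_integral (rhat t) R (loc_integrand c (chi / (m * c)) a G1 psi t) \<le> d" "0 \<le> k"
  shows "\<bar>ball_int t (\<lambda>z. Dg z (ei i))\<bar> \<le> k * d"
proof -
  have "\<bar>integral (cball (rhat t) R) (\<lambda>x. Dg (t, x) (ei i))\<bar> \<le> sphere_integral (rhat t) R (\<lambda>x. k * lc (t, x))"
  proof (rule integral_ball_partial_bound[where D = "\<lambda>x h. Dg (t, x) (0, h)" and f = "\<lambda>x. g (t, x)"])
    fix x assume x: "x \<in> cball (rhat t) R"
    have "((\<lambda>x. (t, x)) has_derivative (\<lambda>h. (0, h))) (at x)"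
      by (intro has_derivative_Pair has_derivative_const has_derivative_ident)
    from has_derivative_compose[OF this D[OF slice_U[OF t x]]]
    show "((\<lambda>x. g (t, x)) has_derivative (\<lambda>h. Dg (t, x) (0, h))) (at x)" .
  next
    show "continuous_on (sphere (rhat t) R) (\<lambda>x. k * lc (t, x))"
      by (rule continuous_on_subset[OF slice_continuous[OF _ t, of "\<lambda>z. k * lc z"] sphere_cball])
         (intro continuous_intros)
    show "\<bar>g (t, x)\<bar> \<le> k * lc (t, x)" if "x \<in> sphere (rhat t) R" for x
      using k[of x] that sphere_cball by auto
  qed (use R in \<open>auto intro!: slice_continuous cD t\<close>)
  also have "sphere_integral (rhat t) R (\<lambda>x. k * lc (t, x))
      = k * sphere_integral (rhat t) R (loc_integrand c (chi / (m * c)) a G1 psi t)"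
  proof -
    have "rhat t + R *\<^sub>R sph_dir \<theta> \<phi> \<in> cball (rhat t) R" for \<theta> \<phi>
      using R by (simp add: dist_norm)
    then have "loc_integrand c (chi / (m * c)) a G1 psi t (rhat t + R *\<^sub>R sph_dir \<theta> \<phi>) = lc (t, rhat t + R *\<^sub>R sph_dir \<theta> \<phi>)" for \<theta> \<phi>
      by (intro loc_integrand_eq slice_U t)
    then have "sphere_integral (rhat t) R (loc_integrand c (chi / (m * c)) a G1 psi t)
      = integral (cbox (0, 0) (pi, 2 * pi)) (\<lambda>p. lc (t, rhat t + R *\<^sub>R sph_dir (fst p) (snd p)) * R\<^sup>2 * sin (fst p))"
      unfolding sphere_integral_alt by (simp add: case_prod_unfold)
    moreover have "sphere_integral (rhat t) R (\<lambda>x. k * lc (t, x))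
      = integral (cbox (0, 0) (pi, 2 * pi)) (\<lambda>p. k * (lc (t, rhat t + R *\<^sub>R sph_dir (fst p) (snd p)) * R\<^sup>2 * sin (fst p)))"
      unfolding sphere_integral_alt by (simp add: case_prod_unfold mult.assoc)
    ultimately show ?thesis by simp
  qed
  also have "\<dots> \<le> k * d" using d by (intro mult_left_mono)
  finally show ?thesis unfolding ball_int_def .
qed

lemma ball_int_time_derivative:
  assumes D: "\<And>z. z \<in> U \<Longrightarrow> (g has_derivative Dg z) (at z)"
    and cD: "\<And>h. continuous_on U (\<lambda>z. Dg z h)"
    and t: "t \<in> {Tm..Tp}"
  shows "((\<lambda>t. ball_int t g) has_real_derivative
      (ball_int t (\<lambda>z. Dg z e0) + (\<Sum>i\<in>UNIV. v t $ i * ball_int t (\<lambda>z. Dg z (ei i))))) (at t within {Tm..Tp})"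
proof -
  have "((\<lambda>t. ball_int t g) has_vector_derivative ball_int t (\<lambda>z. Dg z (1, v t))) (at t within {Tm..Tp})"
    unfolding ball_int_def
  proof (rule moving_ball_integral_derivative[OF _ _ R rhat cv t])
    show "(g has_derivative Dg z) (at z)" if "z \<in> tub" for z using D that tube_U by blast
    show "continuous_on tub (\<lambda>z. Dg z h)" for h by (rule continuous_on_subset[OF cD tube_U])
  qed
  moreover have "ball_int t (\<lambda>z. Dg z (1, v t)) = ball_int t (\<lambda>z. Dg z e0 + (\<Sum>i\<in>UNIV. v t $ i * Dg z (ei i)))"
  proof (rule ball_int_cong[OF _ t])
    fix z assume "z \<in> tub"
    then have "linear (Dg z)" using D tube_U has_derivative_linear by blast
    from linear_spacetime_expand[OF this, of 1 "v t"]
    show "Dg z (1, v t) = Dg z e0 + (\<Sum>i\<in>UNIV. v t $ i * Dg z (ei i))"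
      unfolding sum_3 by simp
  qed
  moreover have "\<dots> = ball_int t (\<lambda>z. Dg z e0) + (\<Sum>i\<in>UNIV. v t $ i * ball_int t (\<lambda>z. Dg z (ei i)))"
    using t by (simp add: ball_int_add ball_int_sum ball_int_cmult continuous_intros cD)
  ultimately show ?thesis by (simp add: has_real_derivative_iff_has_vector_derivative)
qed

end

text \<open>The single parameter \<open>d\<close> dominates the radius, the sphere integral, the
  deviation of the potential gradient and the deviation of the charge. The other constants are meant
  to be independent of the index. The bound \<open>d \<le> 1\<close> allows terms of second order in
  \<open>d\<close> to be absorbed into first order.\<close>

locale kg_estimates = kg_solution +
  fixes B V C1 c0 d rinf G :: real and gphi :: "real \<Rightarrow> real^3"
  assumes TT: "Tm < Tp"
    and phi_B: "\<And>t x. (t, x) \<in> tube Tm Tp rhat R \<Longrightarrow> \<bar>phi t x\<bar> \<le> B"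
    and dphi_B: "\<And>t x i. (t, x) \<in> tube Tm Tp rhat R \<Longrightarrow> \<bar>dx i phi t x\<bar> \<le> B"
    and v_V: "\<And>t. t \<in> {Tm..Tp} \<Longrightarrow> norm (v t) \<le> V"
    and lc_C1: "\<And>t. t \<in> {Tm..Tp} \<Longrightarrow> integral (cball (rhat t) R) (loc_integrand c (chi / (m * c)) a G1 psi t) \<le> C1"
    and lc_d: "\<And>t. t \<in> {Tm..Tp} \<Longrightarrow> sphere_integral (rhat t) R (loc_integrand c (chi / (m * c)) a G1 psi t) \<le> d"
    and c0: "c0 > 0" and E_c0: "\<And>t. t \<in> {Tm..Tp} \<Longrightarrow> Ebar c m q chi a G1 phi psi rhat R t \<ge> c0"
    and d: "R \<le> d" "d \<le> 1"
    and dphi_d: "\<And>t x i. (t, x) \<in> tube Tm Tp rhat R \<Longrightarrow> \<bar>dx i phi t x - gphi t $ i\<bar> \<le> d"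
    and rho_d: "\<And>t. t \<in> {Tm..Tp} \<Longrightarrow> \<bar>rhobar c m q chi phi psi rhat R t - rinf\<bar> \<le> d"
    and gphi_G: "\<And>t. t \<in> {Tm..Tp} \<Longrightarrow> norm (gphi t) \<le> G"
    and gphi_c: "continuous_on {Tm..Tp} gphi"
begin

abbreviation "W \<equiv> dens_const c m q B"

lemma W_nonneg: "0 \<le> W"
  unfolding dens_const_def using c m by (intro add_nonneg_nonneg mult_nonneg_nonneg) auto

lemma d_pos: "0 < d" using R d by simp

lemma F_B: "z \<in> tub \<Longrightarrow> \<bar>F z\<bar> \<le> B" using phi_B by (cases z) (auto simp: F_def)

lemma Df_B: "z \<in> tub \<Longrightarrow> \<bar>Df z (ei i)\<bar> \<le> B"
  using dphi_B phi_dx tube_U by (cases z) (metis subsetD)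

lemma Df_d: "(t, x) \<in> tub \<Longrightarrow> \<bar>Df (t, x) (ei i) - gphi t $ i\<bar> \<le> d"
  using dphi_d phi_dx tube_U by (metis subsetD)

lemma nonneg: "0 \<le> B" "0 \<le> V" "0 \<le> C1" "0 \<le> G"
proof -
  have T: "Tm \<in> {Tm..Tp}" using TT by simp
  have z: "(Tm, rhat Tm) \<in> tub" using T R by (auto simp: tube_def)
  show "0 \<le> B" using phi_B[OF z] by simp
  show "0 \<le> V" using v_V[OF T] norm_ge_zero order_trans by blast
  show "0 \<le> G" using gphi_G[OF T] norm_ge_zero order_trans by blast
  have "0 \<le> ball_int Tm lc"
    unfolding ball_int_def
    by (rule integral_nonneg[OF slice_integrable[OF continuous_lc T]])
       (use square_bounds(7)[OF F_B] slice_tub[OF T] in blast)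
  then show "0 \<le> C1" using lc_C1[OF T] ball_int_loc_integrand[OF T] by simp
qed

lemmas db = density_bounds[OF F_B]

lemma lc_nonneg: "z \<in> tub \<Longrightarrow> 0 \<le> lc z" using square_bounds(7)[OF F_B] .

lemma ball_int_C1:
  assumes "continuous_on U g" "t \<in> {Tm..Tp}" "0 \<le> k" "\<And>x. x \<in> cball (rhat t) R \<Longrightarrow> \<bar>g (t, x)\<bar> \<le> k * lc (t, x)"
  shows "\<bar>ball_int t g\<bar> \<le> k * C1"
  using ball_int_bound[OF assms(1,2,4)] mult_left_mono[OF lc_C1[OF assms(2)] assms(3)]
    ball_int_loc_integrand[OF assms(2)] by simp

lemma v_i: "t \<in> {Tm..Tp} \<Longrightarrow> \<bar>v t $ i\<bar> \<le> V"
  using component_le_norm_cart[of "v t" i] v_V by force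

text \<open>Origin of the constant: three stress fluxes give \<open>3 * W\<close>, three transport
  terms give \<open>3 * V * W\<close>, replacing the potential gradient by its limit costs
  \<open>W * C1\<close>, and replacing the charge by its limit costs \<open>G\<close>, each times
  \<open>d\<close>.\<close>

lemma momentum_derivative:
  assumes t: "t \<in> {Tm..Tp}"
  shows "\<exists>p. ((\<lambda>t. ball_int t (mom j)) has_real_derivative p) (at t within {Tm..Tp}) \<and>
     \<bar>p + rinf * gphi t $ j\<bar> \<le> (3 * W * (1 + V) + W * C1 + G) * d"
proof -
  define p where "p = ball_int t (\<lambda>z. Dmom j z e0) + (\<Sum>i\<in>UNIV. v t $ i * ball_int t (\<lambda>z. Dmom j z (ei i)))"
  have p: "((\<lambda>t. ball_int t (mom j)) has_real_derivative p) (at t within {Tm..Tp})"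
    unfolding p_def by (rule ball_int_time_derivative[OF mom_deriv continuous_density_derivatives(2) t])
  have cF: "continuous_on U (\<lambda>z. Df z (ei j))" by (intro continuous_intros cDf)
  have "ball_int t (\<lambda>z. Dmom j z e0) = ball_int t (\<lambda>z. (\<Sum>i\<in>UNIV. - Dstr i j z (ei i)) + - (rho z * Df z (ei j)))"
    by (rule ball_int_cong[OF _ t]) (simp add: momentum_balance sum_negf)
  also have "\<dots> = ball_int t (\<lambda>z. \<Sum>i\<in>UNIV. - Dstr i j z (ei i)) + ball_int t (\<lambda>z. - (rho z * Df z (ei j)))"
    by (rule ball_int_add[OF _ _ t]) (intro continuous_intros cF)+
  also have "ball_int t (\<lambda>z. \<Sum>i\<in>UNIV. - Dstr i j z (ei i)) = (\<Sum>i\<in>UNIV. ball_int t (\<lambda>z. - Dstr i j z (ei i)))"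
    by (rule ball_int_sum[OF _ t]) (intro continuous_intros)
  finally have pe: "p = (\<Sum>i\<in>UNIV. - ball_int t (\<lambda>z. Dstr i j z (ei i))) - ball_int t (\<lambda>z. rho z * Df z (ei j))
     + (\<Sum>i\<in>UNIV. v t $ i * ball_int t (\<lambda>z. Dmom j z (ei i)))" by (simp add: p_def ball_int_uminus)
  have s: "\<bar>ball_int t (\<lambda>z. Dstr i j z (ei i))\<bar> \<le> W * d" for i
    by (rule ball_int_partial_bound[OF str_deriv continuous_density_derivatives(3) t _ lc_d[OF t] W_nonneg])
       (assumption, rule db(3)[OF slice_tub[OF t]])
  have mo: "\<bar>ball_int t (\<lambda>z. Dmom j z (ei i))\<bar> \<le> W * d" for i
    by (rule ball_int_partial_bound[OF mom_deriv continuous_density_derivatives(2) t _ lc_d[OF t] W_nonneg])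
       (assumption, rule db(2)[OF slice_tub[OF t]])
  have s': "\<bar>\<Sum>i\<in>UNIV. - ball_int t (\<lambda>z. Dstr i j z (ei i))\<bar> \<le> 3 * (W * d)"
    using s[of 1] s[of 2] s[of 3] unfolding sum_3 by (simp add: abs_le_iff)
  have mo': "\<bar>\<Sum>i\<in>UNIV. v t $ i * ball_int t (\<lambda>z. Dmom j z (ei i))\<bar> \<le> 3 * (V * (W * d))"
  proof -
    have "\<bar>v t $ i * ball_int t (\<lambda>z. Dmom j z (ei i))\<bar> \<le> V * (W * d)" for i
      unfolding abs_mult by (intro mult_mono v_i[OF t] mo) (use nonneg in auto)
    from this[of 1] this[of 2] this[of 3] show ?thesis unfolding sum_3 by (simp add: abs_le_iff)
  qed
  have rb: "rhobar c m q chi phi psi rhat R t = ball_int t rho"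
    unfolding rhobar_def ball_int_def
    by (rule integral_cong) (use slice_U[OF t] in \<open>auto simp: charge_density_eq\<close>)
  \<comment> \<open>The limiting gradient does not depend on the point of the ball, so it leaves the
    integral and only the total charge remains next to it.\<close>
  have "ball_int t (\<lambda>z. rho z * (Df z (ei j) - gphi t $ j))
      = ball_int t (\<lambda>z. rho z * Df z (ei j) + (- gphi t $ j) * rho z)"
    by (rule ball_int_cong[OF _ t]) (simp add: algebra_simps)
  also have "\<dots> = ball_int t (\<lambda>z. rho z * Df z (ei j)) - gphi t $ j * ball_int t rho"
    by (subst ball_int_add[OF _ _ t]) (auto intro!: continuous_intros cF simp: ball_int_cmult ball_int_uminus)
  finally have re: "ball_int t (\<lambda>z. rho z * Df z (ei j)) = ball_int t (\<lambda>z. rho z * (Df z (ei j) - gphi t $ j))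
     + gphi t $ j * ball_int t rho" by simp
  have r1: "\<bar>ball_int t (\<lambda>z. rho z * (Df z (ei j) - gphi t $ j))\<bar> \<le> (W * d) * C1"
  proof (rule ball_int_C1[OF _ t])
    fix x assume "x \<in> cball (rhat t) R"
    then have z: "(t, x) \<in> tub" by (rule slice_tub[OF t])
    have "\<bar>rho (t, x)\<bar> * \<bar>Df (t, x) (ei j) - gphi t $ j\<bar> \<le> (W * lc (t, x)) * d"
      by (intro mult_mono db(4)[OF z] Df_d[OF z]) (use lc_nonneg[OF z] W_nonneg in auto)
    then show "\<bar>rho (t, x) * (Df (t, x) (ei j) - gphi t $ j)\<bar> \<le> W * d * lc (t, x)"
      by (simp add: abs_mult mult.commute mult.left_commute)
  qed (use W_nonneg d_pos in \<open>auto intro!: continuous_intros cF\<close>)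
  have "\<bar>gphi t $ j\<bar> \<le> G" using component_le_norm_cart[of "gphi t" j] gphi_G[OF t] by linarith
  then have r2: "\<bar>gphi t $ j * (ball_int t rho - rinf)\<bar> \<le> G * d"
    unfolding abs_mult using rho_d[OF t] unfolding rb by (intro mult_mono) (use nonneg in auto)
  have "p + rinf * gphi t $ j = (\<Sum>i\<in>UNIV. - ball_int t (\<lambda>z. Dstr i j z (ei i)))
     + (\<Sum>i\<in>UNIV. v t $ i * ball_int t (\<lambda>z. Dmom j z (ei i)))
     - ball_int t (\<lambda>z. rho z * (Df z (ei j) - gphi t $ j)) - gphi t $ j * (ball_int t rho - rinf)"
    unfolding pe re by (simp add: algebra_simps)
  then have "\<bar>p + rinf * gphi t $ j\<bar> \<le> 3 * (W * d) + 3 * (V * (W * d)) + (W * d) * C1 + G * d"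
    using s' mo' r1 r2 by (simp add: abs_le_iff)
  also have "\<dots> = (3 * W * (1 + V) + W * C1 + G) * d" by (simp add: algebra_simps)
  finally show ?thesis using p by blast
qed

lemma momentum_change:
  assumes t: "t0 \<in> {Tm..Tp}" "t \<in> {Tm..Tp}"
  shows "\<bar>ball_int t (mom j) - ball_int t0 (mom j) + oint t0 t (\<lambda>s. rinf *\<^sub>R gphi s) $ j\<bar>
     \<le> (3 * W * (1 + V) + W * C1 + G) * d * (Tp - Tm)"
proof -
  let ?f = "\<lambda>s. rinf *\<^sub>R gphi s"
  let ?k = "(3 * W * (1 + V) + W * C1 + G) * d"
  \<comment> \<open>A primitive with base point \<open>Tm\<close> treats both orders of
    \<open>t0\<close> and \<open>t\<close> at once: the oriented integral is a difference of its
    values.\<close>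
  define I where "I s = integral {Tm..s} ?f" for s
  have fc: "continuous_on {Tm..Tp} ?f" by (intro continuous_intros gphi_c)
  have fi: "?f integrable_on {x..y}" if "Tm \<le> x" "y \<le> Tp" for x y
    by (rule integrable_continuous_interval[OF continuous_on_subset[OF fc]]) (use that in auto)
  have oi: "oint t0 t ?f = I t - I t0"
  proof (cases "t0 \<le> t")
    case True
    then show ?thesis
      using Henstock_Kurzweil_Integration.integral_combine[of Tm t0 t ?f, OF _ True fi] t
      by (simp add: oint_def I_def algebra_simps)
  next
    case False
    then show ?thesis
      using Henstock_Kurzweil_Integration.integral_combine[of Tm t t0 ?f, OF _ _ fi] t
      by (simp add: oint_def I_def algebra_simps)
  qed
  have "\<forall>s\<in>{Tm..Tp}. \<exists>p. ((\<lambda>t. ball_int t (mom j)) has_real_derivative p) (at s within {Tm..Tp}) \<and>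
     \<bar>p + rinf * gphi s $ j\<bar> \<le> ?k"
    using momentum_derivative by blast
  from bchoice[OF this] obtain p where p: "\<And>s. s \<in> {Tm..Tp} \<Longrightarrow> ((\<lambda>t. ball_int t (mom j)) has_real_derivative p s) (at s within {Tm..Tp})"
    "\<And>s. s \<in> {Tm..Tp} \<Longrightarrow> \<bar>p s + rinf * gphi s $ j\<bar> \<le> ?k"
    by blast
  define H where "H s = ball_int s (mom j) + I s $ j" for s
  have "norm (H t - H t0) \<le> ?k * norm (t - t0)"
  proof (rule field_differentiable_bound[where f' = "\<lambda>s. p s + rinf * gphi s $ j"])
    fix s assume s: "s \<in> {Tm..Tp}"
    have "(I has_vector_derivative ?f s) (at s within {Tm..Tp})"
      unfolding I_def by (rule integral_has_vector_derivative[OF fc s])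
    from bounded_linear.has_vector_derivative[OF bounded_linear_vec_nth this, of j]
    have "((\<lambda>s. I s $ j) has_real_derivative rinf * gphi s $ j) (at s within {Tm..Tp})"
      by (simp add: has_real_derivative_iff_has_vector_derivative)
    from DERIV_add[OF p(1)[OF s] this]
    show "(H has_field_derivative p s + rinf * gphi s $ j) (at s within {Tm..Tp})"
      unfolding H_def[abs_def] .
    show "norm (p s + rinf * gphi s $ j) \<le> ?k" using p(2)[OF s] by simp
  qed (use t in auto)
  also have "\<dots> \<le> ?k * (Tp - Tm)"
  proof (rule mult_left_mono)
    show "norm (t - t0) \<le> Tp - Tm" using t by (auto simp: abs_le_iff)
    show "0 \<le> ?k" using p(2)[OF t(1)] abs_ge_zero order_trans by blast
  qed
  finally show ?thesis by (simp add: H_def oi algebra_simps)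
qed

end

section \<open>The ergocenter\<close>

text \<open>The fraction over \<open>c\<^sup>2\<close> bounds the gap between energy times velocity
  and momentum; it counts twice, once for each of the two times. The term with \<open>T\<close>
  bounds the momentum change over an interval of that length. The outer 3 comes from estimating the
  norm by the sum of the components.\<close>

definition err_const :: "real \<Rightarrow> real \<Rightarrow> real \<Rightarrow> real \<Rightarrow> real \<Rightarrow> real \<Rightarrow> real \<Rightarrow> real \<Rightarrow> real" where
  "err_const c W B V C1 c0 G T = 3 * (2 * ((3 * c\<^sup>2 * ((1 + W * C1 / c0) * W) + 3 * V * ((1 + W * C1 / c0) * W)
      + 3 * B * C1 * ((1 + W * C1 / c0) * W)) / c\<^sup>2) + (3 * W * (1 + V) + W * C1 + G) * T)"

context kg_estimates
begin

abbreviation "E t \<equiv> Ebar c m q chi a G1 phi psi rhat R t"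
abbreviation "erg \<equiv> ergocenter c m q chi a G1 phi psi rhat R"

lemma E_eq: "t \<in> {Tm..Tp} \<Longrightarrow> E t = ball_int t en"
  unfolding Ebar_def ball_int_def
  by (rule integral_cong) (use slice_U in \<open>auto simp: energy_density_eq\<close>)

lemma E_pos: "t \<in> {Tm..Tp} \<Longrightarrow> 0 < E t"
  using E_c0 c0 by force

definition "offset j r z = snd z $ j - r" for r :: real and z :: "real \<times> (real^3)"

lemma continuous_offset [continuous_intros]: "continuous_on S (offset j r)"
  unfolding offset_def[abs_def] by (intro continuous_intros)

lemma offset_mult_deriv:
  assumes "(g has_derivative g') (at z)"
  shows "((\<lambda>z. offset j r z * g z) has_derivative (\<lambda>h. offset j r z * g' h + snd h $ j * g z)) (at z)"
proof -
  have "(offset j r has_derivative (\<lambda>h. snd h $ j - 0)) (at z)"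
    unfolding offset_def[abs_def]
    by (intro has_derivative_diff has_derivative_const bounded_linear_imp_has_derivative
        bounded_linear_compose[OF bounded_linear_vec_nth bounded_linear_snd])
  from has_derivative_mult[OF this assms] show ?thesis by simp
qed

lemma ball_int_offset:
  assumes "t \<in> {Tm..Tp}"
  shows "ball_int t (\<lambda>z. offset j r z * en z) = ball_int t (\<lambda>z. snd z $ j * en z) - r * E t"
proof -
  have "ball_int t (\<lambda>z. offset j r z * en z) = ball_int t (\<lambda>z. snd z $ j * en z + (- r) * en z)"
    by (rule ball_int_cong[OF _ assms]) (simp add: offset_def algebra_simps)
  also have "\<dots> = ball_int t (\<lambda>z. snd z $ j * en z) + ball_int t (\<lambda>z. (- r) * en z)"
    by (rule ball_int_add[OF _ _ assms]) (intro continuous_intros)+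
  finally show ?thesis by (simp only: ball_int_cmult E_eq[OF assms])
qed

text \<open>The reference value \<open>r\<close> is arbitrary. Choosing \<open>rhat t $ j\<close>
  locates the ergocenter near the trajectory; choosing the ergocenter at a frozen time gives a
  moment that vanishes at that time.\<close>

lemma ergocenter_component:
  assumes t: "t \<in> {Tm..Tp}"
  shows "erg t $ j = r + ball_int t (\<lambda>z. offset j r z * en z) / E t"
proof -
  have "continuous_on (cball (rhat t) R) (\<lambda>x. en (t, x) *\<^sub>R x)"
    by (intro continuous_intros slice_continuous[OF _ t])
  from borel_integrable_compact[OF compact_cball this]
  have int: "(\<lambda>x. en (t, x) *\<^sub>R x) integrable_on cball (rhat t) R"
    using set_borel_integral_eq_integral(1)[of "cball (rhat t) R" "\<lambda>x. en (t, x) *\<^sub>R x"]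
    by (simp add: set_integrable_def)
  have "integral (cball (rhat t) R) (\<lambda>x. energy_density c m q chi a G1 phi psi t x *\<^sub>R x)
      = integral (cball (rhat t) R) (\<lambda>x. en (t, x) *\<^sub>R x)"
    by (rule integral_cong) (use slice_U[OF t] in \<open>simp add: energy_density_eq\<close>)
  then have "erg t $ j = integral (cball (rhat t) R) (\<lambda>x. en (t, x) *\<^sub>R x) $ j / E t"
    unfolding ergocenter_def by simp
  also have "integral (cball (rhat t) R) (\<lambda>x. en (t, x) *\<^sub>R x) $ j = ball_int t (\<lambda>z. snd z $ j * en z)"
    unfolding integral_component_eq_cart[OF int, symmetric] ball_int_def by (simp add: mult.commute)
  finally show ?thesis using E_pos[OF t] unfolding ball_int_offset[OF t] by (simp add: field_simps)
qed

abbreviation "\<kappa> \<equiv> 1 + W * C1 / c0"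

lemma kappa_nonneg: "0 \<le> \<kappa>"
  using W_nonneg nonneg c0 by simp

text \<open>The energy density may change sign, so the ergocenter need not lie in the ball. Its
  distance from the centre is bounded per component by the moment of the absolute density, at most
  \<open>R * W * C1\<close>, over the energy, at least \<open>c0\<close>; adding \<open>R\<close>
  for the point \<open>x\<close> gives the factor \<open>\<kappa>\<close>.\<close>

lemma ergocenter_near:
  assumes t: "t \<in> {Tm..Tp}" and x: "x \<in> cball (rhat t) R"
  shows "\<bar>offset j (erg t $ j) (t, x)\<bar> \<le> d * \<kappa>"
proof -
  have near: "\<bar>offset j (rhat t $ j) (t, y)\<bar> \<le> R" if "y \<in> cball (rhat t) R" for y
  proof -
    have "\<bar>(y - rhat t) $ j\<bar> \<le> norm (y - rhat t)" by (rule component_le_norm_cart)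
    then show ?thesis using that by (simp add: offset_def dist_norm norm_minus_commute)
  qed
  have "\<bar>ball_int t (\<lambda>z. offset j (rhat t $ j) z * en z)\<bar> \<le> (R * W) * C1"
  proof (rule ball_int_C1[OF _ t])
    fix y assume y: "y \<in> cball (rhat t) R"
    have "\<bar>offset j (rhat t $ j) (t, y)\<bar> * \<bar>en (t, y)\<bar> \<le> R * (W * lc (t, y))"
      by (intro mult_mono near[OF y] db(1)[OF slice_tub[OF t y]]) (use R in auto)
    then show "\<bar>offset j (rhat t $ j) (t, y) * en (t, y)\<bar> \<le> R * W * lc (t, y)" by (simp add: abs_mult)
  qed (use R W_nonneg in \<open>auto intro!: continuous_intros\<close>)
  then have "\<bar>ball_int t (\<lambda>z. offset j (rhat t $ j) z * en z)\<bar> / E t \<le> (R * W) * C1 / c0"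
    using E_c0[OF t] c0 R W_nonneg nonneg by (intro frac_le) auto
  then have "\<bar>erg t $ j - rhat t $ j\<bar> \<le> R * (W * C1 / c0)"
    using ergocenter_component[OF t, of j "rhat t $ j"] E_pos[OF t] by simp
  moreover have "\<bar>offset j (erg t $ j) (t, x)\<bar> \<le> \<bar>offset j (rhat t $ j) (t, x)\<bar> + \<bar>erg t $ j - rhat t $ j\<bar>"
    unfolding offset_def by linarith
  ultimately have "\<bar>offset j (erg t $ j) (t, x)\<bar> \<le> R * \<kappa>"
    using near[OF x] unfolding distrib_left mult_1_right by linarith
  also have "\<dots> \<le> d * \<kappa>" using d(1) kappa_nonneg by (rule mult_right_mono)
  finally show ?thesis .
qed

text \<open>The reference point is fixed while the time \<open>s\<close> varies. Moving the offset
  inside the divergence of the energy law leaves one term without offset, \<open>c\<^sup>2\<close>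
  times the momentum; all others carry a factor of order \<open>d\<close>. The three parts of the
  constant come from the flux, the transport term and the work of the field.\<close>

lemma energy_moment_derivative:
  assumes t: "t \<in> {Tm..Tp}"
  shows "\<exists>p. ((\<lambda>s. ball_int s (\<lambda>z. offset j (erg t $ j) z * en z)) has_real_derivative p) (at t within {Tm..Tp}) \<and>
     \<bar>p - c\<^sup>2 * ball_int t (mom j)\<bar> \<le> (3 * c\<^sup>2 * (\<kappa> * W) + 3 * V * (\<kappa> * W) + 3 * B * C1 * (\<kappa> * W)) * d"
proof -
  let ?X = "offset j (erg t $ j)"
  let ?k = "d * \<kappa> * W"
  have k0: "0 \<le> ?k" using d_pos kappa_nonneg W_nonneg by simp
  define DQ where "DQ z h = ?X z * De z h + snd h $ j * en z" for z and h :: "real \<times> (real^3)"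
  define Dq where "Dq i z h = ?X z * Dmom i z h + snd h $ j * mom i z" for i z and h :: "real \<times> (real^3)"
  have dQ: "((\<lambda>z. ?X z * en z) has_derivative DQ z) (at z)" if "z \<in> U" for z
    unfolding DQ_def[abs_def] by (rule offset_mult_deriv[OF en_deriv[OF that]])
  have dq: "((\<lambda>z. ?X z * mom i z) has_derivative Dq i z) (at z)" if "z \<in> U" for i z
    unfolding Dq_def[abs_def] by (rule offset_mult_deriv[OF mom_deriv[OF that]])
  have cQ: "continuous_on U (\<lambda>z. DQ z h)" and cq: "continuous_on U (\<lambda>z. Dq i z h)" for h i
    unfolding DQ_def Dq_def by (intro continuous_intros)+
  have cF: "continuous_on U (\<lambda>z. Df z h)" for h by (intro continuous_intros cDf)
  define p where "p = ball_int t (\<lambda>z. DQ z e0) + (\<Sum>i\<in>UNIV. v t $ i * ball_int t (\<lambda>z. DQ z (ei i)))"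
  have p: "((\<lambda>s. ball_int s (\<lambda>z. ?X z * en z)) has_real_derivative p) (at t within {Tm..Tp})"
    unfolding p_def by (rule ball_int_time_derivative[OF dQ cQ t])
  have Xb: "\<bar>?X (t, x) * g\<bar> \<le> ?k * lc (t, x)"
    if x: "x \<in> cball (rhat t) R" and g: "\<bar>g\<bar> \<le> W * lc (t, x)" for x g
  proof -
    have "\<bar>?X (t, x)\<bar> * \<bar>g\<bar> \<le> (d * \<kappa>) * (W * lc (t, x))"
      by (intro mult_mono ergocenter_near[OF t x] g) (use d_pos kappa_nonneg in auto)
    then show ?thesis by (simp add: abs_mult mult.assoc)
  qed
  \<comment> \<open>Boundary terms carry \<open>d\<close> twice, from the offset and from the sphere
    integral; one factor is dropped using \<open>d \<le> 1\<close>.\<close>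
  have kd: "?k * d \<le> ?k" using k0 d(2) d_pos by (simp add: mult_left_le)
  have bQ: "\<bar>ball_int t (\<lambda>z. DQ z (ei i))\<bar> \<le> ?k" for i
    using ball_int_partial_bound[OF dQ cQ t Xb[OF _ db(1)[OF slice_tub[OF t]]] lc_d[OF t] k0, of i] kd
    by auto
  have bq: "\<bar>ball_int t (\<lambda>z. Dq i z (ei i))\<bar> \<le> ?k" for i
    using ball_int_partial_bound[OF dq cq t Xb[OF _ db(2)[OF slice_tub[OF t]]] lc_d[OF t] k0, of i i] kd
    by auto
  have bJ: "\<bar>ball_int t (\<lambda>z. ?X z * (Df z (ei i) * cur i z))\<bar> \<le> ?k * B * C1" for i
  proof (rule ball_int_C1[OF _ t])
    fix x assume x: "x \<in> cball (rhat t) R"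
    note z = slice_tub[OF t x]
    have "\<bar>?X (t, x) * cur i (t, x)\<bar> * \<bar>Df (t, x) (ei i)\<bar> \<le> (?k * lc (t, x)) * B"
      by (intro mult_mono Xb[OF x db(5)[OF z]] Df_B[OF z]) (use k0 lc_nonneg[OF z] in auto)
    then show "\<bar>?X (t, x) * (Df (t, x) (ei i) * cur i (t, x))\<bar> \<le> ?k * B * lc (t, x)"
      by (simp add: abs_mult mult.commute mult.left_commute)
  qed (use k0 nonneg in \<open>auto intro!: continuous_intros cF\<close>)
  have "DQ z e0 = (\<Sum>i\<in>UNIV. (- (c\<^sup>2)) * Dq i z (ei i)) + c\<^sup>2 * mom j z + (\<Sum>i\<in>UNIV. (- 1) * (?X z * (Df z (ei i) * cur i z)))"
    if z: "z \<in> tub" for z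
  proof -
    \<comment> \<open>The derivative of the offset along \<open>ei i\<close> is 1 for
      \<open>i = j\<close> and 0 otherwise, so exactly the component \<open>mom j\<close> is singled
      out.\<close>
    have "(\<Sum>i\<in>UNIV. Dq i z (ei i)) = ?X z * (\<Sum>i\<in>UNIV. Dmom i z (ei i)) + (\<Sum>i\<in>UNIV. (if i = j then mom i z else 0))"
      unfolding Dq_def sum.distrib sum_distrib_left
      by (intro arg_cong2[of _ _ _ _ "(+)"] refl sum.cong) (simp add: axis_def)
    then have 1: "(\<Sum>i\<in>UNIV. Dq i z (ei i)) = ?X z * (\<Sum>i\<in>UNIV. Dmom i z (ei i)) + mom j z" by simp
    show ?thesis
      unfolding sum_distrib_left[symmetric] 1 by (simp add: DQ_def energy_balance[OF z] algebra_simps)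
  qed
  then have "ball_int t (\<lambda>z. DQ z e0) = ball_int t (\<lambda>z. (\<Sum>i\<in>UNIV. (- (c\<^sup>2)) * Dq i z (ei i)) + c\<^sup>2 * mom j z
      + (\<Sum>i\<in>UNIV. (- 1) * (?X z * (Df z (ei i) * cur i z))))"
    by (rule ball_int_cong[OF _ t])
  also have "\<dots> = ball_int t (\<lambda>z. (\<Sum>i\<in>UNIV. (- (c\<^sup>2)) * Dq i z (ei i)) + c\<^sup>2 * mom j z)
      + ball_int t (\<lambda>z. \<Sum>i\<in>UNIV. (- 1) * (?X z * (Df z (ei i) * cur i z)))"
    by (rule ball_int_add[OF _ _ t]) (intro continuous_intros cq cF)+
  also have "ball_int t (\<lambda>z. (\<Sum>i\<in>UNIV. (- (c\<^sup>2)) * Dq i z (ei i)) + c\<^sup>2 * mom j z)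
      = ball_int t (\<lambda>z. \<Sum>i\<in>UNIV. (- (c\<^sup>2)) * Dq i z (ei i)) + ball_int t (\<lambda>z. c\<^sup>2 * mom j z)"
    by (rule ball_int_add[OF _ _ t]) (intro continuous_intros cq)+
  also have "ball_int t (\<lambda>z. \<Sum>i\<in>UNIV. (- (c\<^sup>2)) * Dq i z (ei i)) = (\<Sum>i\<in>UNIV. ball_int t (\<lambda>z. (- (c\<^sup>2)) * Dq i z (ei i)))"
    by (rule ball_int_sum[OF _ t]) (intro continuous_intros cq)
  also have "ball_int t (\<lambda>z. \<Sum>i\<in>UNIV. (- 1) * (?X z * (Df z (ei i) * cur i z)))
      = (\<Sum>i\<in>UNIV. ball_int t (\<lambda>z. (- 1) * (?X z * (Df z (ei i) * cur i z))))"
    by (rule ball_int_sum[OF _ t]) (intro continuous_intros cF)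
  finally have pe: "p - c\<^sup>2 * ball_int t (mom j) = (\<Sum>i\<in>UNIV. - (c\<^sup>2) * ball_int t (\<lambda>z. Dq i z (ei i)))
      + (\<Sum>i\<in>UNIV. - 1 * ball_int t (\<lambda>z. ?X z * (Df z (ei i) * cur i z)))
      + (\<Sum>i\<in>UNIV. v t $ i * ball_int t (\<lambda>z. DQ z (ei i)))"
    unfolding p_def ball_int_cmult by simp
  have s3: "\<bar>\<Sum>i\<in>(UNIV::3 set). f i\<bar> \<le> 3 * k" if "\<And>i. \<bar>f i\<bar> \<le> k" for f :: "3 \<Rightarrow> real" and k
    using that[of 1] that[of 2] that[of 3] unfolding sum_3 by linarith
  have "\<bar>\<Sum>i\<in>UNIV. - (c\<^sup>2) * ball_int t (\<lambda>z. Dq i z (ei i))\<bar> \<le> 3 * (c\<^sup>2 * ?k)"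
    by (rule s3) (simp add: abs_mult, intro mult_left_mono, use bq in auto)
  moreover have "\<bar>\<Sum>i\<in>UNIV. - 1 * ball_int t (\<lambda>z. ?X z * (Df z (ei i) * cur i z))\<bar> \<le> 3 * (?k * B * C1)"
    by (rule s3) (use bJ in simp)
  moreover have "\<bar>\<Sum>i\<in>UNIV. v t $ i * ball_int t (\<lambda>z. DQ z (ei i))\<bar> \<le> 3 * (V * ?k)"
    by (rule s3, unfold abs_mult, intro mult_mono v_i[OF t] bQ) (use nonneg in auto)
  ultimately have "\<bar>p - c\<^sup>2 * ball_int t (mom j)\<bar> \<le> 3 * (c\<^sup>2 * ?k) + 3 * (?k * B * C1) + 3 * (V * ?k)"
    unfolding pe by linarith
  also have "\<dots> = (3 * c\<^sup>2 * (\<kappa> * W) + 3 * V * (\<kappa> * W) + 3 * B * C1 * (\<kappa> * W)) * d" by (simp add: algebra_simps)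
  finally show ?thesis using p by blast
qed

lemma ergocenter_velocity:
  assumes t: "t \<in> {Tm..Tp}"
  shows "\<bar>((E t / c\<^sup>2) *\<^sub>R vector_derivative erg (at t within {Tm..Tp})) $ j - ball_int t (mom j)\<bar>
    \<le> (3 * c\<^sup>2 * (\<kappa> * W) + 3 * V * (\<kappa> * W) + 3 * B * C1 * (\<kappa> * W)) / c\<^sup>2 * d"
proof -
  let ?Q = "\<lambda>j s. ball_int s (\<lambda>z. offset j (erg t $ j) z * en z)"
  let ?b = "(3 * c\<^sup>2 * (\<kappa> * W) + 3 * V * (\<kappa> * W) + 3 * B * C1 * (\<kappa> * W)) * d"
  have "\<forall>j. \<exists>p. (?Q j has_real_derivative p) (at t within {Tm..Tp}) \<and> \<bar>p - c\<^sup>2 * ball_int t (mom j)\<bar> \<le> ?b"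
    using energy_moment_derivative[OF t] by blast
  from choice[OF this] obtain p where p: "\<And>j. (?Q j has_real_derivative p j) (at t within {Tm..Tp})"
    and pb: "\<And>j. \<bar>p j - c\<^sup>2 * ball_int t (mom j)\<bar> \<le> ?b" by blast
  have "\<exists>E'. ((\<lambda>s. ball_int s en) has_real_derivative E') (at t within {Tm..Tp})"
    using ball_int_time_derivative[OF en_deriv continuous_density_derivatives(1) t] by blast
  then obtain E' where E': "((\<lambda>s. ball_int s en) has_real_derivative E') (at t within {Tm..Tp})" by blast
  have E1: "((\<lambda>s. E s) has_real_derivative E') (at t within {Tm..Tp})"
    by (rule has_field_derivative_transform_within[OF E', of 1]) (use t E_eq in auto)
  have Et: "E t \<noteq> 0" using E_pos[OF t] by simp
  \<comment> \<open>The energy moment about the fixed point \<open>erg t\<close> vanishes at time \<open>t\<close>, so the derivative of the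
    total energy drops out of the quotient rule.\<close>
  have Q0: "?Q j t = 0" for j
    using ergocenter_component[OF t, of j "erg t $ j"] Et by simp
  have comp: "((\<lambda>s. erg s $ j) has_real_derivative p j / E t) (at t within {Tm..Tp})" for j
  proof -
    have "((\<lambda>s. erg t $ j + ?Q j s / E s) has_real_derivative 0 + (p j * E t - ?Q j t * E') / (E t * E t)) (at t within {Tm..Tp})"
      by (intro DERIV_add DERIV_const DERIV_divide p E1 Et)
    then have "((\<lambda>s. erg t $ j + ?Q j s / E s) has_real_derivative p j / E t) (at t within {Tm..Tp})"
      using Et by (simp add: Q0)
    then show ?thesis
      by (rule has_field_derivative_transform_within[of _ _ _ _ 1])
         (use t in \<open>auto intro!: ergocenter_component[symmetric]\<close>)
  qed
  have "(erg has_vector_derivative (\<chi> j. p j / E t)) (at t within {Tm..Tp})"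
    unfolding has_vector_derivative_def
  proof (subst has_derivative_componentwise_within, rule ballI)
    fix b :: "real^3" assume "b \<in> Basis"
    then obtain j where b: "b = axis j 1" by (auto simp: Basis_vec_def)
    have "((\<lambda>s. erg s $ j) has_derivative (\<lambda>k. p j / E t * k)) (at t within {Tm..Tp})"
      using comp[of j] unfolding has_field_derivative_def .
    then show "((\<lambda>s. erg s \<bullet> b) has_derivative (\<lambda>k. k *\<^sub>R (\<chi> j. p j / E t) \<bullet> b)) (at t within {Tm..Tp})"
      unfolding b by (simp add: inner_axis mult.commute)
  qed
  \<comment> \<open>A derivative within the interval determines \<open>vector_derivative\<close>
    uniquely because the interval has more than one point.\<close>
  then have "vector_derivative erg (at t within {Tm..Tp}) = (\<chi> j. p j / E t)"
    using t TT by (intro vector_derivative_within_closed_interval) auto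
  then have "((E t / c\<^sup>2) *\<^sub>R vector_derivative erg (at t within {Tm..Tp})) $ j - ball_int t (mom j)
     = (p j - c\<^sup>2 * ball_int t (mom j)) / c\<^sup>2"
    using Et c by (simp add: field_simps)
  then have "\<bar>((E t / c\<^sup>2) *\<^sub>R vector_derivative erg (at t within {Tm..Tp})) $ j - ball_int t (mom j)\<bar>
     = \<bar>p j - c\<^sup>2 * ball_int t (mom j)\<bar> / c\<^sup>2" by simp
  also have "\<dots> \<le> ?b / c\<^sup>2" by (rule divide_right_mono[OF pb]) simp
  finally show ?thesis by (simp add: mult.commute)
qed

lemma ergocenter_momentum_law:
  assumes t: "t0 \<in> {Tm..Tp}" "t \<in> {Tm..Tp}"
  shows "norm ((E t / c\<^sup>2) *\<^sub>R vector_derivative erg (at t within {Tm..Tp})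
       - (E t0 / c\<^sup>2) *\<^sub>R vector_derivative erg (at t0 within {Tm..Tp}) + oint t0 t (\<lambda>s. rinf *\<^sub>R gphi s))
     \<le> err_const c W B V C1 c0 G (Tp - Tm) * d"
proof -
  define x where "x = (E t / c\<^sup>2) *\<^sub>R vector_derivative erg (at t within {Tm..Tp})"
  define y where "y = (E t0 / c\<^sup>2) *\<^sub>R vector_derivative erg (at t0 within {Tm..Tp})"
  define w where "w = oint t0 t (\<lambda>s. rinf *\<^sub>R gphi s)"
  define b1 where "b1 = (3 * c\<^sup>2 * (\<kappa> * W) + 3 * V * (\<kappa> * W) + 3 * B * C1 * (\<kappa> * W)) / c\<^sup>2 * d"
  define b2 where "b2 = (3 * W * (1 + V) + W * C1 + G) * d * (Tp - Tm)"
  have "\<bar>(x - y + w) $ j\<bar> \<le> 2 * b1 + b2" for j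
    using ergocenter_velocity[OF t(2), of j, folded x_def b1_def] ergocenter_velocity[OF t(1), of j, folded y_def b1_def]
      momentum_change[OF t, of j, folded w_def b2_def]
    unfolding vector_add_component vector_minus_component by linarith
  then have "(\<Sum>j\<in>UNIV. \<bar>(x - y + w) $ j\<bar>) \<le> (\<Sum>j\<in>(UNIV::3 set). 2 * b1 + b2)"
    by (intro sum_mono)
  with norm_le_l1_cart[of "x - y + w"] have "norm (x - y + w) \<le> 3 * (2 * b1 + b2)" by simp
  also have "\<dots> = err_const c W B V C1 c0 G (Tp - Tm) * d" unfolding err_const_def b1_def b2_def by (simp add: algebra_simps)
  finally show ?thesis unfolding x_def y_def w_def .
qed

end

section \<open>Choice of the small parameter and passage to large indices\<close>

theorem theorem3:
  fixes c m q :: real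
    and G1 dG1 :: "real \<Rightarrow> real"
    and Tm Tp :: real
    and rhat :: "real \<Rightarrow> real^3"
    and R a chi :: "nat \<Rightarrow> real"
    and phi :: "nat \<Rightarrow> real \<Rightarrow> real^3 \<Rightarrow> real"
    and phi0 :: "real \<Rightarrow> real" and gphi :: "real \<Rightarrow> real^3"
    and psi :: "nat \<Rightarrow> real \<Rightarrow> real^3 \<Rightarrow> complex"
    and rho_inf :: real
  assumes c_pos: "c > 0" and m_pos: "m > 0"
    \<comment> \<open>hypotheses on the nonlinearity G_1 (dG1 = G_1')\<close>
    and G1_0: "G1 0 = 0"
    and G1_deriv: "\<forall>s>0. (G1 has_real_derivative dG1 s) (at s)"
    and dG1_C1: "\<exists>ddG1. (\<forall>s>0. (dG1 has_real_derivative ddG1 s) (at s)) \<and> continuous_on {0<..} ddG1"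
    and G1_Calpha: "\<forall>\<alpha>. 0 < \<alpha> \<and> \<alpha> < 1 \<longrightarrow>
        (\<exists>g :: complex \<Rightarrow> complex. (\<forall>z. z \<noteq> 0 \<longrightarrow> g z = complex_of_real (dG1 ((cmod z)\<^sup>2)) * z)
           \<and> holder_loc \<alpha> g)"
    and G1_C1alpha: "\<forall>\<alpha>. 0 < \<alpha> \<and> \<alpha> < 1 \<longrightarrow>
        (\<exists>D :: complex \<Rightarrow> (complex \<Rightarrow>\<^sub>L real).
           (\<forall>z. ((\<lambda>w. G1 ((cmod w)\<^sup>2)) has_derivative blinfun_apply (D z)) (at z))
           \<and> holder_loc \<alpha> D)"
    and G1_bounds: "\<forall>\<alpha>. 0 < \<alpha> \<and> \<alpha> < 1 \<longrightarrow> (\<forall>C1. \<exists>C. \<forall>z. cmod z \<le> C1 \<longrightarrow>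
        \<bar>G1 ((cmod z)\<^sup>2)\<bar> \<le> C * cmod z powr (1 + \<alpha>)
        \<and> \<bar>dG1 ((cmod z)\<^sup>2)\<bar> * cmod z \<le> C * cmod z powr \<alpha>)"
    \<comment> \<open>the trajectory\<close>
    and rhat_C2: "\<exists>v acc C. (\<forall>t\<in>{Tm..Tp}.
          (rhat has_vector_derivative v t) (at t within {Tm..Tp})
        \<and> (v has_vector_derivative acc t) (at t within {Tm..Tp})
        \<and> norm (v t) \<le> C \<and> norm (acc t) \<le> C) \<and> continuous_on {Tm..Tp} acc"
    and R_pos: "\<forall>n. R n > 0" and R_lim: "R \<longlonglongrightarrow> 0"
    \<comment> \<open>localized KG equations\<close>
    and a_pos: "\<forall>n. a n > 0" and a_lim: "a \<longlonglongrightarrow> 0"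
    and chi_pos: "\<forall>n. chi n > 0" and chi_lim: "chi \<longlonglongrightarrow> 0"
    and aC_bound: "\<exists>C. \<forall>n. (chi n / (m * c)) / a n \<le> C"
    and R_over_a: "filterlim (\<lambda>n. R n / a n) at_top sequentially"
    and phi_C2: "\<forall>n. C2_closed (tube Tm Tp rhat (R n)) (phi n)"
    and phi_bound: "\<exists>C. \<forall>n. \<forall>(t, x)\<in>tube Tm Tp rhat (R n).
        \<bar>phi n t x\<bar> + sqrt (grad0_sq c (phi n) t x) \<le> C"
    and phi_inf_reg: "\<exists>C. \<forall>t\<in>{Tm..Tp}. \<bar>phi0 t\<bar> \<le> C \<and> norm (gphi t) \<le> C
        \<and> phi0 differentiable (at t within {Tm..Tp})
        \<and> (\<exists>g'. (gphi has_vector_derivative g') (at t within {Tm..Tp}) \<and> norm g' \<le> C)"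
    and phi_conv: "\<forall>\<epsilon>>0. \<forall>\<^sub>F n in sequentially. \<forall>(t, x)\<in>tube Tm Tp rhat (R n).
        \<bar>phi n t x - (phi0 t + (x - rhat t) \<bullet> gphi t)\<bar>
        + sqrt ((dt (phi n) t x
                  - vector_derivative (\<lambda>s. phi0 s + (x - rhat s) \<bullet> gphi s) (at t within {Tm..Tp}))\<^sup>2 / c\<^sup>2
                + (\<Sum>i\<in>UNIV. (dx i (phi n) t x
                  - dx i (\<lambda>s y. phi0 s + (y - rhat s) \<bullet> gphi s) t x)\<^sup>2)) < \<epsilon>"
    \<comment> \<open>concentrating solutions\<close>
    and psi_C2: "\<forall>n. C2_closed (tube Tm Tp rhat (R n)) (psi n)"
    and psi_KG: "\<forall>n. \<forall>(t, x)\<in>tube Tm Tp rhat (R n).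
        KG c m q (chi n) (a n) dG1 (phi n) (psi n) t x = 0"
    and cond_i: "\<exists>C. \<forall>n. \<forall>t\<in>{Tm..Tp}.
        integral (cball (rhat t) (R n)) (loc_integrand c (chi n / (m * c)) (a n) G1 (psi n) t) \<le> C"
    and cond_ii: "\<forall>\<epsilon>>0. \<forall>\<^sub>F n in sequentially. \<forall>t\<in>{Tm..Tp}.
        sphere_integral (rhat t) (R n) (loc_integrand c (chi n / (m * c)) (a n) G1 (psi n) t) \<le> \<epsilon>"
    and cond_iii: "\<exists>c0>0. \<exists>n0. \<forall>n\<ge>n0. \<forall>t\<in>{Tm..Tp}.
        Ebar c m q (chi n) (a n) G1 (phi n) (psi n) rhat (R n) t \<ge> c0"
    and cond_iv: "\<exists>t0\<in>{Tm..Tp}. convergent (\<lambda>n. Ebar c m q (chi n) (a n) G1 (phi n) (psi n) rhat (R n) t0)"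
    \<comment> \<open>uniform convergence of the restricted charges\<close>
    and charge_conv: "\<forall>\<epsilon>>0. \<forall>\<^sub>F n in sequentially. \<forall>t\<in>{Tm..Tp}.
        \<bar>rhobar c m q (chi n) (phi n) (psi n) rhat (R n) t - rho_inf\<bar> < \<epsilon>"
  shows "\<forall>\<epsilon>>0. \<forall>\<^sub>F n in sequentially. \<forall>t0\<in>{Tm..Tp}. \<forall>t\<in>{Tm..Tp}.
     norm ((Ebar c m q (chi n) (a n) G1 (phi n) (psi n) rhat (R n) t / c\<^sup>2) *\<^sub>R
              vector_derivative (ergocenter c m q (chi n) (a n) G1 (phi n) (psi n) rhat (R n))
                (at t within {Tm..Tp})
         - (Ebar c m q (chi n) (a n) G1 (phi n) (psi n) rhat (R n) t0 / c\<^sup>2) *\<^sub>R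
              vector_derivative (ergocenter c m q (chi n) (a n) G1 (phi n) (psi n) rhat (R n))
                (at t0 within {Tm..Tp})
         + oint t0 t (\<lambda>s. rho_inf *\<^sub>R gphi s)) < \<epsilon>"
proof (cases "Tm < Tp")
  \<comment> \<open>The interval is empty or a single point: the two times coincide, the momenta
    cancel and the integral runs over one point.\<close>
  case False
  show ?thesis
  proof (intro allI impI always_eventually ballI, goal_cases)
    case (1 \<epsilon> n t0 t)
    then have "t0 = t" using False by auto
    then show ?case using 1 by (simp add: oint_def)
  qed
next
  case TT: True
  from rhat_C2 obtain v acc V where rh: "\<And>t. t \<in> {Tm..Tp} \<Longrightarrow> (rhat has_vector_derivative v t) (at t within {Tm..Tp})"
    and vh: "\<And>t. t \<in> {Tm..Tp} \<Longrightarrow> (v has_vector_derivative acc t) (at t within {Tm..Tp})"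
    and V: "\<And>t. t \<in> {Tm..Tp} \<Longrightarrow> norm (v t) \<le> V" by blast
  have cv: "continuous_on {Tm..Tp} v"
    using vh by (meson continuous_on_eq_continuous_within has_vector_derivative_continuous)
  from phi_bound obtain B where B: "\<And>n t x. (t, x) \<in> tube Tm Tp rhat (R n) \<Longrightarrow>
      \<bar>phi n t x\<bar> + sqrt (grad0_sq c (phi n) t x) \<le> B" by blast
  from cond_i obtain C1 where C1: "\<And>n t. t \<in> {Tm..Tp} \<Longrightarrow>
      integral (cball (rhat t) (R n)) (loc_integrand c (chi n / (m * c)) (a n) G1 (psi n) t) \<le> C1" by blast
  from cond_iii obtain c0 n0 where c0: "c0 > 0" and n0: "\<And>n t. n \<ge> n0 \<Longrightarrow> t \<in> {Tm..Tp} \<Longrightarrow>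
      Ebar c m q (chi n) (a n) G1 (phi n) (psi n) rhat (R n) t \<ge> c0" by blast
  from phi_inf_reg obtain G where G: "\<And>t. t \<in> {Tm..Tp} \<Longrightarrow> norm (gphi t) \<le> G"
    and gd: "\<And>t. t \<in> {Tm..Tp} \<Longrightarrow> \<exists>g'. (gphi has_vector_derivative g') (at t within {Tm..Tp})" by blast
  have cgphi: "continuous_on {Tm..Tp} gphi"
    using gd by (meson continuous_on_eq_continuous_within has_vector_derivative_continuous)
  \<comment> \<open>The exponent is arbitrary; any one yields a continuous derivative of the
    nonlinear energy.\<close>
  from G1_C1alpha[rule_format, of "1/2"] obtain D :: "complex \<Rightarrow> (complex \<Rightarrow>\<^sub>L real)" where
    D: "\<And>z. ((\<lambda>w. G1 ((cmod w)\<^sup>2)) has_derivative blinfun_apply (D z)) (at z)" and Dh: "holder_loc (1/2) D" by auto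
  have dxB: "\<bar>dx i (phi n) t x\<bar> \<le> B" "\<bar>phi n t x\<bar> \<le> B" if "(t, x) \<in> tube Tm Tp rhat (R n)" for n t x i
  proof -
    have "(dx i (phi n) t x)\<^sup>2 \<le> grad_sq (phi n) t x"
      unfolding grad_sq_def using member_le_sum[of i UNIV "\<lambda>i. (norm (dx i (phi n) t x))\<^sup>2"] by simp
    also have "\<dots> \<le> grad0_sq c (phi n) t x" by (simp add: grad0_sq_def)
    finally have "\<bar>dx i (phi n) t x\<bar> \<le> sqrt (grad0_sq c (phi n) t x)" by (metis real_sqrt_abs real_sqrt_le_iff)
    moreover have "0 \<le> sqrt (grad0_sq c (phi n) t x)"
      by (simp add: grad0_sq_def grad_sq_def sum_nonneg)
    ultimately show "\<bar>dx i (phi n) t x\<bar> \<le> B" "\<bar>phi n t x\<bar> \<le> B" using B[OF that] by linarith+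
  qed
  \<comment> \<open>The limiting potential is affine in the space variable, so its gradient is the
    same at every point.\<close>
  have dxlin: "dx i (\<lambda>s y. phi0 s + (y - rhat s) \<bullet> gphi s) t x = gphi t $ i" for i t x
  proof -
    have "((\<lambda>s. phi0 t + (x + s *\<^sub>R axis i 1 - rhat t) \<bullet> gphi t) has_vector_derivative axis i 1 \<bullet> gphi t) (at 0)"
      unfolding has_vector_derivative_def by (auto intro!: derivative_eq_intros)
    from vector_derivative_at[OF this] show ?thesis unfolding dx_def inner_axis' by simp
  qed
  define Kc where "Kc = err_const c (dens_const c m q B) B V C1 c0 G (Tp - Tm)"
  show ?thesis
  proof (intro allI impI)
    fix \<epsilon> :: real assume \<epsilon>: "\<epsilon> > 0"
    \<comment> \<open>With this choice the error \<open>Kc * d\<close> is at most half of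
      \<open>\<epsilon>\<close>; the absolute value plus 1 keeps the denominator positive.\<close>
    define d where "d = min 1 (\<epsilon> / (2 * (\<bar>Kc\<bar> + 1)))"
    have d: "d > 0" "d \<le> 1" using \<epsilon> by (auto simp: d_def)
    have Kd: "Kc * d < \<epsilon>"
    proof -
      have "Kc * d \<le> (\<bar>Kc\<bar> + 1) * (\<epsilon> / (2 * (\<bar>Kc\<bar> + 1)))"
        using d by (intro mult_mono) (auto simp: d_def)
      also have "\<dots> = \<epsilon> / 2" by (simp add: field_simps)
      finally show ?thesis using \<epsilon> by simp
    qed
    have "\<forall>\<^sub>F n in sequentially. R n < d" using order_tendstoD(2)[OF R_lim d(1)] .
    moreover note cond_ii[rule_format, OF d(1)] charge_conv[rule_format, OF d(1)] phi_conv[rule_format, OF d(1)]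
      eventually_ge_at_top[of n0]
    ultimately show "\<forall>\<^sub>F n in sequentially. \<forall>t0\<in>{Tm..Tp}. \<forall>t\<in>{Tm..Tp}.
     norm ((Ebar c m q (chi n) (a n) G1 (phi n) (psi n) rhat (R n) t / c\<^sup>2) *\<^sub>R
              vector_derivative (ergocenter c m q (chi n) (a n) G1 (phi n) (psi n) rhat (R n))
                (at t within {Tm..Tp})
         - (Ebar c m q (chi n) (a n) G1 (phi n) (psi n) rhat (R n) t0 / c\<^sup>2) *\<^sub>R
              vector_derivative (ergocenter c m q (chi n) (a n) G1 (phi n) (psi n) rhat (R n))
                (at t0 within {Tm..Tp})
         + oint t0 t (\<lambda>s. rho_inf *\<^sub>R gphi s)) < \<epsilon>"
    proof eventually_elim
      case (elim n)
      obtain U1 Dp D2p where U1: "open U1" "tube Tm Tp rhat (R n) \<subseteq> U1"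
        and Dp: "\<And>z. z \<in> U1 \<Longrightarrow> ((\<lambda>(t, x). psi n t x) has_derivative blinfun_apply (Dp z)) (at z)"
        and D2p: "\<And>z. z \<in> U1 \<Longrightarrow> (Dp has_derivative blinfun_apply (D2p z)) (at z)"
        and cD2p: "continuous_on U1 D2p"
        using psi_C2[rule_format, of n] unfolding C2_closed_def C2_on_def by blast
      obtain U2 Df D2f where U2: "open U2" "tube Tm Tp rhat (R n) \<subseteq> U2"
        and Df: "\<And>z. z \<in> U2 \<Longrightarrow> ((\<lambda>(t, x). phi n t x) has_derivative blinfun_apply (Df z)) (at z)"
        and D2f: "\<And>z. z \<in> U2 \<Longrightarrow> (Df has_derivative blinfun_apply (D2f z)) (at z)"
        using phi_C2[rule_format, of n] unfolding C2_closed_def C2_on_def by blast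
      have cDf: "continuous_on U2 Df"
        using D2f by (meson has_derivative_at_withinI has_derivative_continuous_on)
      have dphi_d: "\<bar>dx i (phi n) t x - gphi t $ i\<bar> \<le> d" if tx: "(t, x) \<in> tube Tm Tp rhat (R n)" for t x i
      proof -
        let ?r = "(dt (phi n) t x - vector_derivative (\<lambda>s. phi0 s + (x - rhat s) \<bullet> gphi s) (at t within {Tm..Tp}))\<^sup>2 / c\<^sup>2"
        let ?S = "\<Sum>i\<in>UNIV. (dx i (phi n) t x - gphi t $ i)\<^sup>2"
        have "\<bar>phi n t x - (phi0 t + (x - rhat t) \<bullet> gphi t)\<bar> + sqrt (?r + ?S) < d"
          using elim(4) tx unfolding dxlin by blast
        moreover have "(dx i (phi n) t x - gphi t $ i)\<^sup>2 \<le> ?S"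
          using member_le_sum[of i UNIV "\<lambda>i. (dx i (phi n) t x - gphi t $ i)\<^sup>2"] by simp
        then have "(dx i (phi n) t x - gphi t $ i)\<^sup>2 \<le> ?r + ?S"
          by (rule order_trans) simp
        from real_sqrt_le_mono[OF this] have "\<bar>dx i (phi n) t x - gphi t $ i\<bar> \<le> sqrt (?r + ?S)"
          by (simp only: real_sqrt_abs)
        ultimately show ?thesis by linarith
      qed
      \<comment> \<open>The wave function and the potential come with their own open neighbourhoods
        of the tube; the intersection serves both.\<close>
      interpret kg_estimates c m q "chi n" "a n" Tm Tp "R n" G1 dG1 rhat v "phi n" "psi n" "U1 \<inter> U2" Dp D2p Df
        B V C1 c0 d rho_inf G gphi
      proof
        show "\<And>w. ((\<lambda>w. Ga G1 (a n) ((cmod w)\<^sup>2)) has_derivative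
            (\<lambda>h. 2 * ((dGa dG1 (a n) ((cmod w)\<^sup>2) *\<^sub>R w) \<bullet> h))) (at w)"
          and "continuous_on UNIV (\<lambda>w. dGa dG1 (a n) ((cmod w)\<^sup>2) *\<^sub>R w)"
          using Ga_gradient[OF G1_deriv D Dh _ a_pos[rule_format, of n]] by simp_all
        show "\<And>t x. (t, x) \<in> tube Tm Tp rhat (R n) \<Longrightarrow> KG c m q (chi n) (a n) dG1 (phi n) (psi n) t x = 0"
          using psi_KG by blast
        show "\<And>t. t \<in> {Tm..Tp} \<Longrightarrow> \<bar>rhobar c m q (chi n) (phi n) (psi n) rhat (R n) t - rho_inf\<bar> \<le> d"
          using elim(3) less_imp_le by blast
      qed (use c_pos m_pos chi_pos R_pos U1 U2 Dp D2p Df TT dxB V C1 c0 n0 elim(1,2,5) d dphi_d G cgphi rh cv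
            continuous_on_subset[OF cD2p] continuous_on_subset[OF cDf] in \<open>auto intro: less_imp_le\<close>)
      show ?case
        using le_less_trans[OF ergocenter_momentum_law Kd[unfolded Kc_def]] by blast
    qed
  qed
qed

end
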